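(* Let $P=\mathbb F_3^4$ with the symplectic form $\omega(x,y)=x_0y_1-x_1y_0+x_2y_3-x_3y_2$. Every indexed list $U$ of at most sixteen nonzero vectors in $P$ admits an edge potential.
   Context: Let $U=(u_i)_{i\in I}$ be an indexed list of nonzero vectors of $P$ (repeated values are allowed and count as different indices). Vectors $x,y$ are nonorthogonal if $\omega(x,y)\neq0$. A triple of indices $\{i,j,k\}$ is balanced if $\omega(u_i,u_j)=\omega(u_j,u_k)=\omega(u_k,u_i)\ne0$ (this does not depend on the chosen ordering of the triple). A balanced triple is called dependent or independent according to whether $u_i,u_j,u_k$ are linearly dependent or independent; the sum $u_i+u_j+u_k$ is zero exactly in the dependent case. Let $\mathcal A(U)$ be the set consisting of all dependent balanced triples, together with those independent balanced triples, of sum $h=u_i+u_j+u_k$, for which $U$ contains an occurrence of $-h$ or at least two occurrences of $h$. An edge potential (or potential) for $U$ is a choice of $\rho_{ij}\in\mathbb F_3$ for every unordered pair of indices $\{i,j\}$ with $\omega(u_i,u_j)\ne0$ such that $\rho_{ij}+\rho_{ik}+\rho_{jk}=1$ for every $\{i,j,k\}\in\mathcal A(U)$. *)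

theory Defs
  imports "HOL-Analysis.Cartesian_Space"
begin

text \<open>The library equips the three-element type \<open>Enum.finite_3\<close> with the structure of a field;
  it is the prime field of order three.\<close>

type_synonym F3 = Enum.finite_3

text \<open>In the index type \<open>4\<close>, the numerals \<open>0, 1, 2, 3\<close> denote the four distinct indices.\<close>

type_synonym P = "F3 ^ 4"

definition \<omega> :: "P \<Rightarrow> P \<Rightarrow> F3" where
  "\<omega> x y = x $ 0 * y $ 1 - x $ 1 * y $ 0 + x $ 2 * y $ 3 - x $ 3 * y $ 2"

text \<open>An indexed list \<open>(u\<^sub>i)\<^sub>i\<^sub>\<in>\<^sub>I\<close> is given by an index set \<open>I\<close> and a function \<open>u\<close>, which
  is only consulted on \<open>I\<close>.\<close>

definition balanced :: "'i set \<Rightarrow> ('i \<Rightarrow> P) \<Rightarrow> 'i \<Rightarrow> 'i \<Rightarrow> 'i \<Rightarrow> bool" where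
  "balanced I u i j k \<longleftrightarrow> i \<in> I \<and> j \<in> I \<and> k \<in> I \<and> distinct [i, j, k] \<and>
     \<omega> (u i) (u j) = \<omega> (u j) (u k) \<and> \<omega> (u j) (u k) = \<omega> (u k) (u i) \<and> \<omega> (u k) (u i) \<noteq> 0"

text \<open>In a balanced triple the three vectors are pairwise nonorthogonal, hence pairwise distinct,
  so linear dependence of the family \<open>u\<^sub>i, u\<^sub>j, u\<^sub>k\<close> is linear dependence of the set of its values.\<close>

definition dependent_triples :: "'i set \<Rightarrow> ('i \<Rightarrow> P) \<Rightarrow> 'i set set" where
  "dependent_triples I u =
     {{i, j, k} | i j k. balanced I u i j k \<and> vec.dependent {u i, u j, u k}}"

definition active_independent_triples :: "'i set \<Rightarrow> ('i \<Rightarrow> P) \<Rightarrow> 'i set set" where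
  "active_independent_triples I u =
     {{i, j, k} | i j k. balanced I u i j k \<and> vec.independent {u i, u j, u k} \<and>
        (let h = u i + u j + u k in
           (\<exists>l\<in>I. u l = - h) \<or> (\<exists>l\<in>I. \<exists>m\<in>I. l \<noteq> m \<and> u l = h \<and> u m = h))}"

definition active_triples :: "'i set \<Rightarrow> ('i \<Rightarrow> P) \<Rightarrow> 'i set set" where
  "active_triples I u = dependent_triples I u \<union> active_independent_triples I u"

text \<open>A potential assigns values to unordered pairs of indices \<open>{i, j}\<close>. All pairs occurring in
  the condition below are nonorthogonal, so the values of \<open>\<rho>\<close> on other sets are irrelevant.\<close>

definition edge_potential :: "'i set \<Rightarrow> ('i \<Rightarrow> P) \<Rightarrow> ('i set \<Rightarrow> F3) \<Rightarrow> bool" where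
  "edge_potential I u \<rho> \<longleftrightarrow>
     (\<forall>i j k. {i, j, k} \<in> active_triples I u \<longrightarrow> \<rho> {i, j} + \<rho> {i, k} + \<rho> {j, k} = 1)"

end

theory Submission
  imports Defs
begin

text \<open>The list is first replaced by its set \<open>S\<close> of values, to which \<open>-h\<close> is added for every value \<open>h\<close> that
  occurs twice; this keeps \<open>|S| \<le> 16\<close> and turns every active triple into a balanced triangle of \<open>S\<close> whose
  negated sum lies in \<open>S \<union> {0}\<close>. Potentials are solutions of a linear system over the prime field, so if there is none,
  there is a dual obstruction: a weight on the triangles with zero sum at every edge but nonzero total.

  Take such a weight of minimal support \<open>Y\<close>. Then every edge of a triangle of \<open>Y\<close> lies in a second one, some edge
  lies in three of them (otherwise the weights would lift to integers \<open>\<plusminus>1\<close> and the total would vanish), and an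
  octahedron all of whose faces are triangles of \<open>S\<close> has at most five faces in \<open>Y\<close> (otherwise subtracting the
  alternating weight of the octahedron would shrink the support). In a symplectic basis the three triangles at the heavy edge
  have one of five shapes, and each of them is refuted by a finite search: a triangle of \<open>Y\<close> whose edge lies in no other
  chosen triangle needs a further one, which adds up to two new points to \<open>S\<close>, and at most sixteen points are
  available. The search is an ordinary function, proved sound, and is run by the simplifier.\<close>

text \<open>For a balanced triangle \<open>{a, b, c}\<close> the vector
  \<open>d = -(a + b + c)\<close> is orthogonal to \<open>a\<close>, \<open>b\<close> and
  \<open>c\<close>. So the triangles at an edge \<open>a, b\<close> correspond to the nine vectors
  \<open>d\<close> of the plane orthogonal to \<open>a\<close> and \<open>b\<close>, with third
  vertex \<open>-(a + b + d)\<close>. The shape of a heavy edge is therefore a triple of distinct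
  vectors of a plane over the field, up to symplectic base change, and an open edge has at most
  eight alternatives, each asking for the two points \<open>c\<close> and \<open>d\<close>. The hard
  shape is the fan \<open>d = 0, f, -f\<close>: it determines only the line of \<open>f\<close>, so
  \<open>e\<close> remains free. A further triangle at another edge of the fan is used to fix
  \<open>e\<close> as well, and if all such triangles stay within cosets of \<open>f\<close>, six of
  them with a free sign each are added before searching. Both values of \<open>\<omega> a b\<close>
  occur. Coordinates are scaled by this value, so that one computation covers both signs. The zero
  vector counts as a known point throughout, which turns the bound sixteen into seventeen.\<close>

text \<open>By default the simplifier rewrites \<open>0\<close> and \<open>1\<close> of this type to constructors, out of reach of the rules
  for fields.\<close>

declare zero_finite_3_def [simp del] one_finite_3_def [simp del]

section \<open>Arithmetic of the field with three elements, and linear systems\<close>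

lemma F3_cases: fixes x :: F3 obtains "x = 0" | "x = 1" | "x = -1"
  by (cases x) (auto simp: zero_finite_3_def one_finite_3_def uminus_finite_3_def)

lemma F3_triple [simp]: fixes x :: F3 shows "x + (x + x) = 0" "x + x + x = 0"
  by (cases x; simp add: zero_finite_3_def plus_finite_3_def)+

lemma F3_one_neq [simp]: "(1::F3) \<noteq> -1" "(-1::F3) \<noteq> 1" "(-1::F3) \<noteq> 0"
  by (simp_all add: one_finite_3_def uminus_finite_3_def zero_finite_3_def)

lemma F3_double: fixes x :: F3 shows "x + x = - x"
  by (cases x) (simp_all add: plus_finite_3_def uminus_finite_3_def)

lemma F3_square: fixes x :: F3 assumes "x \<noteq> 0" shows "x * x = 1"
  using assms by (cases x rule: F3_cases) auto

text \<open>The Fredholm alternative, by Gaussian elimination on the rows: a zero row forces its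
  right-hand side to vanish, any other row supplies a pivot column \<open>p\<close> that is
  eliminated from the remaining rows.\<close>

lemma linear_alternative:
  fixes f :: "'r \<Rightarrow> 'c \<Rightarrow> 'k::field"
  assumes "finite R" "finite C"
    and "\<And>y. \<forall>c\<in>C. (\<Sum>r\<in>R. y r * f r c) = 0 \<Longrightarrow> (\<Sum>r\<in>R. y r * b r) = 0"
  shows "\<exists>x. \<forall>r\<in>R. (\<Sum>c\<in>C. f r c * x c) = b r"
  using assms
proof (induction R arbitrary: f b)
  case empty
  then show ?case by simp
next
  case (insert t R)
  have upd: "(\<Sum>r\<in>insert t R. (y(t := s)) r * h r) = s * h t + (\<Sum>r\<in>R. y r * h r)"
    for y h :: "'r \<Rightarrow> 'k" and s
  proof -
    have "(\<Sum>r\<in>R. (y(t := s)) r * h r) = (\<Sum>r\<in>R. y r * h r)"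
      using insert.hyps by (intro sum.cong) auto
    then show ?thesis using insert.hyps by simp
  qed
  show ?case
  proof (cases "\<forall>c\<in>C. f t c = 0")
    case True
    have bt: "b t = 0"
      using insert.prems(2)[of "(\<lambda>_. 0)(t := 1)"] True unfolding upd by simp
    have "\<exists>x. \<forall>r\<in>R. (\<Sum>c\<in>C. f r c * x c) = b r"
    proof (rule insert.IH)
      fix y assume y: "\<forall>c\<in>C. (\<Sum>r\<in>R. y r * f r c) = 0"
      show "(\<Sum>r\<in>R. y r * b r) = 0"
        using insert.prems(2)[of "y(t := 0)"] y unfolding upd by simp
    qed fact
    then obtain x where "\<forall>r\<in>R. (\<Sum>c\<in>C. f r c * x c) = b r" by blast
    then show ?thesis using True bt by (intro exI[of _ x]) auto
  next
    case False
    then obtain p where p: "p \<in> C" "f t p \<noteq> 0" by blast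
    define k where "k r = f r p / f t p" for r
    define g where "g r c = f r c - k r * f t c" for r c
    have gp: "g r p = 0" for r using p by (simp add: g_def k_def)
    have "\<exists>x. \<forall>r\<in>R. (\<Sum>c\<in>C. g r c * x c) = b r - k r * b t"
    proof (rule insert.IH)
      fix y assume y: "\<forall>c\<in>C. (\<Sum>r\<in>R. y r * g r c) = 0"
      \<comment> \<open>The multiples of row \<open>t\<close> subtracted in forming \<open>g\<close>
        are collected in the weight of \<open>t\<close>; this turns a dual weight of the reduced
        system into one of the full system, with the same value on the right-hand side.\<close>
      define s where "s = - (\<Sum>r\<in>R. y r * k r)"
      define y' where "y' = y(t := s)"
      have split: "(\<Sum>r\<in>insert t R. y' r * h r) = (\<Sum>r\<in>R. y r * (h r - k r * h t))" for h :: "'r \<Rightarrow> 'k"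
      proof -
        have "(\<Sum>r\<in>insert t R. y' r * h r) = s * h t + (\<Sum>r\<in>R. y r * h r)"
          unfolding y'_def by (rule upd)
        also have "\<dots> = (\<Sum>r\<in>R. y r * (h r - k r * h t))"
          by (simp add: s_def sum_distrib_right sum_distrib_left sum_subtractf algebra_simps)
        finally show ?thesis .
      qed
      have "(\<Sum>r\<in>insert t R. y' r * b r) = 0"
        using y by (intro insert.prems(2)) (simp add: split g_def)
      then show "(\<Sum>r\<in>R. y r * (b r - k r * b t)) = 0" by (simp add: split)
    qed fact
    then obtain x where x: "\<And>r. r \<in> R \<Longrightarrow> (\<Sum>c\<in>C. g r c * x c) = b r - k r * b t" by blast
    \<comment> \<open>Back substitution: column \<open>p\<close> vanishes in every
      \<open>g r\<close>, so \<open>x p\<close> can be adjusted to row \<open>t\<close> without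
      disturbing the other rows.\<close>
    define w where "w = (b t - (\<Sum>c\<in>C - {p}. f t c * x c)) / f t p"
    define x' where "x' = x(p := w)"
    have t: "(\<Sum>c\<in>C. f t c * x' c) = b t"
    proof -
      have "(\<Sum>c\<in>C - {p}. f t c * x' c) = (\<Sum>c\<in>C - {p}. f t c * x c)"
        by (intro sum.cong) (auto simp: x'_def)
      then show ?thesis
        using p \<open>finite C\<close> by (simp add: sum.remove[of C p] x'_def w_def)
    qed
    have "(\<Sum>c\<in>C. f r c * x' c) = b r" if "r \<in> R" for r
    proof -
      have "(\<Sum>c\<in>C. g r c * x' c) = (\<Sum>c\<in>C. g r c * x c)"
        using gp by (intro sum.cong) (auto simp: x'_def)
      moreover have "(\<Sum>c\<in>C. g r c * x' c) = (\<Sum>c\<in>C. f r c * x' c) - k r * (\<Sum>c\<in>C. f t c * x' c)"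
        by (simp add: g_def sum_subtractf sum_distrib_left algebra_simps)
      ultimately show ?thesis using x[OF that] t by simp
    qed
    with t show ?thesis by auto
  qed
qed

section \<open>The symplectic form and symplectic bases\<close>

lemma \<omega>_add [simp]: "\<omega> (x + y) w = \<omega> x w + \<omega> y w" "\<omega> w (x + y) = \<omega> w x + \<omega> w y"
  by (simp_all add: \<omega>_def algebra_simps)

lemma \<omega>_uminus [simp]: "\<omega> (- x) w = - \<omega> x w" "\<omega> w (- x) = - \<omega> w x"
  by (simp_all add: \<omega>_def algebra_simps)

lemma \<omega>_diff [simp]: "\<omega> (x - y) w = \<omega> x w - \<omega> y w" "\<omega> w (x - y) = \<omega> w x - \<omega> w y"
  by (simp_all add: \<omega>_def algebra_simps)

lemma \<omega>_scale [simp]: "\<omega> (k *s x) w = k * \<omega> x w" "\<omega> w (k *s x) = k * \<omega> w x"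
  by (simp_all add: \<omega>_def algebra_simps)

lemma \<omega>_self [simp]: "\<omega> x x = 0"
  by (simp add: \<omega>_def algebra_simps)

lemma \<omega>_zero [simp]: "\<omega> 0 x = 0" "\<omega> x 0 = 0"
  by (simp_all add: \<omega>_def)

lemma \<omega>_swap: "\<omega> y x = - \<omega> x y"
  by (simp add: \<omega>_def algebra_simps)

lemma P_triple [simp]: fixes x :: P shows "x + (x + x) = 0" "x + x + x = 0"
  by (simp_all only: vec_eq_iff vector_add_component F3_triple zero_index simp_thms)

lemma P_double: fixes x :: P shows "x + x = - x"
  by (simp only: vec_eq_iff vector_add_component F3_double vector_uminus_component simp_thms)

text \<open>\<open>forall_4\<close> enumerates the indices from 1 to 4, and 4 is 0 in this
  type.\<close>

lemma all_index_4: "(\<forall>i::4. Q i) \<longleftrightarrow> Q 0 \<and> Q 1 \<and> Q 2 \<and> Q 3"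
proof -
  have "iszero (4::4)" by simp
  then have "(4::4) = 0" by (simp only: iszero_def)
  then show ?thesis unfolding forall_4 by (simp only:) blast
qed

lemma \<omega>_nondegenerate:
  assumes "\<And>y. \<omega> x y = 0" shows "x = 0"
proof -
  have "\<omega> x (axis 1 1) = 0" "\<omega> x (axis 0 1) = 0" "\<omega> x (axis 3 1) = 0" "\<omega> x (axis 2 1) = 0"
    using assms by auto
  then show ?thesis
    by (simp add: \<omega>_def axis_def vec_eq_iff all_index_4)
qed

text \<open>Pairing with the four vectors recovers the coordinates, so the coordinate map is
  injective, hence surjective on a finite type.\<close>

lemma symplectic_basis_spans:
  assumes "\<omega> a b \<noteq> 0" "\<omega> e f \<noteq> 0" "\<omega> a e = 0" "\<omega> a f = 0" "\<omega> b e = 0" "\<omega> b f = 0"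
  shows "\<exists>i j k l. x = i *s a + j *s b + k *s e + l *s f"
proof -
  define \<psi> where "\<psi> w = w $ 0 *s a + w $ 1 *s b + w $ 2 *s e + w $ 3 *s f" for w :: P
  have sw: "\<omega> b a = - \<omega> a b" "\<omega> f e = - \<omega> e f" "\<omega> e a = 0" "\<omega> f a = 0" "\<omega> e b = 0" "\<omega> f b = 0"
    using assms \<omega>_swap by (metis neg_equal_0_iff_equal)+
  have "inj \<psi>"
  proof (rule injI)
    fix v w assume "\<psi> v = \<psi> w"
    then have "\<omega> (\<psi> v) u = \<omega> (\<psi> w) u" for u by simp
    from this[of a] this[of b] this[of e] this[of f] show "v = w"
      using assms sw by (simp add: \<psi>_def vec_eq_iff all_index_4)
  qed
  then have "surj \<psi>" by (simp add: finite_UNIV_inj_surj)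
  then show ?thesis unfolding \<psi>_def surj_def by blast
qed

lemma symplectic_partner:
  assumes "d \<noteq> 0" "\<omega> a b \<noteq> 0" "\<omega> a d = 0" "\<omega> b d = 0" "s \<noteq> 0"
  shows "\<exists>e. \<omega> a e = 0 \<and> \<omega> b e = 0 \<and> \<omega> e d = s"
proof -
  obtain x where x: "\<omega> d x \<noteq> 0" using \<omega>_nondegenerate assms(1) by blast
  \<comment> \<open>The projection of \<open>x\<close> to the complement of \<open>a, b\<close>. It
    keeps the pairing with \<open>d\<close>, which is orthogonal to both, and only a rescaling is
    left.\<close>
  define y where "y = x - (\<omega> x b / \<omega> a b) *s a + (\<omega> x a / \<omega> a b) *s b"
  have sw: "\<omega> b a = - \<omega> a b" "\<omega> d a = 0" "\<omega> d b = 0" "\<omega> a x = - \<omega> x a" "\<omega> b x = - \<omega> x b" "\<omega> x d = - \<omega> d x"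
    using assms \<omega>_swap by (metis neg_equal_0_iff_equal)+
  have y: "\<omega> a y = 0" "\<omega> b y = 0" "\<omega> y d = - \<omega> d x"
    using assms sw by (simp_all add: y_def)
  show ?thesis
    using x y by (intro exI[of _ "(s / (- \<omega> d x)) *s y"]) simp
qed

subsection \<open>Obstructions of minimal support\<close>

definition bal :: "P \<Rightarrow> P \<Rightarrow> P \<Rightarrow> bool" where
  "bal a b c \<longleftrightarrow> \<omega> a b = \<omega> b c \<and> \<omega> b c = \<omega> c a \<and> \<omega> c a \<noteq> 0"

lemma bal_rotate: "bal a b c \<Longrightarrow> bal b c a"
  by (simp add: bal_def)

text \<open>A transposition negates all three values, so they stay equal and nonzero.\<close>

lemma bal_swap: "bal a b c \<Longrightarrow> bal b a c"
  unfolding bal_def using \<omega>_swap[of a b] \<omega>_swap[of b c] \<omega>_swap[of c a] by simp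

lemma bal_distinct: "bal a b c \<Longrightarrow> a \<noteq> b \<and> b \<noteq> c \<and> a \<noteq> c"
  by (auto simp: bal_def)

lemma three_set_eq:
  assumes "a \<noteq> b" "b \<noteq> c" "a \<noteq> c" "{a, b, c} = {x, y, z}"
  shows "(x = a \<and> (y = b \<and> z = c \<or> y = c \<and> z = b)) \<or> (x = b \<and> (y = a \<and> z = c \<or> y = c \<and> z = a)) \<or>
    (x = c \<and> (y = a \<and> z = b \<or> y = b \<and> z = a))"
proof -
  have "x \<in> {a, b, c}" "y \<in> {a, b, c}" "z \<in> {a, b, c}" "a \<in> {x, y, z}" "b \<in> {x, y, z}" "c \<in> {x, y, z}"
    using assms(4) by blast+
  then show ?thesis using assms(1-3) by simp metis
qed

lemma bal_set: "bal a b c \<Longrightarrow> {a, b, c} = {x, y, z} \<Longrightarrow> bal x y z"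
  using three_set_eq[of a b c x y z] bal_distinct[of a b c] bal_swap bal_rotate by metis

text \<open>The added \<open>0\<close> admits the dependent triples, whose sum vanishes.\<close>

definition tris :: "P set \<Rightarrow> P set set" where
  "tris S = {{a, b, c} | a b c. a \<in> S \<and> b \<in> S \<and> c \<in> S \<and> bal a b c \<and> - (a + b + c) \<in> insert 0 S}"

lemma trisI: "a \<in> S \<Longrightarrow> b \<in> S \<Longrightarrow> c \<in> S \<Longrightarrow> bal a b c \<Longrightarrow> - (a + b + c) \<in> insert 0 S \<Longrightarrow> {a, b, c} \<in> tris S"
  unfolding tris_def by blast

lemma trisD:
  assumes "{x, y, z} \<in> tris S"
  shows "x \<in> S" "y \<in> S" "z \<in> S" "bal x y z" "- (x + y + z) \<in> insert 0 S"
proof -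
  obtain a b c where abc: "{x, y, z} = {a, b, c}" "a \<in> S" "b \<in> S" "c \<in> S" "bal a b c" "- (a + b + c) \<in> insert 0 S"
    using assms unfolding tris_def by blast
  have "{x, y, z} \<subseteq> S" using abc by simp
  then show "x \<in> S" "y \<in> S" "z \<in> S" by simp_all
  show "bal x y z" using bal_set abc by metis
  have "x + y + z = a + b + c"
    using three_set_eq[of a b c x y z] bal_distinct[OF abc(5)] abc(1) by (auto simp: ac_simps)
  then show "- (x + y + z) \<in> insert 0 S" using abc by simp
qed

lemma trisE:
  assumes "T \<in> tris S"
  obtains a b c where "T = {a, b, c}" "bal a b c"
  using assms unfolding tris_def by blast

lemma card_tri: "T \<in> tris S \<Longrightarrow> card T = 3"
  by (elim trisE) (auto dest: bal_distinct)

lemma tris_subset: "T \<in> tris S \<Longrightarrow> T \<subseteq> S"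
  unfolding tris_def by blast

lemma finite_tris [simp]: "finite S \<Longrightarrow> finite (tris S)"
  by (rule finite_subset[of _ "Pow S"]) (auto dest: tris_subset)

lemma pairs_of_three:
  assumes "a \<noteq> b" "b \<noteq> c" "a \<noteq> c"
  shows "{e. e \<subseteq> {a, b, c} \<and> card e = 2} = {{a, b}, {a, c}, {b, c}}"
proof
  show "{e. e \<subseteq> {a, b, c} \<and> card e = 2} \<subseteq> {{a, b}, {a, c}, {b, c}}"
  proof
    fix e assume "e \<in> {e. e \<subseteq> {a, b, c} \<and> card e = 2}"
    then obtain p q where "e = {p, q}" "p \<noteq> q" "p \<in> {a, b, c}" "q \<in> {a, b, c}"
      by (auto simp: card_2_iff)
    then show "e \<in> {{a, b}, {a, c}, {b, c}}" by (auto simp: insert_commute)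
  qed
qed (use assms in auto)

lemma sum_pairs_of_three:
  fixes g :: "'a set \<Rightarrow> 'b::comm_monoid_add"
  assumes "a \<noteq> b" "b \<noteq> c" "a \<noteq> c"
  shows "sum g {e. e \<subseteq> {a, b, c} \<and> card e = 2} = g {a, b} + g {a, c} + g {b, c}"
proof -
  have "{a, b} \<noteq> {a, c}" "{a, b} \<noteq> {b, c}" "{a, c} \<noteq> {b, c}"
    using assms by (auto simp: doubleton_eq_iff)
  then show ?thesis using assms by (simp add: pairs_of_three add.assoc)
qed

text \<open>The kernel of the transposed triangle-edge incidence matrix. Incidences carry no sign,
  because a potential adds its three edge values without orientation.\<close>

definition cyc :: "P set \<Rightarrow> (P set \<Rightarrow> F3) \<Rightarrow> bool" where
  "cyc S y \<longleftrightarrow> (\<forall>e. card e = 2 \<longrightarrow> (\<Sum>T\<in>tris S. if e \<subseteq> T then y T else 0) = 0)"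

text \<open>\<open>linear_alternative\<close> with one equation per triangle, one unknown per edge
  and right-hand sides 1; a cycle pairs with these to its total.\<close>

lemma potential_or_cycle:
  assumes "finite S" "\<And>y. cyc S y \<Longrightarrow> sum y (tris S) = 0"
  shows "\<exists>R. \<forall>a b c. {a, b, c} \<in> tris S \<longrightarrow> R {a, b} + R {a, c} + R {b, c} = (1::F3)"
proof -
  define C where "C = {e. e \<subseteq> S \<and> card e = 2}"
  have "\<exists>R. \<forall>T\<in>tris S. (\<Sum>e\<in>C. (if e \<subseteq> T then 1 else 0) * R e) = (1::F3)"
  proof (rule linear_alternative)
    show "finite (tris S)" "finite C" using assms(1) by (auto simp: C_def)
    fix y :: "P set \<Rightarrow> F3" assume y: "\<forall>e\<in>C. (\<Sum>T\<in>tris S. y T * (if e \<subseteq> T then 1 else 0)) = 0"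
    have "cyc S y" unfolding cyc_def
    proof (intro allI impI)
      fix e :: "P set" assume e: "card e = 2"
      show "(\<Sum>T\<in>tris S. if e \<subseteq> T then y T else 0) = 0"
      proof (cases "e \<subseteq> S")
        case True
        then have "(\<Sum>T\<in>tris S. y T * (if e \<subseteq> T then 1 else 0)) = 0" using y e by (auto simp: C_def)
        moreover have "(\<Sum>T\<in>tris S. y T * (if e \<subseteq> T then 1 else 0)) = (\<Sum>T\<in>tris S. if e \<subseteq> T then y T else 0)"
          by (intro sum.cong) auto
        ultimately show ?thesis by simp
      next
        case False
        then show ?thesis by (intro sum.neutral) (use tris_subset in auto)
      qed
    qed
    then show "(\<Sum>T\<in>tris S. y T * 1) = 0" using assms(2) by simp
  qed
  then obtain R where R: "\<And>T. T \<in> tris S \<Longrightarrow> (\<Sum>e\<in>C. (if e \<subseteq> T then 1 else 0) * R e) = (1::F3)" by blast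
  have "R {a, b} + R {a, c} + R {b, c} = 1" if "{a, b, c} \<in> tris S" for a b c
  proof -
    have d: "a \<noteq> b" "b \<noteq> c" "a \<noteq> c" using trisD(4)[OF that] bal_distinct by blast+
    have "(\<Sum>e\<in>C. (if e \<subseteq> {a, b, c} then 1 else 0) * R e) = sum R {e. e \<subseteq> {a, b, c} \<and> card e = 2}"
      using assms(1) tris_subset[OF that]
      by (intro sum.mono_neutral_cong_right) (auto simp: C_def)
    then show ?thesis using R[OF that] sum_pairs_of_three[OF d, of R] by simp
  qed
  then show ?thesis by (intro exI[of _ R] allI impI)
qed

text \<open>Subtracting a cycle of total zero yields another obstruction, so \<open>minimal\<close>
  says that no such change can shrink the support.\<close>

locale min_cycle =
  fixes S :: "P set" and y :: "P set \<Rightarrow> F3"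
  assumes fin: "finite S" and cyc: "cyc S y" and total: "sum y (tris S) \<noteq> 0"
    and minimal: "\<And>y'. cyc S y' \<Longrightarrow> sum y' (tris S) \<noteq> 0 \<Longrightarrow>
      card {T \<in> tris S. y T \<noteq> 0} \<le> card {T \<in> tris S. y' T \<noteq> 0}"
begin

definition Y where "Y = {T \<in> tris S. y T \<noteq> 0}"

lemma Y_tris: "T \<in> Y \<Longrightarrow> T \<in> tris S"
  by (simp add: Y_def)

lemma finite_Y [simp]: "finite Y"
  using fin by (simp add: Y_def)

lemma other_triangle:
  assumes T: "T \<in> Y" and e: "e \<subseteq> T" "card e = 2"
  shows "\<exists>T'\<in>Y. T' \<noteq> T \<and> e \<subseteq> T'"
proof (rule ccontr)
  assume no: "\<not> ?thesis"
  have "(\<Sum>T'\<in>tris S. if e \<subseteq> T' then y T' else 0) = (\<Sum>T'\<in>tris S. if T' = T then y T else 0)"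
    using no e by (intro sum.cong) (auto simp: Y_def)
  also have "\<dots> = y T" using T fin by (simp add: Y_def)
  finally show False using cyc e(2) T by (auto simp: cyc_def Y_def)
qed

text \<open>Double counting: a triangle has three edges. The weights are integers because the factor
  3 must be cancelled afterwards, which is impossible in \<open>F3\<close>.\<close>

lemma sum_over_edges:
  fixes z :: "P set \<Rightarrow> int"
  shows "(\<Sum>e\<in>{e. e \<subseteq> S \<and> card e = 2}. \<Sum>T\<in>Y. if e \<subseteq> T then z T else 0) = 3 * sum z Y"
proof -
  have "(\<Sum>e\<in>{e. e \<subseteq> S \<and> card e = 2}. \<Sum>T\<in>Y. if e \<subseteq> T then z T else 0) =
      (\<Sum>T\<in>Y. \<Sum>e\<in>{e. e \<subseteq> S \<and> card e = 2}. if e \<subseteq> T then z T else 0)"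
    by (rule sum.swap)
  also have "\<dots> = (\<Sum>T\<in>Y. 3 * z T)"
  proof (rule sum.cong)
    fix T assume "T \<in> Y"
    then obtain a b c where T: "T = {a, b, c}" "bal a b c" "T \<subseteq> S"
      using Y_tris trisE tris_subset by metis
    have "(\<Sum>e\<in>{e. e \<subseteq> S \<and> card e = 2}. if e \<subseteq> T then z T else 0) =
        (\<Sum>e\<in>{e. e \<subseteq> {a, b, c} \<and> card e = 2}. z T)"
      using fin T by (intro sum.mono_neutral_cong_right) auto
    also have "\<dots> = 3 * z T"
      using sum_pairs_of_three[of a b c "\<lambda>_. z T"] bal_distinct[OF T(2)] by simp
    finally show "(\<Sum>e\<in>{e. e \<subseteq> S \<and> card e = 2}. if e \<subseteq> T then z T else 0) = 3 * z T" .
  qed simp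
  finally show ?thesis by (simp add: sum_distrib_left)
qed

text \<open>Otherwise each edge in question lies in exactly two triangles, with opposite weights; so the integer lifts of
  the weights sum to zero at every edge, and three times their total is zero.\<close>

lemma heavy_edge: "\<exists>e. card e = 2 \<and> (\<exists>T1\<in>Y. \<exists>T2\<in>Y. \<exists>T3\<in>Y. T1 \<noteq> T2 \<and> T2 \<noteq> T3 \<and> T1 \<noteq> T3 \<and> e \<subseteq> T1 \<and> e \<subseteq> T2 \<and> e \<subseteq> T3)"
proof (rule ccontr)
  assume no: "\<not> ?thesis"
  define z :: "P set \<Rightarrow> int" where "z T = (if y T = 0 then 0 else if y T = 1 then 1 else -1)" for T
  have yz: "y T = of_int (z T)" for T
    by (cases "y T" rule: F3_cases) (simp_all add: z_def)
  have zero: "(\<Sum>T\<in>Y. if e \<subseteq> T then z T else 0) = 0" if e: "card e = 2" for e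
  proof (cases "\<exists>T\<in>Y. e \<subseteq> T")
    case True
    then obtain T1 where T1: "T1 \<in> Y" "e \<subseteq> T1" by blast
    then obtain T2 where T2: "T2 \<in> Y" "e \<subseteq> T2" "T2 \<noteq> T1" using other_triangle[OF T1 e] by blast
    \<comment> \<open>Polymorphic in the weights, since it serves \<open>y\<close> over
      \<open>tris S\<close> in the field and \<open>z\<close> over \<open>Y\<close> in the
      integers.\<close>
    have ex: "(\<Sum>T\<in>A. if e \<subseteq> T then g T else 0) = g T1 + g T2"
      if "Y \<subseteq> A" "finite A" "\<And>T. T \<in> A - Y \<Longrightarrow> g T = 0" for A and g :: "P set \<Rightarrow> 'b::comm_monoid_add"
    proof -
      have only: "T = T1 \<or> T = T2" if "T \<in> Y" "e \<subseteq> T" for T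
        using no e T1 T2 that by metis
      have "(\<Sum>T\<in>A. if e \<subseteq> T then g T else 0) = sum g {T1, T2}"
      proof (rule sum.mono_neutral_cong_right)
        show "{T1, T2} \<subseteq> A" using T1 T2 that by auto
        show "\<forall>T\<in>A - {T1, T2}. (if e \<subseteq> T then g T else 0) = 0"
          using only that(3) by auto
      qed (use T1 T2 that in auto)
      then show ?thesis using T2 by simp
    qed
    have "y T1 + y T2 = 0"
    proof -
      have "Y \<subseteq> tris S" "finite (tris S)" "\<And>T. T \<in> tris S - Y \<Longrightarrow> y T = 0"
        using fin by (auto simp: Y_def)
      from ex[OF this] have "(\<Sum>T\<in>tris S. if e \<subseteq> T then y T else 0) = y T1 + y T2" .
      moreover have "(\<Sum>T\<in>tris S. if e \<subseteq> T then y T else 0) = 0"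
        using cyc[unfolded cyc_def, rule_format, OF e] .
      ultimately show ?thesis by (rule trans[OF sym])
    qed
    then have "y T2 = - y T1" by (simp add: add_eq_0_iff)
    moreover have "y T1 \<noteq> 0" using T1 by (simp add: Y_def)
    ultimately have "z T1 + z T2 = 0"
      by (cases "y T1" rule: F3_cases) (simp_all add: z_def)
    then show ?thesis using ex[of Y z] by simp
  next
    case False
    then show ?thesis by (intro sum.neutral) auto
  qed
  have "3 * sum z Y = 0"
    unfolding sum_over_edges[symmetric] by (intro sum.neutral) (use zero in auto)
  then have "sum z Y = 0" by simp
  moreover have "sum y (tris S) = sum y Y"
    using fin by (intro sum.mono_neutral_right) (auto simp: Y_def)
  moreover have "sum y Y = of_int (sum z Y)" by (simp add: yz)
  ultimately show False using total by simp
qed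

text \<open>The eight faces are two-coloured as \<open>O1\<close> and \<open>O2\<close> so that
  faces sharing an edge differ in colour. Weights 1 and -1 then cancel at every edge, and four faces
  of each colour give total zero.\<close>

lemma octahedron:
  assumes d: "a \<noteq> a'" "b \<noteq> b'" "c \<noteq> c'"
    and act: "\<And>p q r. p \<in> {a, a'} \<Longrightarrow> q \<in> {b, b'} \<Longrightarrow> r \<in> {c, c'} \<Longrightarrow> {p, q, r} \<in> tris S"
    and six: "6 \<le> (\<Sum>p\<in>{a, a'}. \<Sum>q\<in>{b, b'}. \<Sum>r\<in>{c, c'}. of_bool ({p, q, r} \<in> Y) :: nat)"
  shows False
proof -
  define O1 where "O1 = {{a, b, c}, {a, b', c'}, {a', b, c'}, {a', b', c}}"
  define O2 where "O2 = {{a', b', c'}, {a', b, c}, {a, b', c}, {a, b, c'}}"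
  have dis: "p \<noteq> q \<and> q \<noteq> r \<and> p \<noteq> r" if "p \<in> {a, a'}" "q \<in> {b, b'}" "r \<in> {c, c'}" for p q r
    using bal_distinct[OF trisD(4)[OF act[OF that]]] by blast
  have ds: "a \<noteq> b" "a \<noteq> b'" "a \<noteq> c" "a \<noteq> c'" "a' \<noteq> b" "a' \<noteq> b'" "a' \<noteq> c" "a' \<noteq> c'" "b \<noteq> c" "b \<noteq> c'" "b' \<noteq> c" "b' \<noteq> c'"
    using dis[of a b c] dis[of a b' c'] dis[of a' b c'] dis[of a' b' c] by auto
  note ne = d ds d[symmetric] ds[symmetric]
  have all: "{{p, q, r} | p q r. p \<in> {a, a'} \<and> q \<in> {b, b'} \<and> r \<in> {c, c'}} = O1 \<union> O2" (is "?L = _")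
  proof (rule set_eqI)
    fix X
    have "X \<in> ?L \<longleftrightarrow> (\<exists>p\<in>{a, a'}. \<exists>q\<in>{b, b'}. \<exists>r\<in>{c, c'}. X = {p, q, r})" by blast
    then show "X \<in> ?L \<longleftrightarrow> X \<in> O1 \<union> O2" unfolding O1_def O2_def by (simp only: bex_simps Un_iff insert_iff empty_iff) argo
  qed
  have sub: "O1 \<union> O2 \<subseteq> tris S" unfolding all[symmetric] using act by blast
  \<comment> \<open>Ordered triples make the sums over \<open>O1\<close> and \<open>O2\<close>
    expand. Distinct triples name distinct faces, as the three pairs of opposite vertices are
    disjoint.\<close>
  define G where "G = (\<lambda>(p, q, r). {p, q, r} :: P set)"
  define A1 where "A1 = {(a, b, c), (a, b', c'), (a', b, c'), (a', b', c)}"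
  define A2 where "A2 = {(a', b', c'), (a', b, c), (a, b', c), (a, b, c')}"
  have OG: "O1 = G ` A1" "O2 = G ` A2"
    by (simp_all add: O1_def O2_def A1_def A2_def G_def)
  have inj: "inj_on G (A1 \<union> A2)"
  proof (rule inj_onI)
    have sub: "A1 \<union> A2 \<subseteq> {a, a'} \<times> {b, b'} \<times> {c, c'}" by (simp add: A1_def A2_def)
    have dj: "{a, a'} \<inter> {b, b'} = {}" "{a, a'} \<inter> {c, c'} = {}" "{b, b'} \<inter> {c, c'} = {}" using ne by auto
    fix s t assume st: "s \<in> A1 \<union> A2" "t \<in> A1 \<union> A2" "G s = G t"
    obtain p q r p' q' r' where s: "s = (p, q, r)" and t: "t = (p', q', r')"
      by (cases s, cases t) blast
    from st sub have "s \<in> {a, a'} \<times> {b, b'} \<times> {c, c'}" "t \<in> {a, a'} \<times> {b, b'} \<times> {c, c'}" by blast+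
    then have m: "p \<in> {a, a'}" "q \<in> {b, b'}" "r \<in> {c, c'}" "p' \<in> {a, a'}" "q' \<in> {b, b'}" "r' \<in> {c, c'}"
      unfolding s t by blast+
    have eq: "{p, q, r} = {p', q', r'}" using st(3) unfolding s t G_def by simp
    from eq have "p \<in> {p', q', r'}" "q \<in> {p', q', r'}" "r \<in> {p', q', r'}" by blast+
    then show "s = t" unfolding s t using m dj by blast
  qed
  note inj1 = inj_on_subset[OF inj Un_upper1] and inj2 = inj_on_subset[OF inj Un_upper2]
  have disj: "O1 \<inter> O2 = {}"
    unfolding OG using inj d by (subst inj_on_image_Int[OF inj, symmetric]) (auto simp: A1_def A2_def)
  have card4: "card O1 = 4" "card O2 = 4"
    unfolding OG card_image[OF inj1] card_image[OF inj2] using d d[symmetric] by (simp_all add: A1_def A2_def)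
  \<comment> \<open>The alternating weight is a cycle of total \<open>0\<close>. It agrees up to one sign with \<open>y\<close> on three of the
    at least six faces in the support, and at most two new faces appear when it is subtracted.\<close>
  define w :: "P set \<Rightarrow> F3" where "w T = (if T \<in> O1 then 1 else if T \<in> O2 then -1 else 0)" for T
  have sum_w: "(\<Sum>T\<in>tris S. if Q T then w T else 0) =
      (\<Sum>T\<in>O1. if Q T then 1 else 0) - (\<Sum>T\<in>O2. if Q T then 1 else 0)" for Q
  proof -
    have "(\<Sum>T\<in>tris S. if Q T then w T else 0) = (\<Sum>T\<in>O1 \<union> O2. if Q T then w T else 0)"
      using fin sub by (intro sum.mono_neutral_right) (auto simp: w_def)
    also have "\<dots> = (\<Sum>T\<in>O1. if Q T then w T else 0) + (\<Sum>T\<in>O2. if Q T then w T else 0)"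
      using disj by (intro sum.union_disjoint) (auto simp: O1_def O2_def)
    also have "(\<Sum>T\<in>O1. if Q T then w T else 0) = (\<Sum>T\<in>O1. if Q T then 1 else 0)"
      by (intro sum.cong) (auto simp: w_def)
    also have "(\<Sum>T\<in>O2. if Q T then w T else 0) = (\<Sum>T\<in>O2. - (if Q T then 1 else 0))"
      using disj by (intro sum.cong) (auto simp: w_def)
    finally show ?thesis by (simp add: sum_negf)
  qed
  have s1: "(\<Sum>T\<in>O1. g T) = g {a, b, c} + g {a, b', c'} + g {a', b, c'} + g {a', b', c}" for g :: "P set \<Rightarrow> 'b::comm_monoid_add"
    unfolding OG sum.reindex[OF inj1] using d d[symmetric] by (simp add: A1_def G_def add.assoc)
  have s2: "(\<Sum>T\<in>O2. g T) = g {a', b', c'} + g {a', b, c} + g {a, b', c} + g {a, b, c'}" for g :: "P set \<Rightarrow> 'b::comm_monoid_add"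
    unfolding OG sum.reindex[OF inj2] using d d[symmetric] by (simp add: A2_def G_def add.assoc)
  have cyc_w: "cyc S w" unfolding cyc_def
  proof (intro allI impI)
    fix e :: "P set" assume "card e = 2"
    then obtain p q where e: "e = {p, q}" by (auto simp: card_2_iff)
    \<comment> \<open>Two points meet at most two of the three opposite pairs. Exchanging the two
      vertices of a pair that is missed matches the faces containing \<open>e\<close>, and matched
      faces have opposite signs.\<close>
    consider "p \<notin> {a, a'} \<and> q \<notin> {a, a'}" | "p \<notin> {b, b'} \<and> q \<notin> {b, b'}" | "p \<notin> {c, c'} \<and> q \<notin> {c, c'}"
      using ne by auto
    then show "(\<Sum>T\<in>tris S. if e \<subseteq> T then w T else 0) = 0"
      unfolding sum_w s1 s2 e by cases (simp_all add: insert_subset)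
  qed
  have tot_w: "sum w (tris S) = 0"
    using sum_w[of "\<lambda>_. True"] card4 by simp
  define X where "X = Y \<inter> (O1 \<union> O2)"
  define X1 where "X1 = {T \<in> X. y T = w T}"
  define X2 where "X2 = {T \<in> X. y T = - w T}"
  have finX: "finite X" by (simp add: X_def)
  have yw: "w T \<noteq> 0 \<and> y T \<noteq> 0" if "T \<in> X" for T
    using that by (auto simp: X_def Y_def w_def)
  have pm: "v = k \<or> v = - k" if "v \<noteq> 0" "k \<noteq> 0" for v k :: F3
    using that by (cases v rule: F3_cases; cases k rule: F3_cases) simp_all
  have X: "X = X1 \<union> X2"
    using yw pm unfolding X1_def X2_def by blast
  have "k \<noteq> - k" if "k \<noteq> 0" for k :: F3
    using that by (cases k rule: F3_cases) simp_all
  then have X': "X1 \<inter> X2 = {}"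
    using yw unfolding X1_def X2_def by force
  have cX: "card X = card X1 + card X2"
    using finX X' unfolding X by (simp add: card_Un_disjoint)
  have "card X = (\<Sum>T\<in>O1 \<union> O2. of_bool (T \<in> Y))"
    unfolding X_def by (subst sum_of_bool_eq) (auto simp: OG A1_def A2_def Int_def intro!: arg_cong[of _ _ card])
  also have "\<dots> = (\<Sum>T\<in>O1. of_bool (T \<in> Y)) + (\<Sum>T\<in>O2. of_bool (T \<in> Y))"
    using disj by (intro sum.union_disjoint) (auto simp: OG A1_def A2_def)
  finally have cardX: "card X = (\<Sum>T\<in>O1. of_bool (T \<in> Y)) + (\<Sum>T\<in>O2. of_bool (T \<in> Y))" .
  have two: "sum g {x, x'} = g x + g x'" if "x \<noteq> x'" for g :: "P \<Rightarrow> nat" and x x'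
    using that by simp
  have six': "card X \<ge> 6"
    using six unfolding cardX s1 s2 two[OF d(1)] two[OF d(2)] two[OF d(3)] by linarith
  have reduce: False if Z: "Z \<subseteq> X" "\<And>T. T \<in> Z \<Longrightarrow> y T = s * w T" "card Z \<ge> 3" for Z s
  proof -
    define y' where "y' T = y T - s * w T" for T
    have "cyc S y'"
      unfolding cyc_def
    proof (intro allI impI)
      fix e :: "P set" assume e: "card e = 2"
      have "(\<Sum>T\<in>tris S. if e \<subseteq> T then y' T else 0) =
          (\<Sum>T\<in>tris S. (if e \<subseteq> T then y T else 0) - s * (if e \<subseteq> T then w T else 0))"
        by (intro sum.cong) (auto simp: y'_def)
      also have "\<dots> = 0"
        using cyc cyc_w e by (simp add: sum_subtractf sum_distrib_left[symmetric] cyc_def)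
      finally show "(\<Sum>T\<in>tris S. if e \<subseteq> T then y' T else 0) = 0" .
    qed
    moreover have "sum y' (tris S) = sum y (tris S)"
      using tot_w by (simp add: y'_def sum_subtractf sum_distrib_left[symmetric])
    ultimately have min: "card Y \<le> card {T \<in> tris S. y' T \<noteq> 0}"
      using minimal total unfolding Y_def by simp
    have "{T \<in> tris S. y' T \<noteq> 0} \<subseteq> (Y - Z) \<union> ((O1 \<union> O2) - X)"
    proof
      fix T assume "T \<in> {T \<in> tris S. y' T \<noteq> 0}"
      then have T: "T \<in> tris S" "y' T \<noteq> 0" by auto
      then have "T \<notin> Z" using Z(2) by (auto simp: y'_def)
      show "T \<in> (Y - Z) \<union> ((O1 \<union> O2) - X)"
      proof (cases "T \<in> Y")
        case False
        then have "w T \<noteq> 0" using T by (auto simp: y'_def Y_def)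
        then show ?thesis using False by (auto simp: w_def X_def split: if_splits)
      qed (use \<open>T \<notin> Z\<close> in simp)
    qed
    then have "card {T \<in> tris S. y' T \<noteq> 0} \<le> card ((Y - Z) \<union> ((O1 \<union> O2) - X))"
      by (intro card_mono) (auto simp: OG A1_def A2_def)
    also have "\<dots> \<le> card (Y - Z) + card ((O1 \<union> O2) - X)"
      by (rule card_Un_le)
    finally have "card Y \<le> card (Y - Z) + card ((O1 \<union> O2) - X)" using min by linarith
    moreover have "card ((O1 \<union> O2) - X) = card (O1 \<union> O2) - card X"
      using finX by (intro card_Diff_subset) (auto simp: X_def)
    moreover have "card (O1 \<union> O2) = 8"
      using card4 disj by (subst card_Un_disjoint) (auto simp: OG A1_def A2_def)
    moreover have "Z \<subseteq> Y" using Z(1) by (auto simp: X_def)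
    then have "card (Y - Z) = card Y - card Z" "card Z \<le> card Y"
      using finite_Y by (auto intro!: card_Diff_subset card_mono intro: finite_subset)
    ultimately show False using Z(3) six' by linarith
  qed
  have "card X1 \<ge> 3 \<or> card X2 \<ge> 3" using cX six' by linarith
  then show False
  proof
    assume "3 \<le> card X1"
    then show False by (rule reduce[of X1 1, rotated 2]) (simp_all add: X1_def subset_iff)
  next
    assume "3 \<le> card X2"
    then show False by (rule reduce[of X2 "-1", rotated 2]) (simp_all add: X2_def subset_iff)
  qed
qed

end

lemma potential_or_min_cycle:
  assumes "finite S" "\<nexists>y. min_cycle S y"
  shows "\<exists>R. \<forall>a b c. {a, b, c} \<in> tris S \<longrightarrow> R {a, b} + R {a, c} + R {b, c} = (1::F3)"
proof (rule potential_or_cycle[OF assms(1)], rule ccontr)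
  fix y assume y: "cyc S y" "sum y (tris S) \<noteq> 0"
  define Q where "Q z \<longleftrightarrow> cyc S z \<and> sum z (tris S) \<noteq> 0" for z
  define m where "m z = card {T \<in> tris S. z T \<noteq> 0}" for z :: "P set \<Rightarrow> F3"
  obtain z where "Q z" "\<And>z'. Q z' \<Longrightarrow> m z \<le> m z'"
    using ex_has_least_nat[of Q y m] y unfolding Q_def by blast
  then have "min_cycle S z"
    using assms(1) by unfold_locales (auto simp: Q_def m_def)
  with assms(2) show False by blast
qed

subsection \<open>The search\<close>

text \<open>The constructor \<open>Q\<close> with number \<open>3x + y\<close> stands for \<open>(x, y)\<close> with \<open>x, y \<in> {0, 1, 2}\<close>, and \<open>V p r\<close>
  for the vector with coordinates \<open>p\<close> with respect to \<open>a, b\<close> and \<open>r\<close> with respect to \<open>e, f\<close>, where \<open>a, b, e, f\<close> is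
  a symplectic basis. The method \<open>code_simp\<close> evaluates all arguments of a function before it unfolds the
  function. Therefore tests are passed on as Boolean arguments to functions defined by pattern matching, which keeps
  branches that are not taken unevaluated.\<close>

datatype plane = Q0 | Q1 | Q2 | Q3 | Q4 | Q5 | Q6 | Q7 | Q8

datatype trit = Z0 | Z1 | Z2

datatype vect = V plane plane

datatype 'a nonet = N 'a 'a 'a 'a 'a 'a 'a 'a 'a

fun nonet_get :: "plane \<Rightarrow> 'a nonet \<Rightarrow> 'a" where
  "nonet_get Q0 (N a0 a1 a2 a3 a4 a5 a6 a7 a8) = a0"
| "nonet_get Q1 (N a0 a1 a2 a3 a4 a5 a6 a7 a8) = a1"
| "nonet_get Q2 (N a0 a1 a2 a3 a4 a5 a6 a7 a8) = a2"
| "nonet_get Q3 (N a0 a1 a2 a3 a4 a5 a6 a7 a8) = a3"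
| "nonet_get Q4 (N a0 a1 a2 a3 a4 a5 a6 a7 a8) = a4"
| "nonet_get Q5 (N a0 a1 a2 a3 a4 a5 a6 a7 a8) = a5"
| "nonet_get Q6 (N a0 a1 a2 a3 a4 a5 a6 a7 a8) = a6"
| "nonet_get Q7 (N a0 a1 a2 a3 a4 a5 a6 a7 a8) = a7"
| "nonet_get Q8 (N a0 a1 a2 a3 a4 a5 a6 a7 a8) = a8"

fun nonet_set :: "plane \<Rightarrow> 'a \<Rightarrow> 'a nonet \<Rightarrow> 'a nonet" where
  "nonet_set Q0 x (N a0 a1 a2 a3 a4 a5 a6 a7 a8) = N x a1 a2 a3 a4 a5 a6 a7 a8"
| "nonet_set Q1 x (N a0 a1 a2 a3 a4 a5 a6 a7 a8) = N a0 x a2 a3 a4 a5 a6 a7 a8"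
| "nonet_set Q2 x (N a0 a1 a2 a3 a4 a5 a6 a7 a8) = N a0 a1 x a3 a4 a5 a6 a7 a8"
| "nonet_set Q3 x (N a0 a1 a2 a3 a4 a5 a6 a7 a8) = N a0 a1 a2 x a4 a5 a6 a7 a8"
| "nonet_set Q4 x (N a0 a1 a2 a3 a4 a5 a6 a7 a8) = N a0 a1 a2 a3 x a5 a6 a7 a8"
| "nonet_set Q5 x (N a0 a1 a2 a3 a4 a5 a6 a7 a8) = N a0 a1 a2 a3 a4 x a6 a7 a8"
| "nonet_set Q6 x (N a0 a1 a2 a3 a4 a5 a6 a7 a8) = N a0 a1 a2 a3 a4 a5 x a7 a8"
| "nonet_set Q7 x (N a0 a1 a2 a3 a4 a5 a6 a7 a8) = N a0 a1 a2 a3 a4 a5 a6 x a8"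
| "nonet_set Q8 x (N a0 a1 a2 a3 a4 a5 a6 a7 a8) = N a0 a1 a2 a3 a4 a5 a6 a7 x"

fun plane_add :: "plane \<Rightarrow> plane \<Rightarrow> plane" where
  "plane_add Q0 Q0 = Q0" |  "plane_add Q0 Q1 = Q1" |  "plane_add Q0 Q2 = Q2" |  "plane_add Q0 Q3 = Q3" |  "plane_add Q0 Q4 = Q4" |  "plane_add Q0 Q5 = Q5" |  "plane_add Q0 Q6 = Q6" |  "plane_add Q0 Q7 = Q7" |  "plane_add Q0 Q8 = Q8"
| "plane_add Q1 Q0 = Q1" |  "plane_add Q1 Q1 = Q2" |  "plane_add Q1 Q2 = Q0" |  "plane_add Q1 Q3 = Q4" |  "plane_add Q1 Q4 = Q5" |  "plane_add Q1 Q5 = Q3" |  "plane_add Q1 Q6 = Q7" |  "plane_add Q1 Q7 = Q8" |  "plane_add Q1 Q8 = Q6"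
| "plane_add Q2 Q0 = Q2" |  "plane_add Q2 Q1 = Q0" |  "plane_add Q2 Q2 = Q1" |  "plane_add Q2 Q3 = Q5" |  "plane_add Q2 Q4 = Q3" |  "plane_add Q2 Q5 = Q4" |  "plane_add Q2 Q6 = Q8" |  "plane_add Q2 Q7 = Q6" |  "plane_add Q2 Q8 = Q7"
| "plane_add Q3 Q0 = Q3" |  "plane_add Q3 Q1 = Q4" |  "plane_add Q3 Q2 = Q5" |  "plane_add Q3 Q3 = Q6" |  "plane_add Q3 Q4 = Q7" |  "plane_add Q3 Q5 = Q8" |  "plane_add Q3 Q6 = Q0" |  "plane_add Q3 Q7 = Q1" |  "plane_add Q3 Q8 = Q2"
| "plane_add Q4 Q0 = Q4" |  "plane_add Q4 Q1 = Q5" |  "plane_add Q4 Q2 = Q3" |  "plane_add Q4 Q3 = Q7" |  "plane_add Q4 Q4 = Q8" |  "plane_add Q4 Q5 = Q6" |  "plane_add Q4 Q6 = Q1" |  "plane_add Q4 Q7 = Q2" |  "plane_add Q4 Q8 = Q0"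
| "plane_add Q5 Q0 = Q5" |  "plane_add Q5 Q1 = Q3" |  "plane_add Q5 Q2 = Q4" |  "plane_add Q5 Q3 = Q8" |  "plane_add Q5 Q4 = Q6" |  "plane_add Q5 Q5 = Q7" |  "plane_add Q5 Q6 = Q2" |  "plane_add Q5 Q7 = Q0" |  "plane_add Q5 Q8 = Q1"
| "plane_add Q6 Q0 = Q6" |  "plane_add Q6 Q1 = Q7" |  "plane_add Q6 Q2 = Q8" |  "plane_add Q6 Q3 = Q0" |  "plane_add Q6 Q4 = Q1" |  "plane_add Q6 Q5 = Q2" |  "plane_add Q6 Q6 = Q3" |  "plane_add Q6 Q7 = Q4" |  "plane_add Q6 Q8 = Q5"
| "plane_add Q7 Q0 = Q7" |  "plane_add Q7 Q1 = Q8" |  "plane_add Q7 Q2 = Q6" |  "plane_add Q7 Q3 = Q1" |  "plane_add Q7 Q4 = Q2" |  "plane_add Q7 Q5 = Q0" |  "plane_add Q7 Q6 = Q4" |  "plane_add Q7 Q7 = Q5" |  "plane_add Q7 Q8 = Q3"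
| "plane_add Q8 Q0 = Q8" |  "plane_add Q8 Q1 = Q6" |  "plane_add Q8 Q2 = Q7" |  "plane_add Q8 Q3 = Q2" |  "plane_add Q8 Q4 = Q0" |  "plane_add Q8 Q5 = Q1" |  "plane_add Q8 Q6 = Q5" |  "plane_add Q8 Q7 = Q3" |  "plane_add Q8 Q8 = Q4"

fun plane_sub :: "plane \<Rightarrow> plane \<Rightarrow> plane" where
  "plane_sub Q0 Q0 = Q0" |  "plane_sub Q0 Q1 = Q2" |  "plane_sub Q0 Q2 = Q1" |  "plane_sub Q0 Q3 = Q6" |  "plane_sub Q0 Q4 = Q8" |  "plane_sub Q0 Q5 = Q7" |  "plane_sub Q0 Q6 = Q3" |  "plane_sub Q0 Q7 = Q5" |  "plane_sub Q0 Q8 = Q4"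
| "plane_sub Q1 Q0 = Q1" |  "plane_sub Q1 Q1 = Q0" |  "plane_sub Q1 Q2 = Q2" |  "plane_sub Q1 Q3 = Q7" |  "plane_sub Q1 Q4 = Q6" |  "plane_sub Q1 Q5 = Q8" |  "plane_sub Q1 Q6 = Q4" |  "plane_sub Q1 Q7 = Q3" |  "plane_sub Q1 Q8 = Q5"
| "plane_sub Q2 Q0 = Q2" |  "plane_sub Q2 Q1 = Q1" |  "plane_sub Q2 Q2 = Q0" |  "plane_sub Q2 Q3 = Q8" |  "plane_sub Q2 Q4 = Q7" |  "plane_sub Q2 Q5 = Q6" |  "plane_sub Q2 Q6 = Q5" |  "plane_sub Q2 Q7 = Q4" |  "plane_sub Q2 Q8 = Q3"
| "plane_sub Q3 Q0 = Q3" |  "plane_sub Q3 Q1 = Q5" |  "plane_sub Q3 Q2 = Q4" |  "plane_sub Q3 Q3 = Q0" |  "plane_sub Q3 Q4 = Q2" |  "plane_sub Q3 Q5 = Q1" |  "plane_sub Q3 Q6 = Q6" |  "plane_sub Q3 Q7 = Q8" |  "plane_sub Q3 Q8 = Q7"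
| "plane_sub Q4 Q0 = Q4" |  "plane_sub Q4 Q1 = Q3" |  "plane_sub Q4 Q2 = Q5" |  "plane_sub Q4 Q3 = Q1" |  "plane_sub Q4 Q4 = Q0" |  "plane_sub Q4 Q5 = Q2" |  "plane_sub Q4 Q6 = Q7" |  "plane_sub Q4 Q7 = Q6" |  "plane_sub Q4 Q8 = Q8"
| "plane_sub Q5 Q0 = Q5" |  "plane_sub Q5 Q1 = Q4" |  "plane_sub Q5 Q2 = Q3" |  "plane_sub Q5 Q3 = Q2" |  "plane_sub Q5 Q4 = Q1" |  "plane_sub Q5 Q5 = Q0" |  "plane_sub Q5 Q6 = Q8" |  "plane_sub Q5 Q7 = Q7" |  "plane_sub Q5 Q8 = Q6"
| "plane_sub Q6 Q0 = Q6" |  "plane_sub Q6 Q1 = Q8" |  "plane_sub Q6 Q2 = Q7" |  "plane_sub Q6 Q3 = Q3" |  "plane_sub Q6 Q4 = Q5" |  "plane_sub Q6 Q5 = Q4" |  "plane_sub Q6 Q6 = Q0" |  "plane_sub Q6 Q7 = Q2" |  "plane_sub Q6 Q8 = Q1"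
| "plane_sub Q7 Q0 = Q7" |  "plane_sub Q7 Q1 = Q6" |  "plane_sub Q7 Q2 = Q8" |  "plane_sub Q7 Q3 = Q4" |  "plane_sub Q7 Q4 = Q3" |  "plane_sub Q7 Q5 = Q5" |  "plane_sub Q7 Q6 = Q1" |  "plane_sub Q7 Q7 = Q0" |  "plane_sub Q7 Q8 = Q2"
| "plane_sub Q8 Q0 = Q8" |  "plane_sub Q8 Q1 = Q7" |  "plane_sub Q8 Q2 = Q6" |  "plane_sub Q8 Q3 = Q5" |  "plane_sub Q8 Q4 = Q4" |  "plane_sub Q8 Q5 = Q3" |  "plane_sub Q8 Q6 = Q2" |  "plane_sub Q8 Q7 = Q1" |  "plane_sub Q8 Q8 = Q0"

fun plane_form :: "plane \<Rightarrow> plane \<Rightarrow> trit" where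
  "plane_form Q0 Q0 = Z0" |  "plane_form Q0 Q1 = Z0" |  "plane_form Q0 Q2 = Z0" |  "plane_form Q0 Q3 = Z0" |  "plane_form Q0 Q4 = Z0" |  "plane_form Q0 Q5 = Z0" |  "plane_form Q0 Q6 = Z0" |  "plane_form Q0 Q7 = Z0" |  "plane_form Q0 Q8 = Z0"
| "plane_form Q1 Q0 = Z0" |  "plane_form Q1 Q1 = Z0" |  "plane_form Q1 Q2 = Z0" |  "plane_form Q1 Q3 = Z2" |  "plane_form Q1 Q4 = Z2" |  "plane_form Q1 Q5 = Z2" |  "plane_form Q1 Q6 = Z1" |  "plane_form Q1 Q7 = Z1" |  "plane_form Q1 Q8 = Z1"
| "plane_form Q2 Q0 = Z0" |  "plane_form Q2 Q1 = Z0" |  "plane_form Q2 Q2 = Z0" |  "plane_form Q2 Q3 = Z1" |  "plane_form Q2 Q4 = Z1" |  "plane_form Q2 Q5 = Z1" |  "plane_form Q2 Q6 = Z2" |  "plane_form Q2 Q7 = Z2" |  "plane_form Q2 Q8 = Z2"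
| "plane_form Q3 Q0 = Z0" |  "plane_form Q3 Q1 = Z1" |  "plane_form Q3 Q2 = Z2" |  "plane_form Q3 Q3 = Z0" |  "plane_form Q3 Q4 = Z1" |  "plane_form Q3 Q5 = Z2" |  "plane_form Q3 Q6 = Z0" |  "plane_form Q3 Q7 = Z1" |  "plane_form Q3 Q8 = Z2"
| "plane_form Q4 Q0 = Z0" |  "plane_form Q4 Q1 = Z1" |  "plane_form Q4 Q2 = Z2" |  "plane_form Q4 Q3 = Z2" |  "plane_form Q4 Q4 = Z0" |  "plane_form Q4 Q5 = Z1" |  "plane_form Q4 Q6 = Z1" |  "plane_form Q4 Q7 = Z2" |  "plane_form Q4 Q8 = Z0"
| "plane_form Q5 Q0 = Z0" |  "plane_form Q5 Q1 = Z1" |  "plane_form Q5 Q2 = Z2" |  "plane_form Q5 Q3 = Z1" |  "plane_form Q5 Q4 = Z2" |  "plane_form Q5 Q5 = Z0" |  "plane_form Q5 Q6 = Z2" |  "plane_form Q5 Q7 = Z0" |  "plane_form Q5 Q8 = Z1"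
| "plane_form Q6 Q0 = Z0" |  "plane_form Q6 Q1 = Z2" |  "plane_form Q6 Q2 = Z1" |  "plane_form Q6 Q3 = Z0" |  "plane_form Q6 Q4 = Z2" |  "plane_form Q6 Q5 = Z1" |  "plane_form Q6 Q6 = Z0" |  "plane_form Q6 Q7 = Z2" |  "plane_form Q6 Q8 = Z1"
| "plane_form Q7 Q0 = Z0" |  "plane_form Q7 Q1 = Z2" |  "plane_form Q7 Q2 = Z1" |  "plane_form Q7 Q3 = Z2" |  "plane_form Q7 Q4 = Z1" |  "plane_form Q7 Q5 = Z0" |  "plane_form Q7 Q6 = Z1" |  "plane_form Q7 Q7 = Z0" |  "plane_form Q7 Q8 = Z2"
| "plane_form Q8 Q0 = Z0" |  "plane_form Q8 Q1 = Z2" |  "plane_form Q8 Q2 = Z1" |  "plane_form Q8 Q3 = Z1" |  "plane_form Q8 Q4 = Z0" |  "plane_form Q8 Q5 = Z2" |  "plane_form Q8 Q6 = Z2" |  "plane_form Q8 Q7 = Z1" |  "plane_form Q8 Q8 = Z0"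

fun plane_eq :: "plane \<Rightarrow> plane \<Rightarrow> bool" where
  "plane_eq Q0 Q0 = True" |  "plane_eq Q0 Q1 = False" |  "plane_eq Q0 Q2 = False" |  "plane_eq Q0 Q3 = False" |  "plane_eq Q0 Q4 = False" |  "plane_eq Q0 Q5 = False" |  "plane_eq Q0 Q6 = False" |  "plane_eq Q0 Q7 = False" |  "plane_eq Q0 Q8 = False"
| "plane_eq Q1 Q0 = False" |  "plane_eq Q1 Q1 = True" |  "plane_eq Q1 Q2 = False" |  "plane_eq Q1 Q3 = False" |  "plane_eq Q1 Q4 = False" |  "plane_eq Q1 Q5 = False" |  "plane_eq Q1 Q6 = False" |  "plane_eq Q1 Q7 = False" |  "plane_eq Q1 Q8 = False"
| "plane_eq Q2 Q0 = False" |  "plane_eq Q2 Q1 = False" |  "plane_eq Q2 Q2 = True" |  "plane_eq Q2 Q3 = False" |  "plane_eq Q2 Q4 = False" |  "plane_eq Q2 Q5 = False" |  "plane_eq Q2 Q6 = False" |  "plane_eq Q2 Q7 = False" |  "plane_eq Q2 Q8 = False"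
| "plane_eq Q3 Q0 = False" |  "plane_eq Q3 Q1 = False" |  "plane_eq Q3 Q2 = False" |  "plane_eq Q3 Q3 = True" |  "plane_eq Q3 Q4 = False" |  "plane_eq Q3 Q5 = False" |  "plane_eq Q3 Q6 = False" |  "plane_eq Q3 Q7 = False" |  "plane_eq Q3 Q8 = False"
| "plane_eq Q4 Q0 = False" |  "plane_eq Q4 Q1 = False" |  "plane_eq Q4 Q2 = False" |  "plane_eq Q4 Q3 = False" |  "plane_eq Q4 Q4 = True" |  "plane_eq Q4 Q5 = False" |  "plane_eq Q4 Q6 = False" |  "plane_eq Q4 Q7 = False" |  "plane_eq Q4 Q8 = False"
| "plane_eq Q5 Q0 = False" |  "plane_eq Q5 Q1 = False" |  "plane_eq Q5 Q2 = False" |  "plane_eq Q5 Q3 = False" |  "plane_eq Q5 Q4 = False" |  "plane_eq Q5 Q5 = True" |  "plane_eq Q5 Q6 = False" |  "plane_eq Q5 Q7 = False" |  "plane_eq Q5 Q8 = False"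
| "plane_eq Q6 Q0 = False" |  "plane_eq Q6 Q1 = False" |  "plane_eq Q6 Q2 = False" |  "plane_eq Q6 Q3 = False" |  "plane_eq Q6 Q4 = False" |  "plane_eq Q6 Q5 = False" |  "plane_eq Q6 Q6 = True" |  "plane_eq Q6 Q7 = False" |  "plane_eq Q6 Q8 = False"
| "plane_eq Q7 Q0 = False" |  "plane_eq Q7 Q1 = False" |  "plane_eq Q7 Q2 = False" |  "plane_eq Q7 Q3 = False" |  "plane_eq Q7 Q4 = False" |  "plane_eq Q7 Q5 = False" |  "plane_eq Q7 Q6 = False" |  "plane_eq Q7 Q7 = True" |  "plane_eq Q7 Q8 = False"
| "plane_eq Q8 Q0 = False" |  "plane_eq Q8 Q1 = False" |  "plane_eq Q8 Q2 = False" |  "plane_eq Q8 Q3 = False" |  "plane_eq Q8 Q4 = False" |  "plane_eq Q8 Q5 = False" |  "plane_eq Q8 Q6 = False" |  "plane_eq Q8 Q7 = False" |  "plane_eq Q8 Q8 = True"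

fun trit_add :: "trit \<Rightarrow> trit \<Rightarrow> trit" where
  "trit_add Z0 Z0 = Z0"
| "trit_add Z0 Z1 = Z1"
| "trit_add Z0 Z2 = Z2"
| "trit_add Z1 Z0 = Z1"
| "trit_add Z1 Z1 = Z2"
| "trit_add Z1 Z2 = Z0"
| "trit_add Z2 Z0 = Z2"
| "trit_add Z2 Z1 = Z0"
| "trit_add Z2 Z2 = Z1"

fun trit_scale :: "trit \<Rightarrow> plane \<Rightarrow> plane" where
  "trit_scale Z0 p = Q0"
| "trit_scale Z1 p = p"
| "trit_scale Z2 Q0 = Q0"
| "trit_scale Z2 Q1 = Q2"
| "trit_scale Z2 Q2 = Q1"
| "trit_scale Z2 Q3 = Q6"
| "trit_scale Z2 Q4 = Q8"
| "trit_scale Z2 Q5 = Q7"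
| "trit_scale Z2 Q6 = Q3"
| "trit_scale Z2 Q7 = Q5"
| "trit_scale Z2 Q8 = Q4"

fun vect_add :: "vect \<Rightarrow> vect \<Rightarrow> vect" where
  "vect_add (V a b) (V c d) = V (plane_add a c) (plane_add b d)"

fun vect_sub :: "vect \<Rightarrow> vect \<Rightarrow> vect" where
  "vect_sub (V a b) (V c d) = V (plane_sub a c) (plane_sub b d)"

fun vect_form :: "vect \<Rightarrow> vect \<Rightarrow> trit" where
  "vect_form (V a b) (V c d) = trit_add (plane_form a c) (plane_form b d)"

fun vect_scale :: "trit \<Rightarrow> vect \<Rightarrow> vect" where
  "vect_scale k (V a b) = V (trit_scale k a) (trit_scale k b)"

fun vect_neg :: "vect \<Rightarrow> vect" where "vect_neg (V a b) = V (trit_scale Z2 a) (trit_scale Z2 b)"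

fun both :: "bool \<Rightarrow> bool \<Rightarrow> bool" where "both True x = x" | "both False x = False"

fun vect_eq :: "vect \<Rightarrow> vect \<Rightarrow> bool" where
  "vect_eq (V a b) (V c d) = both (plane_eq a c) (plane_eq b d)"

text \<open>Two levels of nine branches hold one bit for each of the 81 vectors.\<close>

type_synonym trie = "bool nonet nonet"

fun trie_mem :: "vect \<Rightarrow> trie \<Rightarrow> bool" where
  "trie_mem (V a b) s = nonet_get b (nonet_get a s)"

fun trie_insert :: "vect \<Rightarrow> trie \<Rightarrow> trie" where
  "trie_insert (V a b) s = nonet_set a (nonet_set b True (nonet_get a s)) s"

datatype unary = U0 | US unary
text \<open>\<open>OE a b c al\<close> records that \<open>a, b, c\<close> is the only chosen triangle at the oriented edge from \<open>a\<close> to \<open>b\<close>; a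
  further triangle of the support has a third vertex \<open>c'\<close> and needs the point \<open>d' = -(a + b + c')\<close>, for some
  pair \<open>(c', d')\<close> in \<open>al\<close>. Tries hold the points known to be in \<open>S \<union> {0}\<close>, and unary numbers count
  how many more points there can be.\<close>

datatype open_edge = OE vect vect vect "(vect \<times> vect) list"

datatype triangle = T3 vect vect vect

text \<open>The projection to the orthogonal complement of \<open>a, b\<close>, provided that
  \<open>vect_form a b = Z1\<close>.\<close>

fun orth_proj :: "vect \<Rightarrow> vect \<Rightarrow> vect \<Rightarrow> vect" where
  "orth_proj a b x = vect_add (vect_sub x (vect_scale (vect_form x b) a)) (vect_scale (vect_form x a) b)"

fun cons_unless :: "bool \<Rightarrow> vect \<Rightarrow> vect \<Rightarrow> (vect \<times> vect) list \<Rightarrow> (vect \<times> vect) list" where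
  "cons_unless True c d xs = xs" | "cons_unless False c d xs = (c, d) # xs"

text \<open>Here \<open>m\<close> is \<open>-(a + b)\<close>, so \<open>m - d\<close> is the third
  vertex belonging to the fourth point \<open>d\<close>; the triangle with third vertex
  \<open>c\<close> is already present.\<close>

fun alternatives :: "vect \<Rightarrow> vect \<Rightarrow> vect list \<Rightarrow> (vect \<times> vect) list" where
  "alternatives m c [] = []"
| "alternatives m c (d # ds) = cons_unless (vect_eq (vect_sub m d) c) (vect_sub m d) d (alternatives m c ds)"

fun plane_span :: "vect \<Rightarrow> vect \<Rightarrow> vect \<Rightarrow> vect \<Rightarrow> vect list" where
  "plane_span e f e2 f2 = [V Q0 Q0, e, e2, f, f2, vect_add e f, vect_add e2 f2, vect_sub e f, vect_sub f e]"

definition all_vects :: "vect list" where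
  "all_vects = [V a b. a \<leftarrow> [Q0,Q1,Q2,Q3,Q4,Q5,Q6,Q7,Q8], b \<leftarrow> [Q0,Q1,Q2,Q3,Q4,Q5,Q6,Q7,Q8]]"

text \<open>If the second pair of projected basis vectors is degenerate too, all vectors are
  offered. Completeness of the list thus needs no argument about which pair spans.\<close>

fun span_or_all :: "trit \<Rightarrow> vect \<Rightarrow> vect \<Rightarrow> vect list" where
  "span_or_all Z0 e f = all_vects"
| "span_or_all Z1 e f = plane_span e f (vect_neg e) (vect_neg f)"
| "span_or_all Z2 e f = plane_span e f (vect_neg e) (vect_neg f)"

fun span_of_second :: "vect \<Rightarrow> vect \<Rightarrow> vect list" where
  "span_of_second e f = span_or_all (vect_form e f) e f"

fun span_or_second :: "trit \<Rightarrow> vect \<Rightarrow> vect \<Rightarrow> vect \<Rightarrow> vect \<Rightarrow> vect list" where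
  "span_or_second Z0 e f a b = span_of_second (orth_proj a b (V Q0 Q3)) (orth_proj a b (V Q0 Q1))"
| "span_or_second Z1 e f a b = plane_span e f (vect_neg e) (vect_neg f)"
| "span_or_second Z2 e f a b = plane_span e f (vect_neg e) (vect_neg f)"

fun span_of_first :: "vect \<Rightarrow> vect \<Rightarrow> vect \<Rightarrow> vect \<Rightarrow> vect list" where
  "span_of_first e f a b = span_or_second (vect_form e f) e f a b"

fun orth_complement :: "vect \<Rightarrow> vect \<Rightarrow> vect list" where
  "orth_complement a b = span_of_first (orth_proj a b (V Q3 Q0)) (orth_proj a b (V Q1 Q0)) a b"

fun make_open :: "vect \<Rightarrow> vect \<Rightarrow> vect \<Rightarrow> open_edge" where
  "make_open a b c = OE a b c (alternatives (vect_neg (vect_add a b)) c (orth_complement a b))"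

datatype cost = C0 | C1 | C2

fun step_cost :: "bool \<Rightarrow> bool \<Rightarrow> cost" where
  "step_cost True True = C0"
| "step_cost True False = C1"
| "step_cost False True = C1"
| "step_cost False False = C2"

fun affordable :: "cost \<Rightarrow> unary \<Rightarrow> bool" where
  "affordable C0 r = True"
| "affordable C1 U0 = False"
| "affordable C1 (US r) = True"
| "affordable C2 U0 = False"
| "affordable C2 (US U0) = False"
| "affordable C2 (US (US r)) = True"

fun pay :: "cost \<Rightarrow> unary \<Rightarrow> unary" where
  "pay C0 r = r"
| "pay C1 U0 = U0"
| "pay C1 (US r) = r"
| "pay C2 U0 = U0"
| "pay C2 (US U0) = U0"
| "pay C2 (US (US r)) = r"

fun cons_if_affordable :: "bool \<Rightarrow> vect \<Rightarrow> vect \<Rightarrow> (vect \<times> vect) list \<Rightarrow> (vect \<times> vect) list" where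
  "cons_if_affordable True c d xs = (c, d) # xs" | "cons_if_affordable False c d xs = xs"

fun keep_affordable :: "unary \<Rightarrow> trie \<Rightarrow> (vect \<times> vect) list \<Rightarrow> (vect \<times> vect) list" where
  "keep_affordable r s [] = []"
| "keep_affordable r s ((c, d) # xs) = cons_if_affordable (affordable (step_cost (trie_mem c s) (trie_mem d s)) r) c d (keep_affordable r s xs)"

fun cons_option :: "open_edge \<Rightarrow> open_edge list option \<Rightarrow> open_edge list option" where
  "cons_option e None = None" | "cons_option e (Some es) = Some (e # es)"

text \<open>\<open>None\<close> reports a contradiction: some open edge has no alternative within
  the budget.\<close>

fun restrict_edges :: "unary \<Rightarrow> trie \<Rightarrow> open_edge list \<Rightarrow> open_edge list option" and
    restrict_edge :: "unary \<Rightarrow> trie \<Rightarrow> vect \<Rightarrow> vect \<Rightarrow> vect \<Rightarrow> (vect \<times> vect) list \<Rightarrow> open_edge list \<Rightarrow> open_edge list option" where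
  "restrict_edges r s [] = Some []"
| "restrict_edges r s (OE a b c al # es) = restrict_edge r s a b c (keep_affordable r s al) es"
| "restrict_edge r s a b c [] es = None"
| "restrict_edge r s a b c (x # xs) es = cons_option (OE a b c (x # xs)) (restrict_edges r s es)"

text \<open>If at most one point is still missing, it must be contained in the list of missing points of every open edge;
  \<open>Sat\<close> marks edges that can be served without a new point.\<close>

datatype points = Sat | Pts "vect list"

fun cons_point :: "vect \<Rightarrow> points \<Rightarrow> points" where
  "cons_point p Sat = Sat" | "cons_point p (Pts ps) = Pts (p # ps)"

text \<open>Alternatives with both points missing are skipped: the two points are distinct, so they
  exceed a budget of one.\<close>

fun missing_points :: "trie \<Rightarrow> (vect \<times> vect) list \<Rightarrow> points" and missing_points_step :: "bool \<Rightarrow> bool \<Rightarrow> trie \<Rightarrow> vect \<Rightarrow> vect \<Rightarrow> (vect \<times> vect) list \<Rightarrow> points" where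
  "missing_points s [] = Pts []"
| "missing_points s ((c, d) # xs) = missing_points_step (trie_mem c s) (trie_mem d s) s c d xs"
| "missing_points_step True True s c d xs = Sat"
| "missing_points_step True False s c d xs = cons_point d (missing_points s xs)"
| "missing_points_step False True s c d xs = cons_point c (missing_points s xs)"
| "missing_points_step False False s c d xs = missing_points s xs"

fun vect_member_step :: "bool \<Rightarrow> vect \<Rightarrow> vect list \<Rightarrow> bool" and vect_member :: "vect \<Rightarrow> vect list \<Rightarrow> bool" where
  "vect_member x [] = False"
| "vect_member x (y # ys) = vect_member_step (vect_eq x y) x ys"
| "vect_member_step True x ys = True"
| "vect_member_step False x ys = vect_member x ys"

fun cons_if :: "bool \<Rightarrow> vect \<Rightarrow> vect list \<Rightarrow> vect list" where
  "cons_if True x xs = x # xs" | "cons_if False x xs = xs"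

fun common_vects :: "vect list \<Rightarrow> vect list \<Rightarrow> vect list" where
  "common_vects [] ys = []" | "common_vects (x # xs) ys = cons_if (vect_member x ys) x (common_vects xs ys)"

fun no_common_point :: "trie \<Rightarrow> open_edge list \<Rightarrow> vect list \<Rightarrow> bool" and no_common_point_step :: "points \<Rightarrow> trie \<Rightarrow> open_edge list \<Rightarrow> vect list \<Rightarrow> bool" where
  "no_common_point s es [] = True"
| "no_common_point s [] (p # ps) = False"
| "no_common_point s (OE a b c al # es) (p # ps) = no_common_point_step (missing_points s al) s es (p # ps)"
| "no_common_point_step Sat s es ps = no_common_point s es ps"
| "no_common_point_step (Pts qs) s es ps = no_common_point s es (common_vects ps qs)"

fun no_missing_point :: "trie \<Rightarrow> open_edge list \<Rightarrow> bool" and no_missing_point_step :: "points \<Rightarrow> trie \<Rightarrow> open_edge list \<Rightarrow> bool" where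
  "no_missing_point s [] = False"
| "no_missing_point s (OE a b c al # es) = no_missing_point_step (missing_points s al) s es"
| "no_missing_point_step Sat s es = no_missing_point s es"
| "no_missing_point_step (Pts qs) s es = no_common_point s es qs"

fun restrict_unless :: "bool \<Rightarrow> unary \<Rightarrow> trie \<Rightarrow> open_edge list \<Rightarrow> open_edge list option" where
  "restrict_unless True r s es = None" | "restrict_unless False r s es = restrict_edges r s es"

fun prune :: "unary \<Rightarrow> trie \<Rightarrow> open_edge list \<Rightarrow> open_edge list option" where
  "prune U0 s es = restrict_edges U0 s es"
| "prune (US U0) s es = restrict_unless (no_missing_point s es) (US U0) s es"
| "prune (US (US r)) s es = restrict_edges (US (US r)) s es"

text \<open>Comparing rotations suffices, since all recorded triangles have the cyclic order in
  which the form is \<open>Z1\<close>.\<close>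

fun same_triangle :: "vect \<Rightarrow> vect \<Rightarrow> vect \<Rightarrow> triangle \<Rightarrow> bool" and same_rotated :: "bool \<Rightarrow> bool \<Rightarrow> bool \<Rightarrow> vect \<Rightarrow> vect \<Rightarrow> vect \<Rightarrow> vect \<Rightarrow> vect \<Rightarrow> bool" where
  "same_triangle x y w (T3 a b c) = same_rotated (vect_eq x a) (vect_eq x b) (vect_eq x c) y w a b c"
| "same_rotated True i j y w a b c = both (vect_eq y b) (vect_eq w c)"
| "same_rotated False True j y w a b c = both (vect_eq y c) (vect_eq w a)"
| "same_rotated False False True y w a b c = both (vect_eq y a) (vect_eq w b)"
| "same_rotated False False False y w a b c = False"

fun required :: "vect \<Rightarrow> vect \<Rightarrow> vect \<Rightarrow> triangle list \<Rightarrow> bool" and required_step :: "bool \<Rightarrow> vect \<Rightarrow> vect \<Rightarrow> vect \<Rightarrow> triangle list \<Rightarrow> bool" where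
  "required x y w [] = False" | "required x y w (t # ts) = required_step (same_triangle x y w t) x y w ts"
| "required_step True x y w ts = True" | "required_step False x y w ts = required x y w ts"

fun count_if :: "bool \<Rightarrow> unary \<Rightarrow> unary" where
  "count_if True n = US n" | "count_if False n = n"

fun fourth_mem :: "trie \<Rightarrow> vect \<Rightarrow> vect \<Rightarrow> vect \<Rightarrow> bool" where
  "fourth_mem s x y w = trie_mem (vect_neg (vect_add (vect_add x y) w)) s"

fun at_least_six :: "unary \<Rightarrow> bool" where
  "at_least_six (US (US (US (US (US (US n)))))) = True" | "at_least_six n = False"

fun octahedron_at :: "bool \<Rightarrow> trie \<Rightarrow> triangle list \<Rightarrow> vect \<Rightarrow> vect \<Rightarrow> vect \<Rightarrow> vect \<Rightarrow> vect \<Rightarrow> vect \<Rightarrow> bool" where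
  "octahedron_at False s q a a' b b' c c' = False"
| "octahedron_at True s q a a' b b' c c' = both (at_least_six (count_if (required a b c q) (count_if (required a b c' q) (count_if (required a b' c q) (count_if (required a b' c' q)
     (count_if (required a' b c q) (count_if (required a' b c' q) (count_if (required a' b' c q) (count_if (required a' b' c' q) U0)))))))))
     (both (fourth_mem s a b c) (both (fourth_mem s a b c') (both (fourth_mem s a b' c) (both (fourth_mem s a b' c')
       (both (fourth_mem s a' b c) (both (fourth_mem s a' b c') (both (fourth_mem s a' b' c) (fourth_mem s a' b' c'))))))))"

fun either :: "bool \<Rightarrow> bool \<Rightarrow> bool" where "either True x = True" | "either False x = x"

fun is_zero :: "trit \<Rightarrow> bool" where
  "is_zero Z0 = True" | "is_zero Z1 = False" | "is_zero Z2 = False"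

fun octahedra_along :: "bool \<Rightarrow> trie \<Rightarrow> triangle list \<Rightarrow> vect \<Rightarrow> vect \<Rightarrow> vect \<Rightarrow> vect \<Rightarrow> vect \<Rightarrow> vect \<Rightarrow> vect \<Rightarrow> vect \<Rightarrow> bool" where
  "octahedra_along False s q a b c c' a1 a2 b1 b2 = False"
| "octahedra_along True s q a b c c' a1 a2 b1 b2 = either (either (octahedron_at (both (trie_mem a1 s) (trie_mem b1 s)) s q a a1 b b1 c c') (octahedron_at (both (trie_mem a1 s) (trie_mem b2 s)) s q a a1 b b2 c c'))
     (either (octahedron_at (both (trie_mem a2 s) (trie_mem b1 s)) s q a a2 b b1 c c') (octahedron_at (both (trie_mem a2 s) (trie_mem b2 s)) s q a a2 b b2 c c'))"
text \<open>The opposite vertices of an octahedron differ by multiples of one vector \<open>l\<close> orthogonal to all of them,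
  here \<open>c' - c\<close>.\<close>

fun octahedra_parallel :: "vect \<Rightarrow> trie \<Rightarrow> triangle list \<Rightarrow> vect \<Rightarrow> vect \<Rightarrow> vect \<Rightarrow> vect \<Rightarrow> bool" where
  "octahedra_parallel l s q a b c c' = octahedra_along (is_zero (vect_form l c)) s q a b c c' (vect_add a l) (vect_sub a l) (vect_add b l) (vect_sub b l)"

fun octahedra_distinct :: "bool \<Rightarrow> trie \<Rightarrow> triangle list \<Rightarrow> vect \<Rightarrow> vect \<Rightarrow> vect \<Rightarrow> vect \<Rightarrow> bool" where
  "octahedra_distinct True s q a b c c' = False"
| "octahedra_distinct False s q a b c c' = octahedra_parallel (vect_sub c' c) s q a b c c'"

fun octahedra :: "trie \<Rightarrow> triangle list \<Rightarrow> vect \<Rightarrow> vect \<Rightarrow> vect \<Rightarrow> vect \<Rightarrow> bool" where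
  "octahedra s q a b c c' = octahedra_distinct (vect_eq c c') s q a b c c'"

text \<open>The optional vector is the third vertex of the older triangle at an open edge that has
  just been closed; together with the new triangle it is tested for octahedra around that
  edge.\<close>

datatype removal = RM "vect option" "open_edge list"

fun vect_eq_if :: "bool \<Rightarrow> vect \<Rightarrow> vect \<Rightarrow> bool" where
  "vect_eq_if False b y = False" | "vect_eq_if True b y = vect_eq b y"

fun remove_step :: "bool \<Rightarrow> open_edge \<Rightarrow> vect \<Rightarrow> removal \<Rightarrow> removal" where
  "remove_step True e c (RM t es) = RM (Some c) es" | "remove_step False e c (RM t es) = RM t (e # es)"

fun remove_open :: "vect \<Rightarrow> vect \<Rightarrow> open_edge list \<Rightarrow> removal" where
  "remove_open x y [] = RM None []"
| "remove_open x y (OE a b c al # es) = remove_step (vect_eq_if (vect_eq a x) b y) (OE a b c al) c (remove_open x y es)"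

fun has_edge :: "vect \<Rightarrow> vect \<Rightarrow> triangle \<Rightarrow> bool" where
  "has_edge x y (T3 a b c) = either (both (vect_eq x a) (vect_eq y b)) (either (both (vect_eq x b) (vect_eq y c)) (both (vect_eq x c) (vect_eq y a)))"

fun edge_occurs :: "vect \<Rightarrow> vect \<Rightarrow> triangle list \<Rightarrow> bool" where
  "edge_occurs x y [] = False" | "edge_occurs x y (t # ts) = either (has_edge x y t) (edge_occurs x y ts)"

fun make_unless :: "bool \<Rightarrow> vect \<Rightarrow> vect \<Rightarrow> vect \<Rightarrow> open_edge list" where
  "make_unless True a b c = []" | "make_unless False a b c = [make_open a b c]"

text \<open>A continuation is forced only where a single triangle has been chosen, so an edge that
  was just closed or occurs in an older triangle is not opened.\<close>

fun new_edges :: "vect option \<Rightarrow> vect \<Rightarrow> vect \<Rightarrow> vect \<Rightarrow> triangle list \<Rightarrow> open_edge list" where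
  "new_edges (Some t) a b c q = []" | "new_edges None a b c q = make_unless (edge_occurs a b q) a b c"

fun octahedra_closing :: "vect option \<Rightarrow> trie \<Rightarrow> triangle list \<Rightarrow> vect \<Rightarrow> vect \<Rightarrow> vect \<Rightarrow> bool" where
  "octahedra_closing None s q a b c = False" | "octahedra_closing (Some t) s q a b c = octahedra s q a b t c"

fun append_edges :: "open_edge list \<Rightarrow> open_edge list \<Rightarrow> open_edge list" where
  "append_edges [] ys = ys" | "append_edges (x # xs) ys = x # append_edges xs ys"

fun join_edges :: "unary \<Rightarrow> trie \<Rightarrow> open_edge list \<Rightarrow> open_edge list \<Rightarrow> open_edge list option" where
  "join_edges (US U0) s es fs = restrict_unless (no_missing_point s (append_edges es fs)) (US U0) s (append_edges es fs)"
| "join_edges U0 s es fs = Some (append_edges es fs)"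
| "join_edges (US (US r)) s es fs = Some (append_edges es fs)"

fun join_new :: "open_edge list option \<Rightarrow> unary \<Rightarrow> trie \<Rightarrow> open_edge list \<Rightarrow> open_edge list option" where
  "join_new None r s fs = None" | "join_new (Some es) r s fs = join_edges r s es fs"

fun extend_if :: "bool \<Rightarrow> vect option \<Rightarrow> vect option \<Rightarrow> unary \<Rightarrow> trie \<Rightarrow> triangle list \<Rightarrow> vect \<Rightarrow> vect \<Rightarrow> vect \<Rightarrow> open_edge list \<Rightarrow> open_edge list option" where
  "extend_if True t1 t2 r s q a b c fs = None"
| "extend_if False t1 t2 r s q a b c fs = join_new (restrict_edges r s (append_edges (new_edges t1 b c a q) (new_edges t2 c a b q))) r s fs"

fun extend_pruned :: "open_edge list option \<Rightarrow> vect option \<Rightarrow> vect option \<Rightarrow> unary \<Rightarrow> trie \<Rightarrow> triangle list \<Rightarrow> vect \<Rightarrow> vect \<Rightarrow> vect \<Rightarrow> vect \<Rightarrow> open_edge list option" where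
  "extend_pruned None t1 t2 r s q a b c c' = None"
| "extend_pruned (Some fs) t1 t2 r s q a b c c' = extend_if (either (octahedra s (T3 a b c' # q) a b c c')
     (either (octahedra_closing t1 s (T3 a b c' # q) b c' a) (octahedra_closing t2 s (T3 a b c' # q) c' a b))) t1 t2 r s q a b c' fs"

fun extend_second :: "vect option \<Rightarrow> removal \<Rightarrow> unary \<Rightarrow> trie \<Rightarrow> triangle list \<Rightarrow> vect \<Rightarrow> vect \<Rightarrow> vect \<Rightarrow> vect \<Rightarrow> open_edge list option" where
  "extend_second t1 (RM t2 fs) r s q a b c c' = extend_pruned (prune r s fs) t1 t2 r s q a b c c'"

fun extend_by :: "removal \<Rightarrow> unary \<Rightarrow> trie \<Rightarrow> triangle list \<Rightarrow> vect \<Rightarrow> vect \<Rightarrow> vect \<Rightarrow> vect \<Rightarrow> open_edge list option" where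
  "extend_by (RM t1 fs) r s q a b c c' = extend_second t1 (remove_open c' a fs) r s q a b c c'"

text \<open>Alternatives that need fewer new points leave a larger budget, so they weigh more in the choice of the edge.\<close>

fun add_score :: "cost \<Rightarrow> unary \<Rightarrow> unary" where
  "add_score C0 n = US (US (US (US n)))" | "add_score C1 n = US (US n)" | "add_score C2 n = US n"

fun score :: "trie \<Rightarrow> (vect \<times> vect) list \<Rightarrow> unary" where
  "score s [] = U0"
| "score s ((c, d) # xs) = add_score (step_cost (trie_mem c s) (trie_mem d s)) (score s xs)"

fun unary_less :: "unary \<Rightarrow> unary \<Rightarrow> bool" where
  "unary_less x U0 = False" | "unary_less U0 (US y) = True" | "unary_less (US x) (US y) = unary_less x y"

datatype choice = PR open_edge unary "open_edge list"

fun pick_if :: "bool \<Rightarrow> unary \<Rightarrow> open_edge \<Rightarrow> unary \<Rightarrow> open_edge \<Rightarrow> open_edge list \<Rightarrow> choice" where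
  "pick_if True m e' n e acc = PR e' m (e # acc)" | "pick_if False m e' n e acc = PR e n (e' # acc)"

fun pick_compare :: "unary \<Rightarrow> open_edge \<Rightarrow> choice \<Rightarrow> choice" where
  "pick_compare m e' (PR e n acc) = pick_if (unary_less m n) m e' n e acc"

fun pick_best :: "trie \<Rightarrow> choice \<Rightarrow> open_edge list \<Rightarrow> choice" where
  "pick_best s p [] = p"
| "pick_best s p (OE a b c al # es) = pick_best s (pick_compare (score s al) (OE a b c al) p) es"

fun pick_edge :: "trie \<Rightarrow> open_edge \<Rightarrow> open_edge list \<Rightarrow> choice" where
  "pick_edge s (OE a b c al) es = pick_best s (PR (OE a b c al) (score s al) []) es"

text \<open>\<open>True\<close> means that every branch ended in a contradiction. Exhausted fuel and
  an empty list of open edges both answer \<open>False\<close>, so soundness does not depend on the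
  amount of fuel.\<close>

function (sequential) search :: "unary \<Rightarrow> unary \<Rightarrow> trie \<Rightarrow> open_edge list \<Rightarrow> triangle list \<Rightarrow> bool"
 and search_choice :: "unary \<Rightarrow> choice \<Rightarrow> unary \<Rightarrow> trie \<Rightarrow> triangle list \<Rightarrow> bool"
 and search_alts :: "unary \<Rightarrow> (vect \<times> vect) list \<Rightarrow> vect \<Rightarrow> vect \<Rightarrow> vect \<Rightarrow> open_edge list \<Rightarrow> unary \<Rightarrow> trie \<Rightarrow> triangle list \<Rightarrow> bool"
 and search_state :: "unary \<Rightarrow> open_edge list option \<Rightarrow> unary \<Rightarrow> trie \<Rightarrow> triangle list \<Rightarrow> bool"
 and search_rest :: "unary \<Rightarrow> bool \<Rightarrow> (vect \<times> vect) list \<Rightarrow> vect \<Rightarrow> vect \<Rightarrow> vect \<Rightarrow> open_edge list \<Rightarrow> unary \<Rightarrow> trie \<Rightarrow> triangle list \<Rightarrow> bool"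
 and search_extend :: "unary \<Rightarrow> trie \<Rightarrow> unary \<Rightarrow> vect \<Rightarrow> vect \<Rightarrow> vect \<Rightarrow> vect \<Rightarrow> open_edge list \<Rightarrow> triangle list \<Rightarrow> bool" where
  "search U0 r s es q = False"
| "search (US n) r s [] q = False"
| "search (US n) r s (e # es) q = search_choice n (pick_edge s e es) r s q"
| "search_choice n (PR (OE a b c al) m es) r s q = search_alts n al a b c es r s q"
| "search_alts n [] a b c es r s q = True"
| "search_alts n ((c', d) # xs) a b c es r s q =
     search_rest n (search_extend n (trie_insert c' (trie_insert d s)) (pay (step_cost (trie_mem c' s) (trie_mem d s)) r) a b c c' es q) xs a b c es r s q"
| "search_extend n s r a b c c' es q = search_state n (extend_by (remove_open b c' es) r s q a b c c') r s (T3 a b c' # q)"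
| "search_state n None r s q = True"
| "search_state n (Some es) r s q = search n r s es q"
| "search_rest n False xs a b c es r s q = False"
| "search_rest n True xs a b c es r s q = search_alts n xs a b c es r s q"
  by pat_completeness auto
termination
  \<comment> \<open>Fuel drops only on entering \<open>search_choice\<close>. At equal fuel the
    second measure follows the call order, with four units per remaining alternative.\<close>
  by (relation "measures [\<lambda>x. case x of Inl (Inl (n, _)) \<Rightarrow> size n | Inl (Inr (Inl (n, _))) \<Rightarrow> size n | Inl (Inr (Inr (n, _))) \<Rightarrow> size n
      | Inr (Inl (n, _)) \<Rightarrow> size n | Inr (Inr (Inl (n, _))) \<Rightarrow> size n | Inr (Inr (Inr (n, _))) \<Rightarrow> size n,
     \<lambda>x. case x of Inl (Inl _) \<Rightarrow> 0 | Inl (Inr (Inl (_, PR (OE _ _ _ al) _ _, _))) \<Rightarrow> 4 * length al + 6 | Inl (Inr (Inr (n, al, _))) \<Rightarrow> 4 * length al + 5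
      | Inr (Inl (n, _)) \<Rightarrow> 1 | Inr (Inr (Inl (n, _, al, _))) \<Rightarrow> 4 * length al + 6 | Inr (Inr (Inr _)) \<Rightarrow> 2]") auto

definition "nine_times x = N x x x x x x x x x"

fun trie_of :: "vect list \<Rightarrow> trie" where
  "trie_of [] = nine_times (nine_times False)" | "trie_of (x # xs) = trie_insert x (trie_of xs)"

abbreviation "vA \<equiv> V Q3 Q0" abbreviation "vB \<equiv> V Q1 Q0"

fun search_option :: "unary \<Rightarrow> unary \<Rightarrow> open_edge list option \<Rightarrow> trie \<Rightarrow> triangle list \<Rightarrow> bool" where
  "search_option n r None s q = True" | "search_option n r (Some es) s q = search n r s es q"

definition "fuel = US (US (US (US (US (US (US (US (US (US (US (US (US (US (US (US (US (US (US (US (US (US (US (US (US (US (US (US (US (US (US (US U0)))))))))))))))))))))))))))))))"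

definition "budget8 = US (US (US (US (US (US (US (US U0)))))))"

fun make_all_open :: "triangle list \<Rightarrow> open_edge list" where
  "make_all_open [] = []" | "make_all_open (T3 a b c # ts) = make_open a b c # make_all_open ts"

fun search_from :: "unary \<Rightarrow> vect list \<Rightarrow> triangle list \<Rightarrow> triangle list \<Rightarrow> bool" where
  "search_from r ps ts q = search_option fuel r (restrict_edges r (trie_of (V Q0 Q0 # ps)) (make_all_open ts)) (trie_of (V Q0 Q0 # ps)) q"

subsection \<open>Soundness of the search\<close>

fun x_of :: "plane \<Rightarrow> F3" where
  "x_of Q0 = 0" | "x_of Q1 = 0" | "x_of Q2 = 0" | "x_of Q3 = 1" | "x_of Q4 = 1" | "x_of Q5 = 1"
| "x_of Q6 = -1" | "x_of Q7 = -1" | "x_of Q8 = -1"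

fun y_of :: "plane \<Rightarrow> F3" where
  "y_of Q0 = 0" | "y_of Q1 = 1" | "y_of Q2 = -1" | "y_of Q3 = 0" | "y_of Q4 = 1" | "y_of Q5 = -1"
| "y_of Q6 = 0" | "y_of Q7 = 1" | "y_of Q8 = -1"

fun F3_of :: "trit \<Rightarrow> F3" where "F3_of Z0 = 0" | "F3_of Z1 = 1" | "F3_of Z2 = -1"

lemmas F3_arith = zero_finite_3_def one_finite_3_def plus_finite_3_def uminus_finite_3_def minus_finite_3_def
  times_finite_3_def

lemma x_of_add: "x_of (plane_add p r) = x_of p + x_of r"
  by (cases p; cases r; simp add: F3_arith)

lemma y_of_add: "y_of (plane_add p r) = y_of p + y_of r"
  by (cases p; cases r; simp add: F3_arith)

lemma x_of_sub: "x_of (plane_sub p r) = x_of p - x_of r"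
  by (cases p; cases r; simp add: F3_arith)

lemma y_of_sub: "y_of (plane_sub p r) = y_of p - y_of r"
  by (cases p; cases r; simp add: F3_arith)

lemma F3_of_add: "F3_of (trit_add p r) = F3_of p + F3_of r"
  by (cases p; cases r; simp add: F3_arith)

lemma plane_form_zf: "F3_of (plane_form p r) = x_of p * y_of r - y_of p * x_of r"
  by (cases p; cases r; simp add: F3_arith)

lemma trit_scale_zf: "x_of (trit_scale k p) = F3_of k * x_of p" "y_of (trit_scale k p) = F3_of k * y_of p"
  by (cases k; cases p; simp)+

lemma F3_of_inj: "F3_of k = F3_of l \<longleftrightarrow> k = l"
  by (cases k; cases l) auto

lemma q_eqI: "x_of p = x_of r \<Longrightarrow> y_of p = y_of r \<Longrightarrow> p = r"
  by (cases p; cases r; simp)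

lemma q_surj: obtains p where "x_of p = x" "y_of p = y"
  by (cases x rule: F3_cases; cases y rule: F3_cases) (metis x_of.simps y_of.simps)+

lemma plane_eq_iff [simp]: "plane_eq p r \<longleftrightarrow> p = r"
  by (cases p; cases r; simp)

lemma both_iff [simp]: "both x y \<longleftrightarrow> x \<and> y" by (cases x) auto

lemma either_iff [simp]: "either x y \<longleftrightarrow> x \<or> y" by (cases x) auto

lemma vect_eq_iff [simp]: "vect_eq x y \<longleftrightarrow> x = y" by (cases x; cases y) auto

lemma sel_upd: "nonet_get p (nonet_set r x t) = (if p = r then x else nonet_get p t)"
  by (cases t; cases r; cases p; simp)

lemma trie_mem_trie_insert [simp]: "trie_mem x (trie_insert y s) \<longleftrightarrow> x = y \<or> trie_mem x s"
  by (cases x; cases y) (auto simp: sel_upd)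

text \<open>Both basis pairs have the same value \<open>\<sigma>\<close>, so
  \<open>vect_form\<close> computes \<open>\<omega>\<close> divided by \<open>\<sigma>\<close> and a
  single evaluation serves either sign.\<close>

locale frame =
  fixes a b e f :: P and \<sigma> :: F3
  assumes ab: "\<omega> a b = \<sigma>" and ef: "\<omega> e f = \<sigma>" and \<sigma>: "\<sigma> \<noteq> 0"
    and orth: "\<omega> a e = 0" "\<omega> a f = 0" "\<omega> b e = 0" "\<omega> b f = 0"
begin

lemma form_swapped: "\<omega> b a = - \<sigma>" "\<omega> f e = - \<sigma>" "\<omega> e a = 0" "\<omega> f a = 0" "\<omega> e b = 0" "\<omega> f b = 0"
  using ab ef orth \<omega>_swap by (metis neg_equal_0_iff_equal)+

fun \<phi> :: "vect \<Rightarrow> P" where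
  "\<phi> (V p r) = x_of p *s a + y_of p *s b + x_of r *s e + y_of r *s f"

lemma \<phi>_add [simp]: "\<phi> (vect_add x y) = \<phi> x + \<phi> y"
  by (cases x; cases y) (simp add: x_of_add y_of_add vec_eq_iff algebra_simps)

lemma \<phi>_sub [simp]: "\<phi> (vect_sub x y) = \<phi> x - \<phi> y"
  by (cases x; cases y) (simp add: x_of_sub y_of_sub vec_eq_iff algebra_simps)

lemma \<phi>_zv [simp]: "\<phi> (vect_scale k x) = F3_of k *s \<phi> x"
  by (cases x) (simp add: trit_scale_zf vec_eq_iff algebra_simps)

lemma \<phi>_neg [simp]: "\<phi> (vect_neg x) = - \<phi> x"
  by (cases x) (simp add: trit_scale_zf vec_eq_iff algebra_simps)

lemma \<phi>_zero [simp]: "\<phi> (V Q0 Q0) = 0"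
  by simp

lemma \<omega>_\<phi>: "\<omega> (\<phi> x) (\<phi> y) = \<sigma> * F3_of (vect_form x y)"
  by (cases x; cases y) (simp add: F3_of_add plane_form_zf ab ef orth form_swapped algebra_simps)

lemma vect_form_iff: "\<omega> (\<phi> x) (\<phi> y) = \<sigma> * F3_of k \<longleftrightarrow> vect_form x y = k"
  using \<sigma> by (simp add: \<omega>_\<phi> F3_of_inj)

lemma \<phi>_inj [simp]: "\<phi> x = \<phi> y \<longleftrightarrow> x = y"
proof
  assume eq: "\<phi> x = \<phi> y"
  obtain p r p' r' where v: "x = V p r" "y = V p' r'" by (cases x, cases y) blast
  have "\<omega> (\<phi> x) u = \<omega> (\<phi> y) u" for u using eq by simp
  from this[of a] this[of b] this[of e] this[of f] show "x = y"
    using \<sigma> by (auto simp: v ab ef orth form_swapped intro: q_eqI)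
qed simp

lemma \<phi>_surj: obtains x where "\<phi> x = w"
proof -
  obtain i j k l where w: "w = i *s a + j *s b + k *s e + l *s f"
    using symplectic_basis_spans[of a b e f w] ab ef \<sigma> orth by auto
  obtain p where p: "x_of p = i" "y_of p = j" by (rule q_surj)
  obtain r where r: "x_of r = k" "y_of r = l" by (rule q_surj)
  show thesis by (rule that[of "V p r"]) (simp add: p r w)
qed

lemma span_two:
  assumes "vect_form x y = Z1" "vect_form x p = Z0" "vect_form y p = Z0" "vect_form x r = Z0" "vect_form y r = Z0" "vect_form x d = Z0" "vect_form y d = Z0"
    "vect_form p r \<noteq> Z0"
  shows "d \<in> set (plane_span p r (vect_neg p) (vect_neg r))"
proof -
  have o: "\<omega> (\<phi> x) (\<phi> y) = \<sigma>" "\<omega> (\<phi> x) (\<phi> p) = 0" "\<omega> (\<phi> y) (\<phi> p) = 0" "\<omega> (\<phi> x) (\<phi> r) = 0" "\<omega> (\<phi> y) (\<phi> r) = 0"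
    "\<omega> (\<phi> x) (\<phi> d) = 0" "\<omega> (\<phi> y) (\<phi> d) = 0" "\<omega> (\<phi> p) (\<phi> r) \<noteq> 0"
    using assms \<sigma> by (auto simp: \<omega>_\<phi>) (metis F3_of.simps(1) F3_of_inj)
  then obtain i j k l where w: "\<phi> d = i *s \<phi> x + j *s \<phi> y + k *s \<phi> p + l *s \<phi> r"
    using symplectic_basis_spans[of "\<phi> x" "\<phi> y" "\<phi> p" "\<phi> r" "\<phi> d"] \<sigma> by auto
  have "\<omega> (\<phi> y) (\<phi> x) = - \<sigma>" using \<omega>_swap[of "\<phi> x" "\<phi> y"] o by simp
  then have "\<omega> (\<phi> y) (\<phi> d) = - (i * \<sigma>)" "\<omega> (\<phi> x) (\<phi> d) = j * \<sigma>"
    unfolding w using o by simp_all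
  then have "i = 0" "j = 0" using o \<sigma> by simp_all
  then have w: "\<phi> d = k *s \<phi> p + l *s \<phi> r" using w by simp
  show ?thesis
    by (cases k rule: F3_cases; cases l rule: F3_cases)
      (use w in \<open>simp_all flip: \<phi>_inj\<close>)
qed

lemma proj_orth:
  assumes "vect_form x y = Z1" shows "vect_form x (orth_proj x y d) = Z0" "vect_form y (orth_proj x y d) = Z0"
proof -
  have 1: "\<omega> (\<phi> x) (\<phi> y) = \<sigma>" using assms by (simp add: \<omega>_\<phi>)
  have 2: "\<omega> (\<phi> y) (\<phi> x) = - \<sigma>" using \<omega>_swap[of "\<phi> x" "\<phi> y"] 1 by simp
  have 3: "\<omega> (\<phi> x) (\<phi> d) = - \<sigma> * F3_of (vect_form d x)" "\<omega> (\<phi> y) (\<phi> d) = - \<sigma> * F3_of (vect_form d y)"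
    using \<omega>_swap[of "\<phi> x" "\<phi> d"] \<omega>_swap[of "\<phi> y" "\<phi> d"] by (simp_all add: \<omega>_\<phi>)
  have "\<omega> (\<phi> x) (\<phi> (orth_proj x y d)) = \<sigma> * F3_of Z0" "\<omega> (\<phi> y) (\<phi> (orth_proj x y d)) = \<sigma> * F3_of Z0"
    using 1 2 3 by (simp_all add: algebra_simps)
  then show "vect_form x (orth_proj x y d) = Z0" "vect_form y (orth_proj x y d) = Z0" unfolding vect_form_iff .
qed

lemma all_vects_all: "d \<in> set all_vects"
  by (cases d; cases "case d of V p r \<Rightarrow> p"; cases "case d of V p r \<Rightarrow> r"; simp add: all_vects_def)

lemma orth_complement_complete:
  assumes "vect_form x y = Z1" "vect_form x d = Z0" "vect_form y d = Z0"
  shows "d \<in> set (orth_complement x y)"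
proof -
  have s: "d \<in> set (plane_span (orth_proj x y p) (orth_proj x y r) (vect_neg (orth_proj x y p)) (vect_neg (orth_proj x y r)))"
    if "vect_form (orth_proj x y p) (orth_proj x y r) \<noteq> Z0" for p r
    by (rule span_two[of x y]) (use assms that proj_orth in auto)
  have 2: "d \<in> set (span_of_second (orth_proj x y p) (orth_proj x y r))" for p r
    using s[of p r] all_vects_all[of d]
    by (cases "vect_form (orth_proj x y p) (orth_proj x y r)") (simp_all del: orth_proj.simps plane_span.simps vect_neg.simps vect_form.simps)
  show ?thesis
    using s[of "V Q3 Q0" "V Q1 Q0"] 2
    by (cases "vect_form (orth_proj x y (V Q3 Q0)) (orth_proj x y (V Q1 Q0))") (simp_all del: orth_proj.simps plane_span.simps vect_neg.simps vect_form.simps span_of_second.simps)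
qed

end

primrec nat_of :: "unary \<Rightarrow> nat" where "nat_of U0 = 0" | "nat_of (US n) = Suc (nat_of n)"

lemma affordable_step_cost: "affordable (step_cost x y) r \<longleftrightarrow> of_bool (\<not> x) + of_bool (\<not> y) \<le> nat_of r"
  by (cases x; cases y; cases r; cases "case r of US r' \<Rightarrow> r'") auto

lemma nat_of_pay: "nat_of (pay (step_cost x y) r) = nat_of r - (of_bool (\<not> x) + of_bool (\<not> y))"
  by (cases x; cases y; cases r; cases "case r of US r' \<Rightarrow> r'") auto

lemma at_least_six_iff: "at_least_six n \<longleftrightarrow> 6 \<le> nat_of n"
  by (induction n rule: at_least_six.induct) auto

lemma nat_of_count_if [simp]: "nat_of (count_if x n) = of_bool x + nat_of n"
  by (cases x) auto

lemma append_edges_append [simp]: "append_edges xs ys = xs @ ys"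
  by (induction xs) auto

lemma vect_member_iff [simp]: "vect_member x ys \<longleftrightarrow> x \<in> set ys"
proof (induction ys)
  case (Cons y ys)
  then show ?case by (cases "x = y") auto
qed simp

lemma common_vects_set [simp]: "set (common_vects xs ys) = set xs \<inter> set ys"
proof (induction xs)
  case (Cons x xs)
  then show ?case by (cases "x \<in> set ys") auto
qed simp

lemma keep_affordable_keep: "(z, d) \<in> set al \<Longrightarrow> affordable (step_cost (trie_mem z s) (trie_mem d s)) r \<Longrightarrow> (z, d) \<in> set (keep_affordable r s al)"
proof (induction al)
  case (Cons x al)
  obtain z' d' where x: "x = (z', d')" by (cases x)
  show ?case using Cons by (cases "affordable (step_cost (trie_mem z' s) (trie_mem d' s)) r") (auto simp: x)
qed simp

lemma alternatives_complete: "d \<in> set ds \<Longrightarrow> vect_sub m d \<noteq> c \<Longrightarrow> (vect_sub m d, d) \<in> set (alternatives m c ds)"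
proof (induction ds)
  case (Cons d' ds)
  then show ?case by (cases "vect_sub m d' = c") auto
qed simp

lemma missing_points_sound:
  "(z, d) \<in> set al \<Longrightarrow> missing_points s al = Pts ps \<Longrightarrow>
    \<not> (trie_mem z s \<and> trie_mem d s) \<and> (\<not> trie_mem z s \<and> trie_mem d s \<longrightarrow> z \<in> set ps) \<and> (trie_mem z s \<and> \<not> trie_mem d s \<longrightarrow> d \<in> set ps)"
proof (induction al arbitrary: ps)
  case (Cons x al)
  obtain z' d' where x: "x = (z', d')" by (cases x)
  show ?case using Cons
    by (cases "trie_mem z' s"; cases "trie_mem d' s"; cases "missing_points s al") (auto simp: x)
qed simp

lemma same_triangle_sound: "same_triangle x y w (T3 a b c) \<Longrightarrow> (x, y, w) \<in> {(a, b, c), (b, c, a), (c, a, b)}"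
  by (cases "x = a"; cases "x = b"; cases "x = c") auto

lemma remove_open_sound:
  "remove_open x y es = RM t es' \<Longrightarrow> set es' \<subseteq> set es \<and> (\<forall>c. t = Some c \<longrightarrow> (\<exists>al. OE x y c al \<in> set es))"
proof (induction es arbitrary: t es')
  case (Cons e es)
  obtain a b c al where e: "e = OE a b c al" by (cases e)
  obtain t1 es1 where r: "remove_open x y es = RM t1 es1" by (cases "remove_open x y es")
  show ?case
    using Cons.prems Cons.IH[OF r] r by (cases "a = x"; cases "b = y") (auto simp: e)
qed simp

lemma pick_best_set: "pick_best s (PR e m acc) es = PR e' m' acc' \<Longrightarrow> insert e' (set acc') \<subseteq> insert e (set acc) \<union> set es"
proof (induction es arbitrary: e m acc)
  case (Cons x es)
  obtain a b c al where x: "x = OE a b c al" by (cases x)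
  show ?case
  proof (cases "unary_less (score s al) m")
    case True
    then have "pick_best s (PR x (score s al) (e # acc)) es = PR e' m' acc'" using Cons.prems by (simp add: x)
    from Cons.IH[OF this] show ?thesis by auto
  next
    case False
    then have "pick_best s (PR e m (x # acc)) es = PR e' m' acc'" using Cons.prems by (simp add: x)
    from Cons.IH[OF this] show ?thesis by auto
  qed
qed simp

lemma pick_edge_set: "pick_edge s e es = PR e' m' es' \<Longrightarrow> insert e' (set es') \<subseteq> insert e (set es)"
  by (cases e) (auto dest!: pick_best_set)

section \<open>Invariants of the search\<close>

locale framed = min_cycle S \<psi> + frame a0 b0 e0 f0 \<sigma> for S \<psi> a0 b0 e0 f0 \<sigma> +
  assumes nz: "0 \<notin> S" and cS: "card S \<le> 16"
begin

definition known :: "vect \<Rightarrow> bool" where "known x \<longleftrightarrow> \<phi> x \<in> insert 0 S"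

text \<open>The second condition selects one of the two cyclic orders; balance carries it over to
  the other two edges.\<close>

definition oriented :: "vect \<Rightarrow> vect \<Rightarrow> vect \<Rightarrow> bool" where
  "oriented x y z \<longleftrightarrow> {\<phi> x, \<phi> y, \<phi> z} \<in> Y \<and> vect_form x y = Z1"

abbreviation fourth_pt :: "vect \<Rightarrow> vect \<Rightarrow> vect \<Rightarrow> vect" where
  "fourth_pt x y z \<equiv> vect_neg (vect_add (vect_add x y) z)"

lemma card_known: "finite {x. known x}" "card {x. known x} \<le> 17"
proof -
  have inj: "inj_on \<phi> {x. known x}" by (simp add: inj_on_def)
  have sub: "\<phi> ` {x. known x} \<subseteq> insert 0 S" by (auto simp: known_def)
  show "finite {x. known x}" using inj sub fin by (meson finite_imageD finite_insert finite_subset)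
  have "card {x. known x} = card (\<phi> ` {x. known x})" using inj by (simp add: card_image)
  also have "\<dots> \<le> card (insert 0 S)" using sub fin by (intro card_mono) auto
  also have "\<dots> \<le> 17" using cS nz fin by simp
  finally show "card {x. known x} \<le> 17" .
qed

lemma oriented_facts:
  assumes "oriented x y z"
  shows "vect_form x y = Z1" "vect_form y z = Z1" "vect_form z x = Z1" "known x" "known y" "known z" "known (fourth_pt x y z)"
    "\<omega> (\<phi> x) (\<phi> y) = \<sigma>" "\<omega> (\<phi> y) (\<phi> z) = \<sigma>" "\<omega> (\<phi> z) (\<phi> x) = \<sigma>" "{\<phi> x, \<phi> y, \<phi> z} \<in> Y"
proof -
  show 1: "vect_form x y = Z1" and Y: "{\<phi> x, \<phi> y, \<phi> z} \<in> Y" using assms by (auto simp: oriented_def)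
  note t = trisD[OF Y_tris[OF Y]]
  show 2: "\<omega> (\<phi> x) (\<phi> y) = \<sigma>" using 1 by (simp add: \<omega>_\<phi>)
  then show 3: "\<omega> (\<phi> y) (\<phi> z) = \<sigma>" "\<omega> (\<phi> z) (\<phi> x) = \<sigma>" using t(4) by (auto simp: bal_def)
  then show "vect_form y z = Z1" "vect_form z x = Z1" using vect_form_iff[of y z Z1] vect_form_iff[of z x Z1] by auto
  show "known x" "known y" "known z" "known (fourth_pt x y z)" using t by (auto simp: known_def)
qed

lemma oriented_rot: "oriented x y z \<Longrightarrow> oriented y z x"
proof -
  assume t: "oriented x y z"
  have "{\<phi> y, \<phi> z, \<phi> x} = {\<phi> x, \<phi> y, \<phi> z}" by blast
  then show ?thesis using oriented_facts(2,11)[OF t] by (simp add: oriented_def)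
qed

text \<open>Needed to charge two points for a triangle. Equality would give
  \<open>y = z - x\<close>, hence \<open>\<sigma> = - \<sigma>\<close>.\<close>

lemma oriented_neq:
  assumes "oriented x y z" shows "z \<noteq> fourth_pt x y z"
proof
  assume "z = fourth_pt x y z"
  then have "\<phi> z = - (\<phi> x + \<phi> y + \<phi> z)" by (metis \<phi>_add \<phi>_neg)
  then have "\<phi> x + \<phi> y = - (\<phi> z + \<phi> z)" by (simp add: algebra_simps eq_neg_iff_add_eq_0)
  then have "\<phi> y = \<phi> z - \<phi> x" by (simp add: P_double algebra_simps)
  then have "\<sigma> = \<omega> (\<phi> x) (\<phi> z)" using oriented_facts(8)[OF assms] by simp
  then show False using oriented_facts(10)[OF assms] \<omega>_swap[of "\<phi> x" "\<phi> z"] \<sigma>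
    by (cases \<sigma> rule: F3_cases) auto
qed

text \<open>The source of all contradictions: a complete list of alternatives at an open edge cannot
  be empty.\<close>

lemma other_oriented:
  assumes "oriented x y z" shows "\<exists>z'. z' \<noteq> z \<and> oriented x y z'"
proof -
  note f = oriented_facts[OF assms]
  have ne: "\<phi> x \<noteq> \<phi> y" using f(8) \<sigma> by auto
  obtain T where T: "T \<in> Y" "T \<noteq> {\<phi> x, \<phi> y, \<phi> z}" "{\<phi> x, \<phi> y} \<subseteq> T"
    using other_triangle[OF f(11), of "{\<phi> x, \<phi> y}"] ne by auto
  have "card (T - {\<phi> x, \<phi> y}) = 1"
    using card_tri[OF Y_tris[OF T(1)]] T(3) ne by (subst card_Diff_subset) auto
  then obtain w where w: "T - {\<phi> x, \<phi> y} = {w}" by (rule card_1_singletonE)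
  obtain z' where z': "\<phi> z' = w" by (rule \<phi>_surj)
  have "T = {\<phi> x, \<phi> y, \<phi> z'}" using w z' T(3) by blast
  then show ?thesis using T f(1) by (intro exI[of _ z']) (auto simp: oriented_def)
qed

definition admissible :: "unary \<Rightarrow> trie \<Rightarrow> bool" where
  "admissible r s \<longleftrightarrow> (\<forall>x. trie_mem x s \<longrightarrow> known x) \<and> card {x. known x \<and> \<not> trie_mem x s} \<le> nat_of r"

lemma admissible_step:
  assumes "admissible r s" "known c" "known d" "c \<noteq> d"
  shows "affordable (step_cost (trie_mem c s) (trie_mem d s)) r" "admissible (pay (step_cost (trie_mem c s) (trie_mem d s)) r) (trie_insert c (trie_insert d s))"
proof -
  define X X' where "X = {x. known x \<and> \<not> trie_mem x s}" and "X' = {x. known x \<and> \<not> trie_mem x (trie_insert c (trie_insert d s))}"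
  have fin: "finite X" "finite X'"
    using card_known(1) by (auto simp: X_def X'_def)
  have "X = X' \<union> {x \<in> {c, d}. \<not> trie_mem x s}" "X' \<inter> {x \<in> {c, d}. \<not> trie_mem x s} = {}"
    using assms by (auto simp: X_def X'_def)
  then have "card X = card X' + card {x \<in> {c, d}. \<not> trie_mem x s}"
    using fin by (metis (no_types, lifting) card_Un_disjoint finite_Un)
  also have "card {x \<in> {c, d}. \<not> trie_mem x s} = of_bool (\<not> trie_mem c s) + of_bool (\<not> trie_mem d s)"
  proof -
    have "{x \<in> {c, d}. \<not> trie_mem x s} = (if trie_mem c s then {} else {c}) \<union> (if trie_mem d s then {} else {d})" by auto
    then show ?thesis using assms(4) by auto
  qed
  finally have c: "card X = card X' + (of_bool (\<not> trie_mem c s) + of_bool (\<not> trie_mem d s))" .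
  have "card X \<le> nat_of r" using assms(1) by (simp add: admissible_def X_def)
  then show "affordable (step_cost (trie_mem c s) (trie_mem d s)) r" "admissible (pay (step_cost (trie_mem c s) (trie_mem d s)) r) (trie_insert c (trie_insert d s))"
    using c assms by (auto simp: affordable_step_cost nat_of_pay admissible_def X'_def)
qed

text \<open>Only completeness of \<open>al\<close> is demanded; it may contain alternatives that do
  not occur, so filtering must merely keep the true ones.\<close>

fun edge_ok :: "open_edge \<Rightarrow> bool" where
  "edge_ok (OE a b c al) \<longleftrightarrow> oriented a b c \<and> (\<forall>z. z \<noteq> c \<longrightarrow> oriented a b z \<longrightarrow> (z, fourth_pt a b z) \<in> set al)"

fun triangle_ok :: "triangle \<Rightarrow> bool" where
  "triangle_ok (T3 a b c) \<longleftrightarrow> oriented a b c"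

lemma edge_ok_mk:
  assumes "oriented a b c" shows "edge_ok (make_open a b c)"
proof -
  have "(z, fourth_pt a b z) \<in> set (alternatives (vect_neg (vect_add a b)) c (orth_complement a b))" if z: "z \<noteq> c" "oriented a b z" for z
  proof -
    note f = oriented_facts[OF z(2)]
    have "\<omega> (\<phi> a) (\<phi> (fourth_pt a b z)) = \<sigma> * F3_of Z0" "\<omega> (\<phi> b) (\<phi> (fourth_pt a b z)) = \<sigma> * F3_of Z0"
      using f(8-10) \<omega>_swap[of "\<phi> b" "\<phi> a"] \<omega>_swap[of "\<phi> a" "\<phi> z"] by simp_all
    then have "fourth_pt a b z \<in> set (orth_complement a b)"
      using f(1) unfolding vect_form_iff by (intro orth_complement_complete)
    moreover have "vect_sub (vect_neg (vect_add a b)) (fourth_pt a b z) = z"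
      by (simp flip: \<phi>_inj)
    ultimately show ?thesis using alternatives_complete z(1) by metis
  qed
  then show ?thesis using assms by (simp del: orth_complement.simps)
qed

text \<open>A triangle that occurs has its points in \<open>S\<close> or zero, so it is always
  affordable; by \<open>other_oriented\<close> no list becomes empty.\<close>

lemma restrict_edges_sound:
  assumes "admissible r s" "\<forall>e\<in>set es. edge_ok e"
  shows "\<exists>es'. restrict_edges r s es = Some es' \<and> (\<forall>e\<in>set es'. edge_ok e)"
  using assms(2)
proof (induction es)
  case (Cons e es)
  obtain a b c al where e: "e = OE a b c al" by (cases e)
  have keep: "(z, fourth_pt a b z) \<in> set (keep_affordable r s al)" if "z \<noteq> c" "oriented a b z" for z
    using Cons.prems that oriented_facts[OF that(2)] oriented_neq[OF that(2)] admissible_step(1)[OF assms(1)]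
    by (intro keep_affordable_keep) (auto simp: e)
  have ok: "edge_ok (OE a b c (keep_affordable r s al))" using Cons.prems keep by (simp add: e)
  obtain z where "z \<noteq> c" "oriented a b z" using other_oriented[of a b c] Cons.prems by (auto simp: e)
  then obtain x xs where k: "keep_affordable r s al = x # xs" using keep by (cases "keep_affordable r s al") auto
  show ?case using Cons ok by (auto simp: e k)
qed simp

lemma missing_unique:
  assumes "admissible r s" "nat_of r \<le> 1" "known x" "\<not> trie_mem x s" "known x'" "\<not> trie_mem x' s"
  shows "x = x'"
proof -
  have "card {x. known x \<and> \<not> trie_mem x s} \<le> Suc 0" using assms by (simp add: admissible_def)
  then show ?thesis using assms card_known(1) by (auto simp: card_le_Suc0_iff_eq)
qed

lemma missing_points_missing:
  assumes "admissible r s" "nat_of r \<le> 1" "edge_ok (OE a b c al)" "missing_points s al = Pts ps"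
  shows "\<exists>x\<in>set ps. known x \<and> \<not> trie_mem x s"
proof -
  obtain z where z: "z \<noteq> c" "oriented a b z" using other_oriented[of a b c] assms by auto
  then have "(z, fourth_pt a b z) \<in> set al" using assms by auto
  note p = missing_points_sound[OF this assms(4)]
  note f = oriented_facts[OF z(2)]
  \<comment> \<open>Otherwise two distinct points would be missing.\<close>
  have "trie_mem z s \<or> trie_mem (fourth_pt a b z) s"
    using missing_unique[OF assms(1,2) f(6) _ f(7)] oriented_neq[OF z(2)] by blast
  then show ?thesis using p f by blast
qed

lemma no_common_point_sound:
  assumes "admissible r s" "nat_of r \<le> 1" "known x" "\<not> trie_mem x s"
  shows "\<forall>e\<in>set es. edge_ok e \<Longrightarrow> x \<in> set ps \<Longrightarrow> \<not> no_common_point s es ps"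
proof (induction es arbitrary: ps)
  case Nil
  then show ?case by (cases ps) auto
next
  case (Cons e es)
  obtain a b c al where e: "e = OE a b c al" by (cases e)
  obtain p ps' where ps: "ps = p # ps'" using Cons.prems by (cases ps) auto
  show ?case
  proof (cases "missing_points s al")
    case Sat
    then show ?thesis using Cons by (simp add: e ps)
  next
    case (Pts qs)
    then obtain x' where "x' \<in> set qs" "known x'" "\<not> trie_mem x' s"
      using missing_points_missing[OF assms(1,2) _ Pts, of a b c] Cons.prems(1) unfolding e list.set by blast
    then have "x \<in> set qs" using missing_unique[OF assms] by blast
    then show ?thesis using Cons.prems Cons.IH[of "common_vects ps qs"] by (auto simp: e ps Pts simp del: common_vects.simps)
  qed
qed

lemma no_missing_point_sound:
  assumes "admissible r s" "nat_of r \<le> 1"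
  shows "\<forall>e\<in>set es. edge_ok e \<Longrightarrow> \<not> no_missing_point s es"
proof (induction es)
  case (Cons e es)
  obtain a b c al where e: "e = OE a b c al" by (cases e)
  show ?case
  proof (cases "missing_points s al")
    case Sat
    then show ?thesis using Cons by (simp add: e)
  next
    case (Pts qs)
    then obtain x' where "x' \<in> set qs" "known x'" "\<not> trie_mem x' s"
      using missing_points_missing[OF assms(1,2) _ Pts, of a b c] Cons.prems(1) unfolding e list.set by blast
    then show ?thesis using Cons.prems no_common_point_sound[OF assms] by (auto simp: e Pts)
  qed
qed simp

lemma prune_sound:
  assumes "admissible r s" "\<forall>e\<in>set es. edge_ok e"
  shows "\<exists>es'. prune r s es = Some es' \<and> (\<forall>e\<in>set es'. edge_ok e)"
  using restrict_edges_sound[OF assms] no_missing_point_sound[OF assms(1) _ assms(2)] by (cases "(r, s, es)" rule: prune.cases) auto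

lemma required_sound: "\<forall>t\<in>set ts. triangle_ok t \<Longrightarrow> required x y w ts \<Longrightarrow> {\<phi> x, \<phi> y, \<phi> w} \<in> Y"
proof (induction ts)
  case (Cons t ts)
  obtain a b c where t: "t = T3 a b c" by (cases t)
  show ?case
  proof (cases "same_triangle x y w t")
    case True
    have "{\<phi> a, \<phi> b, \<phi> c} \<in> Y" using Cons.prems by (simp add: t oriented_def)
    then show ?thesis using same_triangle_sound[OF True[unfolded t]] by (auto simp: insert_commute)
  next
    case False
    then show ?thesis using Cons by simp
  qed
qed simp

text \<open>The vector \<open>l = c' - c\<close> is orthogonal to \<open>a\<close>, \<open>b\<close>
  and \<open>c\<close>, so shifting any of them by multiples of \<open>l\<close> changes no value of
  the form and all eight faces are balanced. The known fourth points put them into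
  \<open>tris S\<close>.\<close>

lemma octahedron_at_sound:
  assumes "admissible r s" "\<forall>t\<in>set q. triangle_ok t" "oriented a b c" "oriented a b c'" "c \<noteq> c'" "vect_form (vect_sub c' c) c = Z0"
    and a': "a' = vect_add a (vect_sub c' c) \<or> a' = vect_sub a (vect_sub c' c)" "trie_mem a' s"
    and b': "b' = vect_add b (vect_sub c' c) \<or> b' = vect_sub b (vect_sub c' c)" "trie_mem b' s"
  shows "\<not> octahedron_at x s q a a' b b' c c'"
proof
  assume oc: "octahedron_at x s q a a' b b' c c'"
  then have x: x by (cases x) auto
  define l where "l = \<phi> c' - \<phi> c"
  have l: "l \<noteq> 0" using assms(5) by (simp add: l_def)
  note f = oriented_facts[OF assms(3)] and f' = oriented_facts[OF assms(4)]
  have "\<omega> (\<phi> (vect_sub c' c)) (\<phi> c) = \<sigma> * F3_of Z0" using assms(6) unfolding vect_form_iff .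
  \<comment> \<open>Only the pairing with \<open>c\<close> was tested. Those with \<open>a\<close>
    and \<open>b\<close> vanish because \<open>c\<close> and \<open>c'\<close> complete the same
    oriented edge.\<close>
  then have o: "\<omega> l (\<phi> c) = 0" "\<omega> l (\<phi> a) = 0" "\<omega> (\<phi> b) l = 0"
    using f(8-10) f'(8-10) by (simp_all add: l_def)
  then have o': "\<omega> (\<phi> c) l = 0" "\<omega> (\<phi> a) l = 0" "\<omega> l (\<phi> b) = 0"
    using \<omega>_swap by (metis neg_equal_0_iff_equal)+
  have c': "\<phi> c' = \<phi> c + l" by (simp add: l_def)
  have A: "\<phi> a' = \<phi> a + l \<or> \<phi> a' = \<phi> a - l" and B: "\<phi> b' = \<phi> b + l \<or> \<phi> b' = \<phi> b - l"
    using a' b' by (auto simp: l_def)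
  have bal_all: "bal p q r" if p: "p \<in> {\<phi> a, \<phi> a'}" and q: "q \<in> {\<phi> b, \<phi> b'}" and r: "r \<in> {\<phi> c, \<phi> c'}" for p q r
  proof -
    have "p = \<phi> a \<or> p = \<phi> a + l \<or> p = \<phi> a - l" "q = \<phi> b \<or> q = \<phi> b + l \<or> q = \<phi> b - l" "r = \<phi> c \<or> r = \<phi> c + l"
      using p q r A B c' by auto
    then show ?thesis using o o' f(8-10) \<sigma> by (elim disjE) (simp_all add: bal_def)
  qed
  have inM: "\<phi> a \<in> insert 0 S" "\<phi> a' \<in> insert 0 S" "\<phi> b \<in> insert 0 S" "\<phi> b' \<in> insert 0 S"
    "\<phi> c \<in> insert 0 S" "\<phi> c' \<in> insert 0 S"
    using f f' a'(2) b'(2) assms(1) by (auto simp: known_def admissible_def)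
  have fourth_mem: "- (\<phi> x + \<phi> y + \<phi> w) \<in> insert 0 S" if "fourth_mem s x y w" for x y w
  proof -
    have "known (fourth_pt x y w)" using that assms(1) unfolding fourth_mem.simps admissible_def by blast
    then show ?thesis by (simp add: known_def)
  qed
  have acts: "fourth_mem s p q r" if "p \<in> {a, a'}" "q \<in> {b, b'}" "r \<in> {c, c'}" for p q r
    using oc x that by (auto simp del: fourth_mem.simps)
  have tris_all: "{p, q, r} \<in> tris S" if p: "p \<in> {\<phi> a, \<phi> a'}" and q: "q \<in> {\<phi> b, \<phi> b'}" and r: "r \<in> {\<phi> c, \<phi> c'}" for p q r
  proof (rule trisI[OF _ _ _ bal_all[OF that]])
    have "\<omega> p q \<noteq> 0" "\<omega> q r \<noteq> 0" "\<omega> r p \<noteq> 0" using bal_all[OF that] by (auto simp: bal_def)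
    then have "p \<noteq> 0" "q \<noteq> 0" "r \<noteq> 0" by auto
    moreover have "p \<in> insert 0 S" "q \<in> insert 0 S" "r \<in> insert 0 S" using that inM by blast+
    ultimately show "p \<in> S" "q \<in> S" "r \<in> S" by simp_all
    obtain p' where p': "p = \<phi> p'" "p' \<in> {a, a'}" using p by (elim insertE) auto
    obtain q' where q': "q = \<phi> q'" "q' \<in> {b, b'}" using q by (elim insertE) auto
    obtain r' where r': "r = \<phi> r'" "r' \<in> {c, c'}" using r by (elim insertE) auto
    from p'(2) q'(2) r'(2) have "fourth_mem s p' q' r'" by (rule acts)
    then show "- (p + q + r) \<in> insert 0 S" unfolding p'(1) q'(1) r'(1) by (rule fourth_mem)
  qed
  \<comment> \<open>The chosen triangles are only part of \<open>Y\<close>, so the computed count is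
    a lower bound, which is the direction needed.\<close>
  have tm_le: "of_bool (required x y w q) \<le> (of_bool ({\<phi> x, \<phi> y, \<phi> w} \<in> Y) :: nat)" for x y w
    using required_sound[OF assms(2), of x y w] by auto
  have ne: "\<phi> a \<noteq> \<phi> a'" "\<phi> b \<noteq> \<phi> b'" "\<phi> c \<noteq> \<phi> c'" using A B c' l by auto
  have two: "sum g {p, p'} = g p + g p'" if "p \<noteq> p'" for g :: "P \<Rightarrow> nat" and p p'
    using that by simp
  have "6 \<le> of_bool (required a b c q) + of_bool (required a b c' q) + of_bool (required a b' c q) + of_bool (required a b' c' q)
      + of_bool (required a' b c q) + of_bool (required a' b c' q) + of_bool (required a' b' c q) + (of_bool (required a' b' c' q) :: nat)"
    using oc x by (simp add: at_least_six_iff del: fourth_mem.simps)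
  then have "6 \<le> (\<Sum>p\<in>{\<phi> a, \<phi> a'}. \<Sum>q\<in>{\<phi> b, \<phi> b'}. \<Sum>r\<in>{\<phi> c, \<phi> c'}. of_bool ({p, q, r} \<in> Y) :: nat)"
    unfolding two[OF ne(1)] two[OF ne(2)] two[OF ne(3)]
    using tm_le[of a b c] tm_le[of a b c'] tm_le[of a b' c] tm_le[of a b' c'] tm_le[of a' b c] tm_le[of a' b c'] tm_le[of a' b' c] tm_le[of a' b' c']
    by linarith
  with octahedron[OF ne tris_all] show False by blast
qed

lemma octahedra_sound:
  assumes "admissible r s" "\<forall>t\<in>set q. triangle_ok t" "oriented a b c" "oriented a b c'"
  shows "\<not> octahedra s q a b c c'"
proof
  assume o: "octahedra s q a b c c'"
  define l where "l = vect_sub c' c"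
  have ne: "c \<noteq> c'" using o by (cases "c = c'") auto
  then have "octahedra_parallel l s q a b c c'" using o unfolding l_def octahedra.simps by simp
  moreover then have "vect_form l c = Z0" by (cases "vect_form l c") auto
  moreover have "\<not> octahedron_at (both (trie_mem a' s) (trie_mem b' s)) s q a a' b b' c c'"
    if "a' \<in> {vect_add a l, vect_sub a l}" "b' \<in> {vect_add b l, vect_sub b l}" for a' b'
  proof (cases "trie_mem a' s \<and> trie_mem b' s")
    case True
    then show ?thesis
      using that \<open>vect_form l c = Z0\<close> unfolding l_def by (intro octahedron_at_sound[OF assms ne]) auto
  next
    case False
    then have "both (trie_mem a' s) (trie_mem b' s) = False" by simp
    then show ?thesis by (simp only: octahedron_at.simps) simp
  qed
  ultimately show False by (simp del: vect_add.simps octahedron_at.simps both_iff)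
qed

lemma octahedra_closing_sound:
  assumes "admissible r s" "\<forall>t\<in>set q. triangle_ok t" "\<And>x. t = Some x \<Longrightarrow> oriented a b x" "oriented a b c"
  shows "\<not> octahedra_closing t s q a b c"
  using octahedra_sound[OF assms(1,2) assms(3) assms(4)] by (cases t) auto

lemma new_edges_sound: "oriented a b c \<Longrightarrow> \<forall>e\<in>set (new_edges t a b c q). edge_ok e"
  using edge_ok_mk by (cases t; cases "edge_occurs a b q") auto

lemma join_edges_sound:
  assumes "admissible r s" "\<forall>e\<in>set es. edge_ok e" "\<forall>e\<in>set fs. edge_ok e"
  shows "\<exists>es'. join_edges r s es fs = Some es' \<and> (\<forall>e\<in>set es'. edge_ok e)"
proof -
  have ok: "\<forall>e\<in>set (es @ fs). edge_ok e" using assms by auto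
  show ?thesis
    using restrict_edges_sound[OF assms(1) ok] no_missing_point_sound[OF assms(1) _ ok] ok
    by (cases "(r, s, es, fs)" rule: join_edges.cases) auto
qed

lemma extend_by_sound:
  assumes admissible: "admissible r s" and es: "\<forall>e\<in>set es. edge_ok e" and q: "\<forall>t\<in>set q. triangle_ok t" and T: "oriented a b c" "oriented a b c'"
  shows "\<exists>es'. extend_by (remove_open b c' es) r s q a b c c' = Some es' \<and> (\<forall>e\<in>set es'. edge_ok e)"
proof -
  obtain t1 es1 where r1: "remove_open b c' es = RM t1 es1" by (cases "remove_open b c' es")
  obtain t2 es2 where r2: "remove_open c' a es1 = RM t2 es2" by (cases "remove_open c' a es1")
  note s1 = remove_open_sound[OF r1] and s2 = remove_open_sound[OF r2]
  have es2: "\<forall>e\<in>set es2. edge_ok e" using es s1 s2 by blast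
  have t1: "oriented b c' x" if "t1 = Some x" for x using s1 es that by fastforce
  have t2: "oriented c' a x" if "t2 = Some x" for x using s1 s2 es that by fastforce
  obtain fs where fs: "prune r s es2 = Some fs" "\<forall>e\<in>set fs. edge_ok e" using prune_sound[OF admissible es2] by blast
  have T2: "oriented b c' a" "oriented c' a b" using T oriented_rot by blast+
  have q': "\<forall>t\<in>set (T3 a b c' # q). triangle_ok t" using q T by simp
  have "\<not> octahedra s (T3 a b c' # q) a b c c'" "\<not> octahedra_closing t1 s (T3 a b c' # q) b c' a" "\<not> octahedra_closing t2 s (T3 a b c' # q) c' a b"
    using octahedra_sound[OF admissible q' T] octahedra_closing_sound[OF admissible q' t1 T2(1)] octahedra_closing_sound[OF admissible q' t2 T2(2)] by blast+
  then have no: "either (octahedra s (T3 a b c' # q) a b c c')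
     (either (octahedra_closing t1 s (T3 a b c' # q) b c' a) (octahedra_closing t2 s (T3 a b c' # q) c' a b)) = False" by (simp del: octahedra.simps)
  have new_edges_ok: "\<forall>e\<in>set (append_edges (new_edges t1 b c' a q) (new_edges t2 c' a b q)). edge_ok e"
    using new_edges_sound[OF T2(1)] new_edges_sound[OF T2(2)] by auto
  obtain gs where gs: "restrict_edges r s (append_edges (new_edges t1 b c' a q) (new_edges t2 c' a b q)) = Some gs" "\<forall>e\<in>set gs. edge_ok e"
    using restrict_edges_sound[OF admissible new_edges_ok] by blast
  show ?thesis
    unfolding r1 extend_by.simps r2 extend_second.simps fs(1) extend_pruned.simps no extend_if.simps gs(1) join_new.simps
    by (rule join_edges_sound[OF admissible gs(2) fs(2)])
qed

text \<open>The given cycle is followed along one branch: \<open>z\<close> is a third vertex that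
  really occurs, and the recursive call for it starts from a state in which all invariants
  hold.\<close>

lemma search_sound:
  "search n r s es q \<Longrightarrow> admissible r s \<Longrightarrow> \<forall>e\<in>set es. edge_ok e \<Longrightarrow> \<forall>t\<in>set q. triangle_ok t \<Longrightarrow> False"
  "search_choice n pr r s q \<Longrightarrow> admissible r s \<Longrightarrow> (\<And>e m es'. pr = PR e m es' \<Longrightarrow> edge_ok e \<and> (\<forall>e\<in>set es'. edge_ok e)) \<Longrightarrow>
    \<forall>t\<in>set q. triangle_ok t \<Longrightarrow> False"
  "search_alts n al a b c es r s q \<Longrightarrow> admissible r s \<Longrightarrow> \<forall>e\<in>set es. edge_ok e \<Longrightarrow> \<forall>t\<in>set q. triangle_ok t \<Longrightarrow> oriented a b c \<Longrightarrow>
    z \<noteq> c \<Longrightarrow> oriented a b z \<Longrightarrow> (z, fourth_pt a b z) \<in> set al \<Longrightarrow> False"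
  "search_state n oes r s q \<Longrightarrow> admissible r s \<Longrightarrow> (\<exists>es. oes = Some es \<and> (\<forall>e\<in>set es. edge_ok e)) \<Longrightarrow> \<forall>t\<in>set q. triangle_ok t \<Longrightarrow> False"
  "search_rest n x xs a b c es r s q \<Longrightarrow> admissible r s \<Longrightarrow> \<forall>e\<in>set es. edge_ok e \<Longrightarrow> \<forall>t\<in>set q. triangle_ok t \<Longrightarrow> oriented a b c \<Longrightarrow>
    z \<noteq> c \<Longrightarrow> oriented a b z \<Longrightarrow> (z, fourth_pt a b z) \<in> set xs \<Longrightarrow> False"
  "search_extend n s r a b c c' es q \<Longrightarrow> admissible r s \<Longrightarrow> \<forall>e\<in>set es. edge_ok e \<Longrightarrow> \<forall>t\<in>set q. triangle_ok t \<Longrightarrow> oriented a b c \<Longrightarrow> oriented a b c' \<Longrightarrow> False"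
proof (induction n r s es q and n pr r s q and n al a b c es r s q and n oes r s q and n x xs a b c es r s q and n s r a b c c' es q
    arbitrary: and and z and and z rule: search_search_choice_search_alts_search_state_search_rest_search_extend.induct)
  case (3 n r s e es q)
  obtain e' m es' where p: "pick_edge s e es = PR e' m es'" by (cases "pick_edge s e es")
  show ?case using 3 pick_edge_set[OF p] by (auto simp: p simp del: pick_edge.simps)
next
  case (4 n a b c al m es r s q)
  have ok: "edge_ok (OE a b c al)" "\<forall>e\<in>set es. edge_ok e" using "4.prems"(3) by blast+
  obtain z where z: "z \<noteq> c" "oriented a b z" using other_oriented[of a b c] ok(1) by auto
  show ?case using "4.IH"[of z] "4.prems" ok z by auto
next
  case (6 n c' d xs a b c es r s q)
  let ?i = "search_extend n (trie_insert c' (trie_insert d s)) (pay (step_cost (trie_mem c' s) (trie_mem d s)) r) a b c c' es q"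
  have i: ?i using "6.prems"(1) by (cases ?i) auto
  show ?case
  proof (cases "c' = z \<and> d = fourth_pt a b z")
    case True
    note f = oriented_facts[OF "6.prems"(7)]
    show ?thesis
      using "6.IH"(1)[OF i] admissible_step(2)[OF "6.prems"(2) f(6,7) oriented_neq[OF "6.prems"(7)]] "6.prems" True by auto
  next
    case False
    then show ?thesis using "6.IH"(2)[of z] "6.prems" by auto
  qed
next
  case (7 n s r a b c c' es q)
  show ?case using 7 extend_by_sound[of r s es q a b c c'] by (auto simp del: extend_by.simps)
qed (auto)

lemma make_all_open_sound: "\<forall>t\<in>set ts. triangle_ok t \<Longrightarrow> \<forall>e\<in>set (make_all_open ts). edge_ok e"
proof (induction ts)
  case (Cons t ts)
  then show ?case using edge_ok_mk by (cases t) (auto simp del: make_open.simps)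
qed simp

lemma trie_mem_trie_of: "trie_mem x (trie_of xs) \<longleftrightarrow> x \<in> set xs"
proof (induction xs)
  case Nil
  have [simp]: "nonet_get p (nine_times k) = k" for p and k :: 'k by (cases p; simp add: nine_times_def)
  show ?case by (cases x) simp
qed simp

text \<open>The initial trie holds \<open>ps\<close> and zero, that is \<open>length ps + 1\<close>
  of at most 17 known points.\<close>

lemma search_from_sound:
  assumes "search_from r ps ts q" "\<And>x. x \<in> set ps \<Longrightarrow> known x" "\<forall>t\<in>set ts. triangle_ok t" "\<forall>t\<in>set q. triangle_ok t"
    "distinct (V Q0 Q0 # ps)" "16 \<le> length ps + nat_of r"
  shows False
proof -
  have "{x. known x \<and> \<not> trie_mem x (trie_of (V Q0 Q0 # ps))} = {x. known x} - set (V Q0 Q0 # ps)" by (auto simp: trie_mem_trie_of simp del: trie_of.simps)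
  moreover have sub: "set (V Q0 Q0 # ps) \<subseteq> {x. known x}" using assms(2) by (auto simp: known_def)
  ultimately have "card {x. known x \<and> \<not> trie_mem x (trie_of (V Q0 Q0 # ps))} = card {x. known x} - length (V Q0 Q0 # ps)"
    using assms(5) by (metis card_Diff_subset distinct_card finite_set)
  also have "\<dots> \<le> nat_of r" using card_known assms(6) by simp
  finally have admissible: "admissible r (trie_of (V Q0 Q0 # ps))"
    using sub unfolding admissible_def by (auto simp: trie_mem_trie_of simp del: trie_of.simps)
  show False
    using restrict_edges_sound[OF admissible make_all_open_sound[OF assms(3)]] assms(1) search_sound(1)[OF _ admissible _ assms(4)]
    by (auto simp del: trie_of.simps)
qed

end

section \<open>Refuting a configuration of initial triangles\<close>

fun fourth :: "vect \<Rightarrow> vect \<Rightarrow> vect \<Rightarrow> vect" where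
  "fourth x y z = vect_neg (vect_add (vect_add x y) z)"

fun cons_new_step :: "bool \<Rightarrow> vect \<Rightarrow> vect list \<Rightarrow> vect list" where
  "cons_new_step True x xs = xs" | "cons_new_step False x xs = x # xs"

fun cons_new :: "vect \<Rightarrow> vect list \<Rightarrow> vect list" where
  "cons_new x xs = cons_new_step (vect_member x (V Q0 Q0 # xs)) x xs"

fun all_points :: "triangle list \<Rightarrow> vect list" where
  "all_points [] = []"
| "all_points (T3 a b c # ts) = cons_new a (cons_new b (cons_new c (cons_new (fourth a b c) (all_points ts))))"

fun budget_left :: "unary \<Rightarrow> vect list \<Rightarrow> unary" where
  "budget_left n [] = n" | "budget_left U0 (p # ps) = U0" | "budget_left (US n) (p # ps) = budget_left n ps"

fun edge_degree :: "vect \<Rightarrow> vect \<Rightarrow> triangle list \<Rightarrow> unary" where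
  "edge_degree x y [] = U0" | "edge_degree x y (t # ts) = count_if (has_edge x y t) (edge_degree x y ts)"
text \<open>Only edges in exactly one of the given triangles are opened: the common edge of the initial triangles
  has no forced continuation.\<close>

fun open_if :: "unary \<Rightarrow> triangle \<Rightarrow> triangle list \<Rightarrow> triangle list" where
  "open_if (US (US n)) t ts = ts" | "open_if U0 t ts = t # ts" | "open_if (US U0) t ts = t # ts"

fun open_rotations :: "triangle list \<Rightarrow> triangle list \<Rightarrow> triangle list" where
  "open_rotations q [] = []"
| "open_rotations q (T3 a b c # ts) = open_if (edge_degree a b q) (T3 a b c) (open_if (edge_degree b c q) (T3 b c a) (open_if (edge_degree c a q) (T3 c a b) (open_rotations q ts)))"

fun octahedra_if :: "bool \<Rightarrow> trie \<Rightarrow> triangle list \<Rightarrow> vect \<Rightarrow> vect \<Rightarrow> vect \<Rightarrow> vect \<Rightarrow> bool" where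
  "octahedra_if True s q a b c c' = octahedra s q a b c c'" | "octahedra_if False s q a b c c' = False"

fun octahedra_with :: "trie \<Rightarrow> triangle list \<Rightarrow> vect \<Rightarrow> vect \<Rightarrow> vect \<Rightarrow> triangle list \<Rightarrow> bool" where
  "octahedra_with s q a b c [] = False"
| "octahedra_with s q a b c (T3 a' b' c' # ts) = either (octahedra_if (both (vect_eq a a') (vect_eq b b')) s q a b c c') (octahedra_with s q a b c ts)"

fun octahedra_among :: "trie \<Rightarrow> triangle list \<Rightarrow> triangle list \<Rightarrow> bool" where
  "octahedra_among s q [] = False"
| "octahedra_among s q (T3 a b c # ts) = either (octahedra_with s q a b c ts) (octahedra_among s q ts)"

definition "budget16 = US (US (US (US (US (US (US (US budget8)))))))"

fun refutes_unless :: "bool \<Rightarrow> vect list \<Rightarrow> triangle list \<Rightarrow> bool" where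
  "refutes_unless True ps q = True"
| "refutes_unless False ps q = search_from (budget_left budget16 ps) ps (open_rotations q q) q"

fun refutes_with :: "vect list \<Rightarrow> triangle list \<Rightarrow> bool" where
  "refutes_with ps q = refutes_unless (octahedra_among (trie_of (V Q0 Q0 # ps)) q q) ps q"

definition refutes :: "triangle list \<Rightarrow> bool" where "refutes q = refutes_with (all_points q) q"

lemma nat_of_budget_left: "length ps \<le> nat_of n \<Longrightarrow> nat_of (budget_left n ps) = nat_of n - length ps"
  by (induction n ps rule: budget_left.induct) auto

lemma cons_new_if: "cons_new x xs = (if x \<in> set (V Q0 Q0 # xs) then xs else x # xs)"
proof (cases "x \<in> set (V Q0 Q0 # xs)")
  case True
  then have "vect_member x (V Q0 Q0 # xs) = True" unfolding vect_member_iff by (rule eqTrueI)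
  then show ?thesis using True by (simp only: cons_new.simps cons_new_step.simps if_True)
next
  case False
  then have "vect_member x (V Q0 Q0 # xs) = False" unfolding vect_member_iff by (rule Eq_FalseI[THEN meta_eq_to_obj_eq])
  then show ?thesis using False by (simp only: cons_new.simps cons_new_step.simps if_False)
qed

declare cons_new.simps [simp del]

lemma cons_new_set: "set (cons_new x xs) \<subseteq> insert x (set xs)"
  by (auto simp: cons_new_if)

lemma cons_new_distinct: "distinct (V Q0 Q0 # xs) \<Longrightarrow> distinct (V Q0 Q0 # cons_new x xs)"
  by (auto simp: cons_new_if)

lemma all_points_distinct: "distinct (V Q0 Q0 # all_points q)"
proof (induction q rule: all_points.induct)
  case (2 a b c ts)
  then show ?case unfolding all_points.simps by (intro cons_new_distinct)
qed simp

lemma all_points_set: "set (all_points (T3 a b c # ts)) \<subseteq> {a, b, c, fourth a b c} \<union> set (all_points ts)"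
  unfolding all_points.simps
  using cons_new_set[of a "cons_new b (cons_new c (cons_new (fourth a b c) (all_points ts)))"] cons_new_set[of b "cons_new c (cons_new (fourth a b c) (all_points ts))"]
    cons_new_set[of c "cons_new (fourth a b c) (all_points ts)"] cons_new_set[of "fourth a b c" "all_points ts"] by auto

context framed
begin

lemma all_points_sound: "\<forall>t\<in>set q. triangle_ok t \<Longrightarrow> x \<in> set (all_points q) \<Longrightarrow> known x"
proof (induction q rule: all_points.induct)
  case (2 a b c ts)
  then have T: "oriented a b c" by simp
  have "x \<in> {a, b, c, fourth a b c} \<or> x \<in> set (all_points ts)" using all_points_set[of a b c ts] "2.prems"(2) by blast
  then show ?case using "2.IH" "2.prems"(1) oriented_facts(4-7)[OF T] by auto
qed simp

lemma open_if_sound: "\<forall>t\<in>set (open_if n t ts). P t" if "P t" "\<forall>t\<in>set ts. P t"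
  using that by (cases "(n, t, ts)" rule: open_if.cases) auto

lemma open_rotations_sound: "\<forall>t\<in>set ts. triangle_ok t \<Longrightarrow> \<forall>t\<in>set (open_rotations q ts). triangle_ok t"
proof (induction q ts rule: open_rotations.induct)
  case (2 q a b c ts)
  then have T: "oriented a b c" by simp
  show ?case unfolding open_rotations.simps
    by (intro open_if_sound) (use 2 T oriented_rot in auto)
qed simp

lemma octahedra_among_sound:
  assumes "admissible r s" "\<forall>t\<in>set q. triangle_ok t"
  shows "\<forall>t\<in>set ts. triangle_ok t \<Longrightarrow> \<not> octahedra_among s q ts"
proof -
  have 1: "\<not> octahedra_with s q a b c ts" if "oriented a b c" "\<forall>t\<in>set ts. triangle_ok t" for a b c ts
    using that(2)
  proof (induction ts)
    case (Cons t ts)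
    obtain a' b' c' where t: "t = T3 a' b' c'" by (cases t)
    show ?case using Cons octahedra_sound[OF assms that(1), of c']
      by (cases "a = a' \<and> b = b'") (auto simp: t simp del: octahedra.simps)
  qed simp
  show "\<forall>t\<in>set ts. triangle_ok t \<Longrightarrow> \<not> octahedra_among s q ts"
  proof (induction ts)
    case (Cons t ts)
    then show ?case using 1 by (cases t) auto
  qed simp
qed

lemma refutes_sound:
  assumes "refutes q" "\<forall>t\<in>set q. triangle_ok t"
  shows False
proof -
  let ?ps = "all_points q"
  have known: "known x" if "x \<in> set (V Q0 Q0 # ?ps)" for x
    using all_points_sound[OF assms(2)] that by (auto simp: known_def)
  have "card (set (V Q0 Q0 # ?ps)) \<le> card {x. known x}"
    using known card_known(1) by (intro card_mono) auto
  then have len: "length ?ps \<le> 16"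
    using card_known(2) distinct_card[OF all_points_distinct, of q] by simp
  have budget16: "nat_of budget16 = 16" by (simp add: budget16_def budget8_def)
  have left: "nat_of (budget_left budget16 ?ps) = 16 - length ?ps" using nat_of_budget_left[of ?ps budget16] len budget16 by simp
  consider "octahedra_among (trie_of (V Q0 Q0 # ?ps)) q q" | "search_from (budget_left budget16 ?ps) ?ps (open_rotations q q) q"
    using assms(1) by (cases "octahedra_among (trie_of (V Q0 Q0 # ?ps)) q q") (auto simp: refutes_def simp del: trie_of.simps search_from.simps)
  then show False
  proof cases
    case 1
    have "{x. known x \<and> \<not> trie_mem x (trie_of (V Q0 Q0 # ?ps))} \<subseteq> {x. known x}" by auto
    \<comment> \<open>The octahedron test does not depend on the budget, so the trivial bound 17 on
      all known points will do.\<close>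
    then have "admissible (((^^) US) 17 U0) (trie_of (V Q0 Q0 # ?ps))"
      using known card_known card_mono[OF card_known(1)] unfolding admissible_def
      by (auto simp: trie_mem_trie_of numeral_eq_Suc simp del: trie_of.simps intro: order_trans)
    from octahedra_among_sound[OF this assms(2) assms(2)] 1 show False by blast
  next
    case 2
    show False
      by (rule search_from_sound[OF 2]) (use assms(2) known open_rotations_sound all_points_distinct[of q] left len in \<open>auto simp del: distinct.simps\<close>)
  qed
qed

lemma Tr_I: "{\<phi> x, \<phi> y, \<phi> z} \<in> Y \<Longrightarrow> vect_form x y = Z1 \<Longrightarrow> oriented x y z"
  by (simp add: oriented_def)

end

abbreviation "base_tri r \<equiv> T3 vA vB (V Q8 r)"
text \<open>The third vertex belonging to \<open>d\<close> in the orthogonal complement of \<open>a, b\<close> is \<open>-(a + b + d)\<close>, which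
  is \<open>V Q8 (-d)\<close>; a fan consists of the triangles for \<open>d \<in> {0, f, -f}\<close>.\<close>

definition "fan = [base_tri Q0, base_tri Q2, base_tri Q1]"

text \<open>One further triangle at each edge of the fan other than \<open>a, b\<close>, with third
  vertex \<open>a \<plusminus> f\<close> or \<open>b \<plusminus> f\<close>; the six signs give 64
  configurations.\<close>

definition "coset_tris j0 k0 j1 k1 j2 k2 = [T3 vB (V Q8 Q0) (V Q3 j0), T3 (V Q8 Q0) vA (V Q1 k0), T3 vB (V Q8 Q2) (V Q3 j1),
    T3 (V Q8 Q2) vA (V Q1 k1), T3 vB (V Q8 Q1) (V Q3 j2), T3 (V Q8 Q1) vA (V Q1 k2)]"

definition "coset_list = [coset_tris j0 k0 j1 k1 j2 k2 @ fan. j0 \<leftarrow> [Q1, Q2], k0 \<leftarrow> [Q1, Q2],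
    j1 \<leftarrow> [Q1, Q2], k1 \<leftarrow> [Q1, Q2], j2 \<leftarrow> [Q1, Q2], k2 \<leftarrow> [Q1, Q2]]"

definition "both_signs p = list_all p [Q1, Q2]"

lemma all_coset_list:
  assumes "list_all p coset_list"
  shows "both_signs (\<lambda>j0. both_signs (\<lambda>k0. both_signs (\<lambda>j1. both_signs (\<lambda>k1. both_signs (\<lambda>j2. both_signs (\<lambda>k2. p (coset_tris j0 k0 j1 k1 j2 k2 @ fan)))))))"
  using assms by (simp add: coset_list_def both_signs_def)

subsection \<open>Three triangles at one edge\<close>

text \<open>Since \<open>base_tri r\<close> belongs to \<open>d = -r\<close>, this and the next
  three lemmas treat the shapes \<open>{0, e, f}\<close>, \<open>{f, -f, e}\<close>,
  \<open>{e, f, -(e + f)}\<close> and \<open>{e, f, e + f}\<close>; the fan is the fifth.\<close>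

lemma refuted_0ef: "refutes [base_tri Q0, base_tri Q6, base_tri Q2]" by code_simp

lemma refuted_opposite: "refutes [base_tri Q2, base_tri Q1, base_tri Q6]" by code_simp

lemma refuted_zero_sum: "refutes [base_tri Q6, base_tri Q2, base_tri Q4]" by code_simp

lemma refuted_sum: "refutes [base_tri Q6, base_tri Q2, base_tri Q8]" by code_simp

text \<open>The normal forms of a continuation of the fan off the cosets of \<open>f\<close>: here
  at \<open>c = -(a + b)\<close>, in the next two lemmas at \<open>c = -(a + b + f)\<close>.\<close>

lemma refuted_fan_zero: "refutes (T3 vB (V Q8 Q0) (V Q3 Q6) # fan)" by code_simp

lemma refuted_fan_minus: "refutes (T3 vB (V Q8 Q2) (V Q5 Q7) # fan)" by code_simp

lemma refuted_fan_plus: "refutes (T3 vB (V Q8 Q2) (V Q4 Q4) # fan)" by code_simp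

lemma refuted_fan_cosets: "list_all refutes coset_list" by code_simp

fun one_of :: "plane \<Rightarrow> plane \<Rightarrow> plane \<Rightarrow> plane \<Rightarrow> bool" where
  "one_of x r1 r2 r3 = either (plane_eq x r1) (either (plane_eq x r2) (plane_eq x r3))"

fun contains_form :: "trit \<Rightarrow> plane \<Rightarrow> plane \<Rightarrow> plane \<Rightarrow> plane \<Rightarrow> plane \<Rightarrow> bool" where
  "contains_form Z0 x y r1 r2 r3 = False" | "contains_form Z2 x y r1 r2 r3 = False"
| "contains_form Z1 x y r1 r2 r3 = either (one_of Q0 r1 r2 r3) (either (one_of (trit_scale Z2 y) r1 r2 r3)
     (either (one_of (trit_scale Z2 (plane_add x y)) r1 r2 r3) (one_of (plane_add x y) r1 r2 r3)))"

fun contains_fan :: "plane \<Rightarrow> plane \<Rightarrow> plane \<Rightarrow> plane \<Rightarrow> bool" where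
  "contains_fan y r1 r2 r3 = both (both (one_of Q0 r1 r2 r3) (one_of (trit_scale Z2 y) r1 r2 r3)) (if plane_eq y Q0 then False else True)"

fun classified :: "bool \<Rightarrow> plane \<Rightarrow> plane \<Rightarrow> plane \<Rightarrow> bool" where
  "classified True r1 r2 r3 = True"
| "classified False r1 r2 r3 = either (list_ex (\<lambda>x. list_ex (\<lambda>y. contains_form (plane_form x y) x y r1 r2 r3) [r1, r2, r3]) [r1, r2, r3])
     (list_ex (\<lambda>y. contains_fan y r1 r2 r3) [r1, r2, r3])"

definition "all_plane = [Q0,Q1,Q2,Q3,Q4,Q5,Q6,Q7,Q8]"

lemma all_classified: "list_all (\<lambda>r1. list_all (\<lambda>r2. list_all (\<lambda>r3. classified (either (plane_eq r1 r2) (either (plane_eq r2 r3) (plane_eq r1 r3))) r1 r2 r3) all_plane) all_plane) all_plane"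
  by code_simp

text \<open>If the form vanishes on all pairs, the three vectors make up a line
  \<open>{0, y, -y}\<close>. Otherwise two of them, in the right order, form a symplectic basis, and
  a suitable choice of this pair brings the third into the list.\<close>

lemma three_classified:
  assumes "r1 \<noteq> r2" "r2 \<noteq> r3" "r1 \<noteq> r3"
  shows "\<exists>x y. plane_form x y = Z1 \<and> ({Q0, x, y} \<subseteq> {r1, r2, r3} \<or> {Q0, y, trit_scale Z2 y} \<subseteq> {r1, r2, r3} \<or> {y, trit_scale Z2 y, x} \<subseteq> {r1, r2, r3} \<or>
    {x, y, trit_scale Z2 (plane_add x y)} \<subseteq> {r1, r2, r3} \<or> {x, y, plane_add x y} \<subseteq> {r1, r2, r3})"
proof -
  have all: "r \<in> set all_plane" for r by (cases r) (auto simp: all_plane_def)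
  have ne: "either (plane_eq r1 r2) (either (plane_eq r2 r3) (plane_eq r1 r3)) = False" using assms by simp
  note all_classified[unfolded list_all_iff]
  note bspec[OF bspec[OF bspec[OF this all[of r1]] all[of r2]] all[of r3]]
  from this[unfolded ne] have f: "classified False r1 r2 r3" .
  define R where "R = {r1, r2, r3}"
  have in3: "one_of x r1 r2 r3 \<longleftrightarrow> x \<in> R" for x by (auto simp: R_def)
  consider x y where "x \<in> R" "y \<in> R" "contains_form (plane_form x y) x y r1 r2 r3" | y where "y \<in> R" "contains_fan y r1 r2 r3"
    using f unfolding classified.simps either_iff list_ex_iff list.set R_def[symmetric] by blast
  then show ?thesis
    unfolding R_def[symmetric]
  proof cases
    case (1 x y)
    from 1(3) have w: "plane_form x y = Z1" by (cases "plane_form x y") (simp_all only: contains_form.simps)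
    with 1(3) have "contains_form Z1 x y r1 r2 r3" by (simp only:)
    then have "Q0 \<in> R \<or> trit_scale Z2 y \<in> R \<or> trit_scale Z2 (plane_add x y) \<in> R \<or> plane_add x y \<in> R"
      unfolding contains_form.simps either_iff in3 .
    with 1(1,2) show "\<exists>x y. plane_form x y = Z1 \<and> ({Q0, x, y} \<subseteq> R \<or> {Q0, y, trit_scale Z2 y} \<subseteq> R \<or> {y, trit_scale Z2 y, x} \<subseteq> R \<or>
      {x, y, trit_scale Z2 (plane_add x y)} \<subseteq> R \<or> {x, y, plane_add x y} \<subseteq> R)"
      by (intro exI[of _ x] exI[of _ y] conjI w) blast
  next
    case (2 y)
    then have "Q0 \<in> R" "trit_scale Z2 y \<in> R" and y: "y \<noteq> Q0"
      unfolding contains_fan.simps both_iff in3 by (auto split: if_splits)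
    moreover obtain x where "plane_form x y = Z1" using y by (cases y) (metis plane_form.simps)+
    ultimately show "\<exists>x y. plane_form x y = Z1 \<and> ({Q0, x, y} \<subseteq> R \<or> {Q0, y, trit_scale Z2 y} \<subseteq> R \<or> {y, trit_scale Z2 y, x} \<subseteq> R \<or>
      {x, y, trit_scale Z2 (plane_add x y)} \<subseteq> R \<or> {x, y, plane_add x y} \<subseteq> R)"
      using 2(1) by (intro exI[of _ x] exI[of _ y] conjI) blast+
  qed
qed

lemma minus_one_scale: "- 1 *s x = - (x::P)"
  by (rule vector_sneg_minus1[symmetric])

context framed
begin

lemma Tr_pair_c: "{a0, b0, - (a0 + b0 + (x_of r *s e0 + y_of r *s f0))} \<in> Y \<Longrightarrow> oriented vA vB (V Q8 (trit_scale Z2 r))"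
proof -
  assume y: "{a0, b0, - (a0 + b0 + (x_of r *s e0 + y_of r *s f0))} \<in> Y"
  have "\<phi> vA = a0" "\<phi> vB = b0" by simp_all
  moreover have "\<phi> (V Q8 (trit_scale Z2 r)) = - (a0 + b0 + (x_of r *s e0 + y_of r *s f0))"
    by (simp add: trit_scale_zf minus_one_scale)
  ultimately have "{\<phi> vA, \<phi> vB, \<phi> (V Q8 (trit_scale Z2 r))} \<in> Y" using y by (simp only:)
  then show ?thesis by (rule Tr_I) simp
qed

lemma fan_ok:
  assumes "{a0, b0, - (a0 + b0)} \<in> Y" "{a0, b0, - (a0 + b0 + f0)} \<in> Y" "{a0, b0, - (a0 + b0 - f0)} \<in> Y"
  shows "\<forall>t\<in>set fan. triangle_ok t"
  using Tr_pair_c[of Q0] Tr_pair_c[of Q1] Tr_pair_c[of Q2] assms by (simp add: fan_def minus_one_scale)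

lemma no_i:
  assumes "{a0, b0, - (a0 + b0)} \<in> Y" "{a0, b0, - (a0 + b0 + f0)} \<in> Y" "{a0, b0, - (a0 + b0 - f0)} \<in> Y"
    and "{b0, - (a0 + b0), a0 - e0} \<in> Y"
  shows False
proof -
  have "\<phi> vB = b0" "\<phi> (V Q8 Q0) = - (a0 + b0)" "\<phi> (V Q3 Q6) = a0 - e0" by (simp_all add: minus_one_scale)
  then have "oriented vB (V Q8 Q0) (V Q3 Q6)" using assms(4) by (intro Tr_I) simp_all
  then show False using fan_ok[OF assms(1-3)] by (intro refutes_sound[OF refuted_fan_zero]) auto
qed

lemma no_iii:
  assumes "{a0, b0, - (a0 + b0)} \<in> Y" "{a0, b0, - (a0 + b0 + f0)} \<in> Y" "{a0, b0, - (a0 + b0 - f0)} \<in> Y"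
    and "{b0, - (a0 + b0 + f0), a0 - b0 + f0 - e0} \<in> Y \<or> {b0, - (a0 + b0 + f0), a0 + b0 + f0 + e0} \<in> Y"
  shows False
proof -
  have "\<phi> vB = b0" "\<phi> (V Q8 Q2) = - (a0 + b0 + f0)" "\<phi> (V Q5 Q7) = a0 - b0 + f0 - e0" "\<phi> (V Q4 Q4) = a0 + b0 + f0 + e0"
    by (simp_all add: minus_one_scale)
  then have "oriented vB (V Q8 Q2) (V Q5 Q7) \<or> oriented vB (V Q8 Q2) (V Q4 Q4)" using assms(4) by (auto intro!: Tr_I simp del: \<phi>.simps)
  then show False
  proof
    assume "oriented vB (V Q8 Q2) (V Q5 Q7)"
    then show False using fan_ok[OF assms(1-3)] by (intro refutes_sound[OF refuted_fan_minus]) auto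
  next
    assume "oriented vB (V Q8 Q2) (V Q4 Q4)"
    then show False using fan_ok[OF assms(1-3)] by (intro refutes_sound[OF refuted_fan_plus]) auto
  qed
qed

text \<open>A continuation of the fan at the edge \<open>b, c\<close> that leaves the cosets of \<open>f\<close> can be brought into one of
  three shapes by replacing \<open>f\<close> by \<open>\<plusminus>f\<close> and changing \<open>e\<close>.\<close>

lemma off_coset:
  assumes Y3: "{a0, b0, - (a0 + b0)} \<in> Y" "{a0, b0, - (a0 + b0 + f0)} \<in> Y" "{a0, b0, - (a0 + b0 - f0)} \<in> Y"
    and k: "c = - (a0 + b0 + k *s f0)" and T: "{b0, c, w} \<in> Y"
  shows "b0 + c + w \<in> {0, f0, - f0}"
proof (rule ccontr)
  assume no: "\<not> ?thesis"
  define D where "D = - (b0 + c + w)"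
  have w: "w = - (b0 + c + D)" by (simp add: D_def)
  obtain i j m l where D: "D = i *s a0 + j *s b0 + m *s e0 + l *s f0"
    using symplectic_basis_spans[of a0 b0 e0 f0 D] ab ef \<sigma> orth by auto
  have bal: "bal b0 c w" using trisD(4)[OF Y_tris[OF T]] .
  have bc: "\<omega> b0 c = \<sigma>" using orth form_swapped by (simp add: k)
  then have "\<omega> c w = \<sigma>" "\<omega> w b0 = \<sigma>" using bal by (auto simp: bal_def)
  then have "\<omega> b0 D = 0" "\<omega> c D = 0"
    using bc \<omega>_swap[of c b0] \<omega>_swap[of b0 w] by (simp_all add: D_def)
  \<comment> \<open>Orthogonality to \<open>b0\<close> kills the coefficient of \<open>a0\<close>;
    orthogonality to \<open>c\<close> ties that of \<open>b0\<close> to that of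
    \<open>e0\<close>.\<close>
  then have "i = 0" and jm: "j = k * m"
    using form_swapped ab ef orth \<sigma> by (auto simp: D k algebra_simps)
  then have D: "D = (k * m) *s b0 + m *s e0 + l *s f0" using D by simp
  have m: "m \<noteq> 0"
  proof
    assume "m = 0"
    then have "D = l *s f0" using D by simp
    then have "b0 + c + w = - (l *s f0)" by (metis D_def minus_minus)
    then show False using no by (cases l rule: F3_cases) (auto simp: minus_one_scale)
  qed
  have mm: "m * m = 1" using m by (rule F3_square)
  show False
  proof (cases "k = 0")
    case True
    \<comment> \<open>For \<open>k = 0\<close> the vector \<open>D\<close> lies in the plane of
      \<open>e0, f0\<close> and replaces \<open>e0\<close>; the factor \<open>m\<close> keeps the
      value \<open>\<sigma>\<close>, as \<open>m * m = 1\<close>.\<close>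
    interpret F: framed S \<psi> a0 b0 D "m *s f0" \<sigma>
      using orth ab ef nz cS mm by unfold_locales (auto simp: D True \<sigma> form_swapped)
    have "m = 1 \<or> m = -1" using m by (cases m rule: F3_cases) auto
    then have "m *s f0 = f0 \<or> m *s f0 = - f0" by (auto simp: minus_one_scale)
    then have "{a0, b0, - (a0 + b0 + m *s f0)} \<in> Y" "{a0, b0, - (a0 + b0 - m *s f0)} \<in> Y"
      using Y3 by (elim disjE; simp only: add_uminus_conv_diff diff_minus_eq_add)+
    moreover have "{b0, - (a0 + b0), a0 - D} \<in> Y" using T unfolding w k True
      by (simp add: insert_commute)
    ultimately show False using F.no_i Y3(1) by blast
  next
    case False
    then have kk: "k * k = 1" by (rule F3_square)
    \<comment> \<open>Chosen such that \<open>c = -(a0 + b0 + f1)\<close> and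
      \<open>D = (k * m) *s (b0 + e1)\<close>; the two signs of \<open>k * m\<close> give the two
      shapes of \<open>no_iii\<close>.\<close>
    define f1 e1 where "f1 = k *s f0" and "e1 = k *s e0 + (k * m * l) *s f0"
    interpret F: framed S \<psi> a0 b0 e1 f1 \<sigma>
      using orth ab ef nz cS kk by unfold_locales (auto simp: e1_def f1_def \<sigma> form_swapped)
    have "k = 1 \<or> k = -1" using False by (cases k rule: F3_cases) auto
    then have "f1 = f0 \<or> f1 = - f0" by (auto simp: f1_def minus_one_scale)
    then have "{a0, b0, - (a0 + b0 + f1)} \<in> Y" "{a0, b0, - (a0 + b0 - f1)} \<in> Y"
      using Y3 by (elim disjE; simp only: add_uminus_conv_diff diff_minus_eq_add)+
    moreover have c: "c = - (a0 + b0 + f1)" by (simp add: k f1_def)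
    moreover have "w = a0 - b0 + f1 - e1 \<or> w = a0 + b0 + f1 + e1"
    proof -
      have km: "k = 1 \<or> k = -1" "m = 1 \<or> m = -1" using False m by (cases k rule: F3_cases; cases m rule: F3_cases; simp)+
      then have "D = (k * m) *s (b0 + e1)" unfolding D e1_def by (elim disjE) (simp_all add: minus_one_scale vec_eq_iff)
      moreover have "k * m = 1 \<or> k * m = -1" using km by auto
      ultimately have "D = b0 + e1 \<or> D = - (b0 + e1)" by (auto simp: minus_one_scale)
      moreover have "b0 + b0 = - b0" by (rule P_double)
      ultimately show ?thesis unfolding w c by (elim disjE) (simp_all add: algebra_simps eq_neg_iff_add_eq_0)
    qed
    ultimately show False using F.no_iii[OF Y3(1)] T by auto
  qed
qed

text \<open>Exchanging \<open>a\<close> and \<open>b\<close> and negating \<open>e\<close> yields a symplectic basis for the opposite sign \<open>\<sigma>\<close>, which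
  covers the edges at \<open>a\<close>. What remains are continuations within the cosets of \<open>f\<close>.\<close>

lemma no_fan:
  assumes Y3: "{a0, b0, - (a0 + b0)} \<in> Y" "{a0, b0, - (a0 + b0 + f0)} \<in> Y" "{a0, b0, - (a0 + b0 - f0)} \<in> Y"
  shows False
proof -
  interpret Sw: framed S \<psi> b0 a0 "- e0" f0 "- \<sigma>"
    using form_swapped orth ef \<sigma> nz cS by unfold_locales simp_all
  have Y3': "{b0, a0, - (b0 + a0)} \<in> Y" "{b0, a0, - (b0 + a0 + f0)} \<in> Y" "{b0, a0, - (b0 + a0 - f0)} \<in> Y"
    using Y3 by (simp_all only: insert_commute add.commute)
  have fan: "\<forall>t\<in>set fan. triangle_ok t" by (rule fan_ok[OF Y3])
  then have T0: "oriented vA vB (V Q8 r)" if "r \<in> {Q0, Q1, Q2}" for r using that by (auto simp: fan_def)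
  have \<phi>c: "\<phi> (V Q8 r) = - (a0 + b0 + (- y_of r) *s f0)" if "r \<in> {Q0, Q1, Q2}" for r
    using that by (auto simp: minus_one_scale)
  have in_coset: "x \<in> {V Q0 Q0, V Q0 Q1, V Q0 Q2}" if "\<phi> x \<in> {0, f0, - f0}" for x
  proof -
    have "\<phi> (V Q0 Q0) = 0" "\<phi> (V Q0 Q1) = f0" "\<phi> (V Q0 Q2) = - f0" by (simp_all add: minus_one_scale)
    then show ?thesis using that \<phi>_inj by (metis insert_iff empty_iff)
  qed
  have ab: "\<phi> vA = a0" "\<phi> vB = b0" by simp_all
  have J: "\<exists>j\<in>{Q1, Q2}. oriented vB (V Q8 r) (V Q3 j)" if r: "r \<in> {Q0, Q1, Q2}" for r
  proof -
    obtain z where z: "z \<noteq> vA" "oriented vB (V Q8 r) z" using other_oriented[OF oriented_rot[OF T0[OF r]]] by blast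
    have "b0 + \<phi> (V Q8 r) + \<phi> z \<in> {0, f0, - f0}"
      using oriented_facts(11)[OF z(2)] unfolding ab by (rule off_coset[OF Y3 \<phi>c[OF r]])
    then have "vect_add (vect_add vB (V Q8 r)) z \<in> {V Q0 Q0, V Q0 Q1, V Q0 Q2}"
      by (intro in_coset) (simp only: \<phi>_add ab)
    then have "z = V Q3 Q1 \<or> z = V Q3 Q2"
    proof -
      obtain p t where pt: "z = V p t" by (cases z)
      show ?thesis
        using \<open>vect_add _ _ \<in> _\<close> z(1) r unfolding pt by (cases p; elim insertE emptyE; simp; cases t; simp)
    qed
    then show ?thesis using z by auto
  qed
  have K: "\<exists>k\<in>{Q1, Q2}. oriented (V Q8 r) vA (V Q1 k)" if r: "r \<in> {Q0, Q1, Q2}" for r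
  proof -
    obtain z where z: "z \<noteq> vB" "oriented (V Q8 r) vA z" using other_oriented[OF oriented_rot[OF oriented_rot[OF T0[OF r]]]] by blast
    have "{a0, \<phi> (V Q8 r), \<phi> z} \<in> Y" using oriented_facts(11)[OF z(2)] unfolding ab by (simp only: insert_commute)
    moreover have "\<phi> (V Q8 r) = - (b0 + a0 + (- y_of r) *s f0)" using \<phi>c[OF r] by (simp only: add.commute)
    ultimately have "a0 + \<phi> (V Q8 r) + \<phi> z \<in> {0, f0, - f0}" by (intro Sw.off_coset[OF Y3'])
    then have "vect_add (vect_add vA (V Q8 r)) z \<in> {V Q0 Q0, V Q0 Q1, V Q0 Q2}"
      by (intro in_coset) (simp only: \<phi>_add ab)
    then have "z = V Q1 Q1 \<or> z = V Q1 Q2"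
    proof -
      obtain p t where pt: "z = V p t" by (cases z)
      show ?thesis
        using \<open>vect_add _ _ \<in> _\<close> z(1) r unfolding pt by (cases p; elim insertE emptyE; simp; cases t; simp)
    qed
    then show ?thesis using z by auto
  qed
  obtain j0 where j0: "j0 \<in> {Q1, Q2}" "oriented vB (V Q8 Q0) (V Q3 j0)" using J[of Q0] by blast
  obtain k0 where k0: "k0 \<in> {Q1, Q2}" "oriented (V Q8 Q0) vA (V Q1 k0)" using K[of Q0] by blast
  obtain j1 where j1: "j1 \<in> {Q1, Q2}" "oriented vB (V Q8 Q2) (V Q3 j1)" using J[of Q2] by blast
  obtain k1 where k1: "k1 \<in> {Q1, Q2}" "oriented (V Q8 Q2) vA (V Q1 k1)" using K[of Q2] by blast
  obtain j2 where j2: "j2 \<in> {Q1, Q2}" "oriented vB (V Q8 Q1) (V Q3 j2)" using J[of Q1] by blast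
  obtain k2 where k2: "k2 \<in> {Q1, Q2}" "oriented (V Q8 Q1) vA (V Q1 k2)" using K[of Q1] by blast
  have both_signs: "p x" if "both_signs p" "x \<in> {Q1, Q2}" for p x using that by (auto simp: both_signs_def)
  have "refutes (coset_tris j0 k0 j1 k1 j2 k2 @ fan)"
    by (rule both_signs[OF both_signs[OF both_signs[OF both_signs[OF both_signs[OF both_signs[OF all_coset_list[OF refuted_fan_cosets] j0(1)] k0(1)] j1(1)] k1(1)] j2(1)] k2(1)])
  then show False by (rule refutes_sound) (use j0 k0 j1 k1 j2 k2 fan in \<open>auto simp: coset_tris_def\<close>)
qed

end

lemma no_min_cycle:
  assumes "min_cycle S \<psi>" "0 \<notin> S" "card S \<le> 16"
  shows False
proof -
  interpret min_cycle S \<psi> by fact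
  obtain E T1 T2 T3 where E: "card E = 2" and T: "T1 \<in> Y" "T2 \<in> Y" "T3 \<in> Y" "T1 \<noteq> T2" "T2 \<noteq> T3" "T1 \<noteq> T3"
    "E \<subseteq> T1" "E \<subseteq> T2" "E \<subseteq> T3" using heavy_edge by blast
  obtain a b where ab: "E = {a, b}" "a \<noteq> b" using E by (auto simp: card_2_iff)
  have third: "\<exists>d. T = {a, b, - (a + b + d)} \<and> \<omega> a d = 0 \<and> \<omega> b d = 0 \<and> \<omega> a b \<noteq> 0" if "T \<in> Y" "E \<subseteq> T" for T
  proof -
    have "card (T - {a, b}) = 1"
      using card_tri[OF Y_tris[OF that(1)]] that(2) ab by (subst card_Diff_subset) auto
    then obtain c where c: "T - {a, b} = {c}" by (rule card_1_singletonE)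
    then have Tc: "T = {a, b, c}" using that(2) ab by blast
    have "bal a b c" using trisD(4) Y_tris that(1) unfolding Tc by blast
    then have "\<omega> a (- (a + b + c)) = 0" "\<omega> b (- (a + b + c)) = 0" "\<omega> a b \<noteq> 0"
      using \<omega>_swap[of a b] \<omega>_swap[of a c] by (auto simp: bal_def)
    then show ?thesis using Tc by (intro exI[of _ "- (a + b + c)"]) simp
  qed
  obtain d1 where d1: "T1 = {a, b, - (a + b + d1)}" "\<omega> a d1 = 0" "\<omega> b d1 = 0" and nz: "\<omega> a b \<noteq> 0" using third[OF T(1,7)] by blast
  obtain d2 where d2: "T2 = {a, b, - (a + b + d2)}" "\<omega> a d2 = 0" "\<omega> b d2 = 0" using third[OF T(2,8)] by blast
  obtain d3 where d3: "T3 = {a, b, - (a + b + d3)}" "\<omega> a d3 = 0" "\<omega> b d3 = 0" using third[OF T(3,9)] by blast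
  have d_distinct: "d1 \<noteq> d2" "d2 \<noteq> d3" "d1 \<noteq> d3" using T(4-6) d1 d2 d3 by auto
  \<comment> \<open>At least one of two distinct vectors is nonzero; it starts a provisional basis,
    used only to write \<open>d1\<close>, \<open>d2\<close>, \<open>d3\<close> in
    coordinates.\<close>
  then obtain d where d: "d \<noteq> 0" "\<omega> a d = 0" "\<omega> b d = 0" using d1 d2 by metis
  obtain e where e: "\<omega> a e = 0" "\<omega> b e = 0" "\<omega> e d = \<omega> a b" using symplectic_partner[OF d(1) nz d(2,3) nz] by blast
  interpret F: framed S \<psi> a b e d "\<omega> a b"
    using e d nz assms by unfold_locales auto
  define vec where "vec r = x_of r *s e + y_of r *s d" for r
  have coord: "\<exists>r. w = vec r" if w: "\<omega> a w = 0" "\<omega> b w = 0" for w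
  proof -
    obtain x where x: "F.\<phi> x = w" by (rule F.\<phi>_surj)
    obtain p r where v: "x = V p r" by (cases x)
    have "\<omega> a (F.\<phi> x) = 0" "\<omega> b (F.\<phi> x) = 0" using w x by auto
    then have "x_of p = 0" "y_of p = 0" using nz F.form_swapped F.orth by (auto simp: v)
    then show ?thesis using x by (intro exI[of _ r]) (simp add: v vec_def)
  qed
  obtain r1 r2 r3 where r: "d1 = vec r1" "d2 = vec r2" "d3 = vec r3"
    using coord[OF d1(2,3)] coord[OF d2(2,3)] coord[OF d3(2,3)] by blast
  define R where "R = {r1, r2, r3}"
  have "r1 \<noteq> r2" "r2 \<noteq> r3" "r1 \<noteq> r3" using d_distinct r by auto
  from three_classified[OF this, folded R_def] obtain x y where w: "plane_form x y = Z1"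
    and xy: "{Q0, x, y} \<subseteq> R \<or> {Q0, y, trit_scale Z2 y} \<subseteq> R \<or> {y, trit_scale Z2 y, x} \<subseteq> R \<or>
    {x, y, trit_scale Z2 (plane_add x y)} \<subseteq> R \<or> {x, y, plane_add x y} \<subseteq> R" by blast
  have YY: "{a, b, - (a + b + vec s)} \<in> Y" if "s \<in> R" for s
    using that T(1-3) d1(1) d2(1) d3(1) r unfolding R_def by auto
  have "x_of x * y_of y - y_of x * x_of y = 1" using plane_form_zf[of x y] w by simp
  moreover have "\<omega> (vec x) (vec y) = \<omega> a b * (x_of x * y_of y - y_of x * x_of y)"
    using F.form_swapped e by (simp add: vec_def algebra_simps)
  ultimately have "\<omega> (vec x) (vec y) = \<omega> a b" by (simp only: mult_1_right)
  \<comment> \<open>The final basis, in which the three triangles have one of the standard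
    shapes.\<close>
  then interpret K: framed S \<psi> a b "vec x" "vec y" "\<omega> a b"
    using e d nz assms by unfold_locales (auto simp: vec_def)
  have base_tri_ok: "K.oriented vA vB (V Q8 (trit_scale Z2 t))" if "x_of t *s vec x + y_of t *s vec y = vec s" "s \<in> R" for s t
    using YY[OF that(2)] by (intro K.Tr_pair_c) (simp only: that(1))
  have comb: "x_of Q0 *s vec x + y_of Q0 *s vec y = vec Q0" "x_of Q3 *s vec x + y_of Q3 *s vec y = vec x" "x_of Q1 *s vec x + y_of Q1 *s vec y = vec y"
    "x_of Q2 *s vec x + y_of Q2 *s vec y = vec (trit_scale Z2 y)" "x_of Q8 *s vec x + y_of Q8 *s vec y = vec (trit_scale Z2 (plane_add x y))"
    "x_of Q4 *s vec x + y_of Q4 *s vec y = vec (plane_add x y)"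
    by (simp_all add: vec_def trit_scale_zf x_of_add y_of_add vec_eq_iff algebra_simps)
  from xy consider "Q0 \<in> R" "x \<in> R" "y \<in> R"
    | "Q0 \<in> R" "y \<in> R" "trit_scale Z2 y \<in> R"
    | "y \<in> R" "trit_scale Z2 y \<in> R" "x \<in> R"
    | "x \<in> R" "y \<in> R" "trit_scale Z2 (plane_add x y) \<in> R"
    | "x \<in> R" "y \<in> R" "plane_add x y \<in> R"
    by blast
  then show False
  proof cases
    case 1
    show ?thesis by (rule K.refutes_sound[OF refuted_0ef]) (simp add: base_tri_ok[OF comb(1) 1(1), unfolded trit_scale.simps] base_tri_ok[OF comb(2) 1(2), unfolded trit_scale.simps] base_tri_ok[OF comb(3) 1(3), unfolded trit_scale.simps])
  next
    case 2
    have v: "vec Q0 = 0" "vec (trit_scale Z2 y) = - vec y" by (simp_all add: vec_def trit_scale_zf minus_one_scale)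
    show ?thesis
      using YY[OF 2(1)] YY[OF 2(2)] YY[OF 2(3)] unfolding v by (intro K.no_fan) simp_all
  next
    case 3
    show ?thesis by (rule K.refutes_sound[OF refuted_opposite]) (simp add: base_tri_ok[OF comb(3) 3(1), unfolded trit_scale.simps] base_tri_ok[OF comb(4) 3(2), unfolded trit_scale.simps] base_tri_ok[OF comb(2) 3(3), unfolded trit_scale.simps])
  next
    case 4
    show ?thesis by (rule K.refutes_sound[OF refuted_zero_sum]) (simp add: base_tri_ok[OF comb(2) 4(1), unfolded trit_scale.simps] base_tri_ok[OF comb(3) 4(2), unfolded trit_scale.simps] base_tri_ok[OF comb(5) 4(3), unfolded trit_scale.simps])
  next
    case 5
    show ?thesis by (rule K.refutes_sound[OF refuted_sum]) (simp add: base_tri_ok[OF comb(2) 5(1), unfolded trit_scale.simps] base_tri_ok[OF comb(3) 5(2), unfolded trit_scale.simps] base_tri_ok[OF comb(6) 5(3), unfolded trit_scale.simps])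
  qed
qed

subsection \<open>From lists to sets of values\<close>

text \<open>Pairing the combination with \<open>x\<close> and with \<open>y\<close> leaves
  differences of coefficients times the common nonzero value.\<close>

lemma vanishing_combination:
  assumes "\<omega> x y = \<omega> y z" "\<omega> y z = \<omega> z x" "\<omega> z x \<noteq> 0" and zero: "i *s x + j *s y + k *s z = 0"
  shows "i = j \<and> j = k"
proof -
  have sw: "\<omega> y x = - \<omega> x y" "\<omega> z y = - \<omega> y z" "\<omega> x z = - \<omega> z x" by (rule \<omega>_swap)+
  have "\<omega> x (i *s x + j *s y + k *s z) = 0" "\<omega> y (i *s x + j *s y + k *s z) = 0"
    unfolding zero by simp_all
  then have "(j - k) * \<omega> z x = 0" "(k - i) * \<omega> z x = 0"
    using assms(1,2) sw by (simp_all add: algebra_simps)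
  then show ?thesis using assms(3) by simp
qed

lemma dependent_sum_zero:
  assumes bal: "\<omega> x y = \<omega> y z" "\<omega> y z = \<omega> z x" "\<omega> z x \<noteq> 0" and dep: "vec.dependent {x, y, z}"
  shows "x + y + z = 0"
proof -
  have ne: "x \<noteq> y" "y \<noteq> z" "x \<noteq> z" using bal by auto
  obtain g w where g: "(\<Sum>v\<in>{x, y, z}. g v *s v) = 0" "w \<in> {x, y, z}" "g w \<noteq> 0"
    using dep unfolding vec.dependent_finite[OF finite.insertI[OF finite.insertI[OF finite.insertI[OF finite.emptyI]]]] by blast
  then have s: "g x *s x + g y *s y + g z *s z = 0" using ne by (simp add: add.assoc)
  have e: "g x = g y \<and> g y = g z" by (rule vanishing_combination[OF bal s])
  then have "g x \<noteq> 0" using g(2,3) by auto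
  moreover have "g x *s (x + y + z) = 0" using s e by (simp add: vector_add_ldistrib)
  ultimately show ?thesis by simp
qed

theorem theorem3p1:
  fixes I :: "'i set" and u :: "'i \<Rightarrow> P"
  assumes "finite I" and "card I \<le> 16" and "\<And>i. i \<in> I \<Longrightarrow> u i \<noteq> 0"
  shows "\<exists>\<rho>. edge_potential I u \<rho>"
proof -
  define H where "H = {h. \<exists>l\<in>I. \<exists>m\<in>I. l \<noteq> m \<and> u l = h \<and> u m = h}"
  define S where "S = u ` I \<union> uminus ` H"
  have H: "H \<subseteq> u ` I" by (auto simp: H_def)
  have fin: "finite S" using assms(1) H by (auto simp: S_def intro: finite_subset)
  have nz: "0 \<notin> S" using assms(3) by (auto simp: S_def H_def)
  have "card H + card (u ` I) \<le> card I"
  proof -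
    \<comment> \<open>One index is set aside for each value; a value occurring twice still has an
      index among the rest, so \<open>H\<close> injects into the indices left over.\<close>
    define f where "f v = (SOME i. i \<in> I \<and> u i = v)" for v
    have f: "f v \<in> I \<and> u (f v) = v" if "v \<in> u ` I" for v
      unfolding f_def by (rule someI_ex) (use that in auto)
    have "H \<subseteq> u ` (I - f ` (u ` I))"
    proof
      fix h assume "h \<in> H"
      then obtain l m where lm: "l \<in> I" "m \<in> I" "l \<noteq> m" "u l = h" "u m = h" by (auto simp: H_def)
      have "\<exists>n\<in>{l, m}. n \<noteq> f h" using lm(3) by auto
      then obtain n where n: "n \<in> I" "u n = h" "n \<noteq> f h" using lm by auto
      have "n \<notin> f ` (u ` I)" using n f by force
      then show "h \<in> u ` (I - f ` (u ` I))" using n by blast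
    qed
    then have "card H \<le> card (I - f ` (u ` I))"
      using assms(1) by (meson card_image_le card_mono finite_Diff finite_imageI order_trans)
    also have "\<dots> = card I - card (f ` (u ` I))"
      using assms(1) f by (intro card_Diff_subset) auto
    also have "card (f ` (u ` I)) = card (u ` I)"
      using f by (intro card_image inj_onI) metis
    finally show ?thesis using card_image_le[OF assms(1), of u] by linarith
  qed
  moreover have "card S \<le> card (u ` I) + card (uminus ` H)" unfolding S_def by (rule card_Un_le)
  moreover have "card (uminus ` H) \<le> card H"
    using assms(1) H by (intro card_image_le) (auto intro: finite_subset)
  ultimately have card: "card S \<le> 16" using assms(2) by linarith
  obtain R where R: "\<And>a b c. {a, b, c} \<in> tris S \<Longrightarrow> R {a, b} + R {a, c} + R {b, c} = (1::F3)"
    using potential_or_min_cycle[OF fin] no_min_cycle[OF _ nz card] by blast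
  \<comment> \<open>The potential depends on values only; in a balanced triple these are distinct,
    so edges go to edges.\<close>
  define \<rho> where "\<rho> A = R (u ` A)" for A
  have "\<rho> {i, j} + \<rho> {i, k} + \<rho> {j, k} = 1" if act: "{i, j, k} \<in> active_triples I u" for i j k
  proof -
    have "\<exists>p q r. {i, j, k} = {p, q, r} \<and> balanced I u p q r \<and> - (u p + u q + u r) \<in> insert 0 S"
      using act unfolding active_triples_def
    proof (elim UnE)
      assume "{i, j, k} \<in> dependent_triples I u"
      then obtain p q r where e: "{i, j, k} = {p, q, r}" and b: "balanced I u p q r" and d: "vec.dependent {u p, u q, u r}"
        unfolding dependent_triples_def by blast
      have "u p + u q + u r = 0" using b d by (intro dependent_sum_zero) (auto simp: balanced_def)
      then show ?thesis using e b by (intro exI[of _ p] exI[of _ q] exI[of _ r]) simp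
    next
      assume "{i, j, k} \<in> active_independent_triples I u"
      then obtain p q r where e: "{i, j, k} = {p, q, r}" and b: "balanced I u p q r"
        and h: "(\<exists>l\<in>I. u l = - (u p + u q + u r)) \<or>
          (\<exists>l\<in>I. \<exists>m\<in>I. l \<noteq> m \<and> u l = u p + u q + u r \<and> u m = u p + u q + u r)"
        unfolding active_independent_triples_def Let_def mem_Collect_eq by (elim exE conjE) (rule that; assumption)
      have "- (u p + u q + u r) \<in> S"
        using h
      proof
        assume "\<exists>l\<in>I. u l = - (u p + u q + u r)"
        then show ?thesis unfolding S_def by (metis UnI1 imageI)
      next
        assume "\<exists>l\<in>I. \<exists>m\<in>I. l \<noteq> m \<and> u l = u p + u q + u r \<and> u m = u p + u q + u r"
        then have "u p + u q + u r \<in> H" unfolding H_def by (rule CollectI)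
        then show ?thesis unfolding S_def by (intro UnI2 imageI)
      qed
      then show ?thesis using e b by blast
    qed
    then obtain p q r where e: "{i, j, k} = {p, q, r}" and b: "balanced I u p q r"
      and m: "- (u p + u q + u r) \<in> insert 0 S" by blast
    have "{u p, u q, u r} \<in> tris S"
      using b m by (intro trisI) (auto simp: balanced_def bal_def S_def)
    moreover have "{u i, u j, u k} = {u p, u q, u r}" using arg_cong[OF e, of "image u"] by simp
    ultimately have "{u i, u j, u k} \<in> tris S" by simp
    from R[OF this] show ?thesis by (simp add: \<rho>_def)
  qed
  then show ?thesis unfolding edge_potential_def by blast
qed
end
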